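(* Let $D\subset\hat{\mathbb C}$ be topologically open and nonempty. The space $\operatorname{Prob}(\mathcal H_D)$ of Borel probability measures on $(\mathcal H_D,\mathcal T_D)$, with the weak-$*$ topology, is a compact metrizable Hausdorff space.
   Context: A quad in $D$ is a homeomorphism $Q:[0,1]^2\to Q([0,1]^2)\subset D$. $\mathcal Q_D$ is the set of all quads in $D$, with the uniform metric $d(Q_1,Q_2)=\sup_{z\in[0,1]^2}|Q_1(z)-Q_2(z)|$ (with the spherical distance in place of $|\cdot|$ if $\infty\in D$). Write $[Q]:=Q([0,1]^2)$, $\partial_0Q:=Q(\{0\}\times[0,1])$, $\partial_2Q:=Q(\{1\}\times[0,1])$. A crossing of $Q$ is a connected compact subset of $[Q]$ that intersects both $\partial_0Q$ and $\partial_2Q$. For $Q_1,Q_2\in\mathcal Q_D$ write $Q_1\le Q_2$ if every crossing of $Q_2$ contains a crossing of $Q_1$; write $Q_1<Q_2$ if there are open neighborhoods $U_1$ of $Q_1$ and $U_2$ of $Q_2$ in $\mathcal Q_D$ such that $Q\le Q'$ for all $Q\in U_1$, $Q'\in U_2$. A subset $S\subset\mathcal Q_D$ is a lower set if $Q\in S$, $Q'\in\mathcal Q_D$ and $Q'<Q$ imply $Q'\in S$. $\mathcal H_D$ is the collection of all topologically closed lower subsets of $\mathcal Q_D$. $\mathcal T_D$ is the minimal topology on $\mathcal H_D$ containing all sets $V_U:=\{S\in\mathcal H_D: S\cap U\ne\varnothing\}$ ($U\subset\mathcal Q_D$ open) and $V^Q:=\{S\in\mathcal H_D: Q\notin S\}$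 ($Q\in\mathcal Q_D$). The weak-$*$ topology is the one induced by duality with continuous functions on $\mathcal H_D$. *)

theory Defs
  imports "HOL-Probability.Probability"
begin

section \<open>The Riemann sphere\<close>

text \<open>
  The Riemann sphere is the one-point compactification of the complex plane;
  \<open>None\<close> is the point at infinity.
\<close>

definition riemann_sphere :: "complex option topology" where
  "riemann_sphere = Alexandroff_compactification euclidean"

text \<open>
  Inverse stereographic projection onto the unit sphere of the Euclidean space
  \<open>complex \<times> real\<close>, with the point at infinity going to the north pole \<open>(0, 1)\<close>.
\<close>

fun inv_stereographic :: "complex option \<Rightarrow> complex \<times> real" where
  "inv_stereographic None = (0, 1)"
| "inv_stereographic (Some z) =
     ((2 / (1 + (cmod z)\<^sup>2)) *\<^sub>R z, ((cmod z)\<^sup>2 - 1) / ((cmod z)\<^sup>2 + 1))"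

lemma norm_inv_stereographic: "norm (inv_stereographic p) = 1"
proof (cases p)
  case (Some z)
  define n where "n = (cmod z)\<^sup>2"
  have a: "n + 1 \<noteq> 0" using zero_le_power2[of "cmod z"] unfolding n_def by linarith
  have "(2 / (1 + n))\<^sup>2 * n + ((n - 1) / (n + 1))\<^sup>2 = (4 * n + (n - 1)\<^sup>2) / (n + 1)\<^sup>2"
    by (simp add: power_divide add_divide_distrib add.commute)
  also have "4 * n + (n - 1)\<^sup>2 = (n + 1)\<^sup>2"
    by (simp add: power2_eq_square algebra_simps)
  also have "(n + 1)\<^sup>2 / (n + 1)\<^sup>2 = 1"
    using a by simp
  finally show ?thesis
    using Some by (simp add: norm_Pair n_def power_mult_distrib power_divide)
qed (simp add: norm_Pair)

text \<open>Great-circle distance, i.e. the angle between the corresponding unit vectors.\<close>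

definition spherical_dist :: "complex option \<Rightarrow> complex option \<Rightarrow> real" where
  "spherical_dist p q = arccos (inv_stereographic p \<bullet> inv_stereographic q)"

definition point_dist :: "complex option set \<Rightarrow> complex option \<Rightarrow> complex option \<Rightarrow> real" where
  "point_dist D p q = (if None \<in> D then spherical_dist p q else cmod (the p - the q))"


section \<open>Quads and their crossings\<close>

type_synonym quad = "real \<times> real \<Rightarrow> complex option"

definition unit_square :: "(real \<times> real) set" where
  "unit_square = {0..1} \<times> {0..1}"

text \<open>
  A quad is a function on the unit square only; it is represented by a total function
  which is \<open>undefined\<close> off the square (\<open>extensional\<close>).
\<close>

definition quads :: "complex option set \<Rightarrow> quad set" where
  "quads D = {Q. Q \<in> extensional unit_square \<and> Q ` unit_square \<subseteq> D \<and>
     homeomorphic_map (top_of_set unit_square)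
       (subtopology riemann_sphere (Q ` unit_square)) Q}"

text \<open>
  The uniform metric. It is set to \<open>0\<close> outside of \<open>quads D\<close>, because the locale
  \<open>Metric_space\<close> asks for nonnegativity and symmetry on the whole type.
\<close>

definition quad_dist :: "complex option set \<Rightarrow> quad \<Rightarrow> quad \<Rightarrow> real" where
  "quad_dist D Q1 Q2 =
     (if Q1 \<in> quads D \<and> Q2 \<in> quads D
      then SUP z\<in>unit_square. point_dist D (Q1 z) (Q2 z) else 0)"

definition quad_topology :: "complex option set \<Rightarrow> quad topology" where
  "quad_topology D = Metric_space.mtopology (quads D) (quad_dist D)"

definition crossing :: "quad \<Rightarrow> complex option set \<Rightarrow> bool" where
  "crossing Q K \<longleftrightarrow>
     connectedin riemann_sphere K \<and> compactin riemann_sphere K \<and>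
     K \<subseteq> Q ` unit_square \<and>
     K \<inter> Q ` ({0} \<times> {0..1}) \<noteq> {} \<and> K \<inter> Q ` ({1} \<times> {0..1}) \<noteq> {}"

definition quad_le :: "quad \<Rightarrow> quad \<Rightarrow> bool" where
  "quad_le Q1 Q2 \<longleftrightarrow> (\<forall>K. crossing Q2 K \<longrightarrow> (\<exists>L. crossing Q1 L \<and> L \<subseteq> K))"

definition quad_less :: "complex option set \<Rightarrow> quad \<Rightarrow> quad \<Rightarrow> bool" where
  "quad_less D Q1 Q2 \<longleftrightarrow>
     (\<exists>U1 U2. openin (quad_topology D) U1 \<and> openin (quad_topology D) U2 \<and>
        Q1 \<in> U1 \<and> Q2 \<in> U2 \<and> (\<forall>Q\<in>U1. \<forall>Q'\<in>U2. quad_le Q Q'))"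


section \<open>The space of closed lower sets\<close>

definition lower_set :: "complex option set \<Rightarrow> quad set \<Rightarrow> bool" where
  "lower_set D S \<longleftrightarrow>
     S \<subseteq> quads D \<and> (\<forall>Q\<in>S. \<forall>Q'\<in>quads D. quad_less D Q' Q \<longrightarrow> Q' \<in> S)"

definition closed_lower_sets :: "complex option set \<Rightarrow> quad set set" where
  "closed_lower_sets D = {S. closedin (quad_topology D) S \<and> lower_set D S}"

text \<open>
  The whole space is listed among the generators because \<open>topology_generated_by\<close> takes
  the union of the generators as the carrier.
\<close>

definition closed_lower_topology :: "complex option set \<Rightarrow> quad set topology" where
  "closed_lower_topology D = topology_generated_by
     ({closed_lower_sets D} \<union>
      {{S \<in> closed_lower_sets D. S \<inter> U \<noteq> {}} | U. openin (quad_topology D) U} \<union>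
      {{S \<in> closed_lower_sets D. Q \<notin> S} | Q. Q \<in> quads D})"


lemma topspace_closed_lower_topology: "topspace (closed_lower_topology D) = closed_lower_sets D"
  unfolding closed_lower_topology_def by auto


section \<open>Borel probability measures and the weak-* topology\<close>

definition borel_prob_measures :: "'a topology \<Rightarrow> 'a measure set" where
  "borel_prob_measures X =
     {M. prob_space M \<and> space M = topspace X \<and>
         sets M = sigma_sets (topspace X) {U. openin X U}}"

text \<open>
  The coarsest topology making \<open>M \<mapsto> \<integral>f dM\<close> continuous for each continuous
  real-valued \<open>f\<close> on \<open>X\<close>. This is meant for compact \<open>X\<close>, where every such \<open>f\<close> is bounded,
  hence integrable.
\<close>

definition weak_star_topology :: "'a topology \<Rightarrow> 'a measure topology" where
  "weak_star_topology X = topology_generated_by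
     {{M \<in> borel_prob_measures X. (\<integral>x. f x \<partial>M) \<in> V} | f V.
        continuous_map X euclideanreal f \<and> open V}"

lemma topspace_weak_star_topology:
  "topspace (weak_star_topology X) = borel_prob_measures X"
proof -
  have "borel_prob_measures X \<subseteq> topspace (weak_star_topology X)"
    unfolding weak_star_topology_def topology_generated_by_topspace
    by (rule Union_upper, rule CollectI, rule exI[of _ "\<lambda>_. 0"], rule exI[of _ UNIV]) simp
  moreover have "topspace (weak_star_topology X) \<subseteq> borel_prob_measures X"
    unfolding weak_star_topology_def topology_generated_by_topspace by (rule Union_least) blast
  ultimately show ?thesis by (rule equalityI[rotated])
qed

end

theory Submission
  imports Defs "HOL-Complex_Analysis.Complex_Analysis"
begin

text \<open>
  The strict order on quads is open and transitive, and every quad is a limit of quads strictly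
  below it. For such an order on a second countable space, Alexander's subbase theorem makes the
  space of closed lower sets compact, and the approximation property makes it Hausdorff and second
  countable.

  To push a quad strictly below itself one needs room outside of its image. The complement of the
  image is a Jordan domain once the image of the centre of the square is sent to infinity, so by
  Caratheodory's theorem its closure is a closed disc, and the quad extends radially to an
  embedding of the whole plane into the sphere. Restricting this embedding to a slightly
  narrower and taller rectangle gives the quad below. Caratheodory's theorem follows from Koebe's
  lemma, Janiszewski's theorem and the maximum principle.

  For a compact second countable Hausdorff space, recording membership in a countable base
  gives a Borel injection into the real line through which every continuous function is the
  restriction of a bounded continuous function on the line. Thus Helly's selection theorem on the
  line yields sequential compactness of the space of probability measures, and countably many
  continuous functions determine a measure.
\<close>

section \<open>Probability measures on a compact space\<close>

text \<open>\<open>quad_less\<close> asks for stability: the quad below \<open>Q\<close> has to stay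
  below when both quads are slightly perturbed. In a chart in which \<open>Q\<close> is the
  identity, a crossing of a quad near \<open>Q\<close> is a continuum in a slightly enlarged square
  that almost reaches both vertical sides. A perturbed narrower and taller rectangle still contains
  the part of the middle vertical line in that enlarged square, by Brouwer's theorem. If no
  connected part of the continuum inside the rectangle joined its vertical sides, the cut wire fence
  theorem would separate these sides within it, and the continuum itself would fall apart.

  In Caratheodory's theorem, Janiszewski's theorem joins nearby points of the Jordan domain by paths
  of small diameter. Koebe's lemma shows that a Riemann map cannot blow up such paths near the
  boundary, which gives uniform continuity; the maximum principle keeps the extension injective.

  The code of a point is in general a discontinuous function of it; it is the return from codes to
  points that is continuous. A weak limit of measures on codes lives on the closure of the codes, so
  limits of codes have to be decoded as well.\<close>

lemma ternary_expansion_lower_bound: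
  fixes d :: "nat \<Rightarrow> real"
  assumes d: "\<And>k. \<bar>d k\<bar> \<le> 1" "\<And>k. k < n \<Longrightarrow> d k = 0" "\<bar>d n\<bar> = 1"
  shows "(1/3) ^ n / 2 \<le> \<bar>\<Sum>k. d k * (1/3) ^ k\<bar>"
proof -
  have bd: "norm (d k * (1/3) ^ k) \<le> (1/3) ^ k" for k
    using d(1)[of k] by (simp add: abs_mult mult_left_le_one_le)
  have sum3: "summable (\<lambda>k. (1/3::real) ^ k)" by (rule summable_geometric) simp
  have summ: "summable (\<lambda>k. d k * (1/3) ^ k)"
    by (rule summable_comparison_test'[OF sum3]) (rule bd)
  have "(\<Sum>k<Suc n. d k * (1/3) ^ k) = d n * (1/3) ^ n"
    using d(2) by simp
  then have eq: "(\<Sum>k. d k * (1/3) ^ k) = (\<Sum>k. d (k + Suc n) * (1/3) ^ (k + Suc n)) + d n * (1/3) ^ n"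
    using suminf_split_initial_segment[OF summ, of "Suc n"] by simp
  \<comment> \<open>In base 3 the digits after the first nonzero one contribute at most half of its
    weight. In base 2 they could cancel it entirely.\<close>
  have "norm (\<Sum>k. d (k + Suc n) * (1/3) ^ (k + Suc n)) \<le> (\<Sum>k. (1/3) ^ (k + Suc n))"
    by (rule norm_suminf_le[OF bd summable_ignore_initial_segment[OF sum3]])
  also have "\<dots> = (\<Sum>k. (1/3::real) ^ k * (1/3) ^ Suc n)" by (simp only: power_add)
  also have "\<dots> = (\<Sum>k. (1/3::real) ^ k) * (1/3) ^ Suc n" by (rule suminf_mult2[OF sum3, symmetric])
  also have "\<dots> = (1/3) ^ n / 2" using suminf_geometric[of "1/3::real"] by simp
  finally have "\<bar>\<Sum>k. d (k + Suc n) * (1/3) ^ (k + Suc n)\<bar> \<le> (1/3) ^ n / 2" by simp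
  moreover have "\<bar>d n * (1/3) ^ n\<bar> = (1/3) ^ n" using d(3) by (simp add: abs_mult)
  ultimately show ?thesis unfolding eq by linarith
qed

lemma space_borel_prob_measures: "M \<in> borel_prob_measures X \<Longrightarrow> space M = topspace X"
  and sets_borel_prob_measures: "M \<in> borel_prob_measures X \<Longrightarrow> sets M = sigma_sets (topspace X) {U. openin X U}"
  and prob_space_borel_prob_measures: "M \<in> borel_prob_measures X \<Longrightarrow> prob_space M"
  by (auto simp: borel_prob_measures_def)

lemma openin_sets_borel_prob: "M \<in> borel_prob_measures X \<Longrightarrow> openin X U \<Longrightarrow> U \<in> sets M"
  by (auto simp: sets_borel_prob_measures)

lemma continuous_map_borel_measurable:
  assumes "M \<in> borel_prob_measures X" "continuous_map X euclideanreal f"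
  shows "f \<in> borel_measurable M"
proof (rule borel_measurableI)
  fix S :: "real set" assume "open S"
  then have "openin X {x \<in> topspace X. f x \<in> S}"
    using assms(2) by (intro openin_continuous_map_preimage) auto
  moreover have "f -` S \<inter> space M = {x \<in> topspace X. f x \<in> S}"
    using space_borel_prob_measures[OF assms(1)] by auto
  ultimately show "f -` S \<inter> space M \<in> sets M"
    using openin_sets_borel_prob[OF assms(1)] by simp
qed

section \<open>Ternary codes of points and transfer of continuous functions to the line\<close>

locale compact_based_space =
  fixes Y :: "'a topology" and B :: "nat \<Rightarrow> 'a set"
  assumes compact_Y: "compact_space Y" and Hausdorff_Y: "Hausdorff_space Y"
    and open_B: "\<And>n. openin Y (B n)"
    and base_B: "\<And>U y. openin Y U \<Longrightarrow> y \<in> U \<Longrightarrow> \<exists>n. y \<in> B n \<and> B n \<subseteq> U"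
begin

text \<open>A Cantor-type code: the ternary digit number \<open>n\<close>, which is 0 or 1, records
  membership in \<open>B n\<close>.\<close>

definition code :: "'a \<Rightarrow> real" where
  "code y = (\<Sum>n. indicator (B n) y * (1/3) ^ n)"

lemma summable_code: "summable (\<lambda>n. indicator (B n) y * (1/3::real) ^ n)"
  by (rule summable_comparison_test'[OF summable_geometric[of "1/3::real"]])
    (auto simp: indicator_def)

lemma code_bounds: "0 \<le> code y" "code y \<le> 3/2"
proof -
  show "0 \<le> code y" unfolding code_def by (rule suminf_nonneg[OF summable_code]) simp
  have "code y \<le> (\<Sum>n. (1/3::real) ^ n)"
    unfolding code_def by (rule suminf_le[OF _ summable_code summable_geometric]) (auto simp: indicator_def)
  then show "code y \<le> 3/2" using suminf_geometric[of "1/3::real"] by simp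
qed

text \<open>The difference of two codes is a ternary series with digits -1, 0 and 1, whose size is
  governed by its first nonzero digit.\<close>

lemma code_near:
  assumes "\<bar>code y - code y'\<bar> < (1/3) ^ N / 2" "n \<le> N"
  shows "y \<in> B n \<longleftrightarrow> y' \<in> B n"
proof (rule ccontr)
  assume neq: "\<not> ?thesis"
  define m where "m = (LEAST k. \<not> (y \<in> B k \<longleftrightarrow> y' \<in> B k))"
  have m: "\<not> (y \<in> B m \<longleftrightarrow> y' \<in> B m)" "m \<le> n"
    unfolding m_def using LeastI[of "\<lambda>k. \<not> (y \<in> B k \<longleftrightarrow> y' \<in> B k)" n] Least_le[of "\<lambda>k. \<not> (y \<in> B k \<longleftrightarrow> y' \<in> B k)" n] neq
    by auto
  have below: "y \<in> B k \<longleftrightarrow> y' \<in> B k" if "k < m" for k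
    using not_less_Least[OF that[unfolded m_def]] by blast
  define \<delta> :: "nat \<Rightarrow> real" where "\<delta> k = indicator (B k) y - indicator (B k) y'" for k
  have "(1/3) ^ m / 2 \<le> \<bar>\<Sum>k. \<delta> k * (1/3) ^ k\<bar>"
    by (rule ternary_expansion_lower_bound)
      (use m below in \<open>auto simp: \<delta>_def indicator_def\<close>)
  also have "(\<Sum>k. \<delta> k * (1/3) ^ k) = code y - code y'"
    unfolding code_def \<delta>_def suminf_diff[OF summable_code summable_code] by (simp add: left_diff_distrib)
  also have "\<bar>code y - code y'\<bar> < (1/3) ^ N / 2" by (rule assms(1))
  finally have "(1/3::real) ^ m < (1/3) ^ N" by simp
  moreover have "(1/3::real) ^ N \<le> (1/3) ^ m" using m(2) assms(2) by (intro power_decreasing) auto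
  ultimately show False by simp
qed

lemma code_measurable:
  assumes M: "M \<in> borel_prob_measures Y"
  shows "code \<in> borel_measurable M"
  unfolding code_def[abs_def]
  by (intro borel_measurable_suminf borel_measurable_times borel_measurable_indicator borel_measurable_const
      openin_sets_borel_prob[OF M open_B])

lemma finite_subcover_Y:
  assumes "\<And>W. W \<in> \<C> \<Longrightarrow> openin Y W" "topspace Y \<subseteq> \<Union>\<C>"
  obtains \<F> where "finite \<F>" "\<F> \<subseteq> \<C>" "topspace Y \<subseteq> \<Union>\<F>"
proof -
  have "\<exists>\<F>. finite \<F> \<and> \<F> \<subseteq> \<C> \<and> topspace Y \<subseteq> \<Union>\<F>"
    by (rule compact_Y[unfolded compact_space_alt, rule_format]) (use assms in auto)
  then show thesis using that by (elim exE conjE)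
qed

text \<open>By compactness, finitely many base sets on which \<open>f\<close> oscillates by less
  than \<open>\<epsilon>\<close> cover the space. If \<open>N\<close> bounds their indices, points
  whose codes agree in the digits up to \<open>N\<close> lie in a common set of this kind, and
  closeness of the codes forces this agreement.\<close>

lemma continuous_map_code_uniform:
  assumes f: "continuous_map Y euclideanreal f" and "0 < \<epsilon>"
  obtains \<delta> where "0 < \<delta>" "\<And>y y'. y \<in> topspace Y \<Longrightarrow> y' \<in> topspace Y \<Longrightarrow> \<bar>code y - code y'\<bar> < \<delta> \<Longrightarrow> \<bar>f y - f y'\<bar> < \<epsilon>"
proof -
  define I where "I = {n. \<forall>x\<in>B n. \<forall>y\<in>B n. \<bar>f x - f y\<bar> < \<epsilon>}"
  have cover: "\<exists>n\<in>I. y \<in> B n" if y: "y \<in> topspace Y" for y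
  proof -
    have "openin Y {x \<in> topspace Y. f x \<in> ball (f y) (\<epsilon> / 2)}"
      by (rule openin_continuous_map_preimage[OF f]) simp
    moreover have "y \<in> {x \<in> topspace Y. f x \<in> ball (f y) (\<epsilon> / 2)}" using y \<open>0 < \<epsilon>\<close> by simp
    ultimately obtain n where n: "y \<in> B n" "B n \<subseteq> {x \<in> topspace Y. f x \<in> ball (f y) (\<epsilon> / 2)}"
      using base_B by blast
    have "\<bar>f a - f b\<bar> < \<epsilon>" if "a \<in> B n" "b \<in> B n" for a b
    proof -
      have "dist (f y) (f a) < \<epsilon> / 2" "dist (f y) (f b) < \<epsilon> / 2" using n(2) that by auto
      then have "dist (f a) (f b) < \<epsilon>" by (rule dist_triangle_half_r)
      then show ?thesis by (simp add: dist_real_def)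
    qed
    then show ?thesis using n(1) by (auto simp: I_def)
  qed
  obtain \<F> where \<F>: "finite \<F>" "\<F> \<subseteq> B ` I" "topspace Y \<subseteq> \<Union>\<F>"
    by (rule finite_subcover_Y[of "B ` I"]) (use open_B cover in auto)
  then obtain J where J: "finite J" "J \<subseteq> I" "topspace Y \<subseteq> \<Union> (B ` J)"
    using finite_subset_image[OF \<F>(1,2)] by blast
  define N where "N = Max (insert 0 J)"
  have N: "n \<le> N" if "n \<in> J" for n using that J(1) by (simp add: N_def)
  show thesis
  proof (rule that[of "(1/3) ^ N / 2"])
    fix y y' assume y: "y \<in> topspace Y" "y' \<in> topspace Y" "\<bar>code y - code y'\<bar> < (1/3) ^ N / 2"
    obtain n where n: "n \<in> J" "y \<in> B n" using J(3) y(1) by blast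
    have "y' \<in> B n" using code_near[OF y(3) N[OF n(1)]] n(2) by simp
    then show "\<bar>f y - f y'\<bar> < \<epsilon>" using n J(2) by (auto simp: I_def)
  qed simp
qed

definition is_transfer :: "('a \<Rightarrow> real) \<Rightarrow> (real \<Rightarrow> real) \<Rightarrow> bool" where
  "is_transfer f g \<longleftrightarrow> continuous_on UNIV g \<and> bounded (range g) \<and> (\<forall>y\<in>topspace Y. g (code y) = f y)"

text \<open>The uniform estimate at distance 0 shows that \<open>f\<close> depends on the code
  alone, and in general that the induced function is uniformly continuous on the set of codes. It
  extends to the closure, which is compact, and from there to the line by Tietze's theorem with the
  same bound.\<close>

lemma transfer_exists:
  assumes f: "continuous_map Y euclideanreal f"
  shows "\<exists>g. is_transfer f g"
proof -
  define S where "S = code ` topspace Y"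
  define h where "h x = f (inv_into (topspace Y) code x)" for x
  have inv: "inv_into (topspace Y) code x \<in> topspace Y" "code (inv_into (topspace Y) code x) = x" if "x \<in> S" for x
    using that by (auto simp: S_def inv_into_into f_inv_into_f)
  have hcode: "h (code y) = f y" if y: "y \<in> topspace Y" for y
  proof (rule ccontr)
    assume "h (code y) \<noteq> f y"
    then have "0 < \<bar>h (code y) - f y\<bar>" by simp
    from continuous_map_code_uniform[OF f this] obtain \<delta> where \<delta>: "0 < \<delta>"
      "\<And>x x'. x \<in> topspace Y \<Longrightarrow> x' \<in> topspace Y \<Longrightarrow> \<bar>code x - code x'\<bar> < \<delta> \<Longrightarrow> \<bar>f x - f x'\<bar> < \<bar>h (code y) - f y\<bar>"
      by blast
    have "code y \<in> S" using y by (simp add: S_def)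
    then show False using \<delta>(2)[OF inv(1) y, of "code y"] \<delta>(1) inv(2)[of "code y"] by (simp add: h_def)
  qed
  have "uniformly_continuous_on S h"
    unfolding uniformly_continuous_on_def
  proof (intro allI impI)
    fix \<epsilon> :: real assume "0 < \<epsilon>"
    then obtain \<delta> where \<delta>: "0 < \<delta>"
      "\<And>x x'. x \<in> topspace Y \<Longrightarrow> x' \<in> topspace Y \<Longrightarrow> \<bar>code x - code x'\<bar> < \<delta> \<Longrightarrow> \<bar>f x - f x'\<bar> < \<epsilon>"
      using continuous_map_code_uniform[OF f] by blast
    have "dist (h x') (h x) < \<epsilon>" if xS: "x \<in> S" "x' \<in> S" "dist x' x < \<delta>" for x x'
    proof -
      obtain y y' where "y \<in> topspace Y" "x = code y" "y' \<in> topspace Y" "x' = code y'" using xS(1,2) by (auto simp: S_def)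
      then show ?thesis using \<delta>(2)[of y' y] xS(3) hcode by (simp add: dist_real_def)
    qed
    then show "\<exists>d>0. \<forall>x\<in>S. \<forall>x'\<in>S. dist x' x < d \<longrightarrow> dist (h x') (h x) < \<epsilon>" using \<delta>(1) by blast
  qed
  then obtain g0 where g0: "uniformly_continuous_on (closure S) g0" "\<And>x. x \<in> S \<Longrightarrow> h x = g0 x"
    by (metis uniformly_continuous_on_extension_on_closure)
  have cont0: "continuous_on (closure S) g0" using g0(1) by (rule uniformly_continuous_imp_continuous)
  have "bounded S"
    using code_bounds by (intro boundedI[of _ "3/2"]) (auto simp: S_def)
  then have "compact (closure S)" by (simp add: compact_closure)
  then have "bounded (g0 ` closure S)" using cont0 compact_continuous_image compact_imp_bounded by blast
  then obtain C where C: "0 < C" "\<And>x. x \<in> closure S \<Longrightarrow> norm (g0 x) \<le> C" unfolding bounded_pos by auto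
  obtain g where g: "continuous_on UNIV g" "\<And>x. x \<in> closure S \<Longrightarrow> g x = g0 x" "\<And>x. x \<in> UNIV \<Longrightarrow> norm (g x) \<le> C"
    by (rule Tietze[of "closure S" g0 UNIV C]) (use cont0 C in auto)
  have "g (code y) = f y" if "y \<in> topspace Y" for y
  proof -
    have "code y \<in> S" using that by (simp add: S_def)
    then show ?thesis using g(2)[of "code y"] g0(2) hcode[OF that] closure_subset[of S] by auto
  qed
  moreover have "bounded (range g)" using g(3) by (intro boundedI[of _ C]) auto
  ultimately show ?thesis using g(1) unfolding is_transfer_def by blast
qed

definition transfer :: "('a \<Rightarrow> real) \<Rightarrow> real \<Rightarrow> real" where
  "transfer f = (SOME g. is_transfer f g)"

lemma transfer:
  assumes "continuous_map Y euclideanreal f"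
  shows "continuous_on UNIV (transfer f)" "bounded (range (transfer f))"
    "\<And>y. y \<in> topspace Y \<Longrightarrow> transfer f (code y) = f y"
proof -
  have "is_transfer f (transfer f)"
    unfolding transfer_def by (rule someI_ex[OF transfer_exists[OF assms]])
  then show "continuous_on UNIV (transfer f)" "bounded (range (transfer f))"
    "\<And>y. y \<in> topspace Y \<Longrightarrow> transfer f (code y) = f y"
    unfolding is_transfer_def by auto
qed

text \<open>A limit of codes need not be a code, yet it still corresponds to a point. Otherwise the
  open sets on which some \<open>f\<close> stays away from \<open>transfer f x\<close> would cover
  \<open>Y\<close>, but points whose codes converge to \<open>x\<close> eventually leave each member
  of a finite subcover.\<close>

lemma decode_exists:
  assumes x: "x \<in> closure (code ` topspace Y)"
  shows "\<exists>y\<in>topspace Y. \<forall>f. continuous_map Y euclideanreal f \<longrightarrow> f y = transfer f x"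
proof (rule ccontr)
  assume no: "\<not> ?thesis"
  define \<C> where "\<C> = {W. \<exists>f. continuous_map Y euclideanreal f \<and> (\<exists>e>0. W = {y \<in> topspace Y. f y \<in> - cball (transfer f x) e})}"
  obtain t where t: "\<And>n. t n \<in> code ` topspace Y" "t \<longlonglongrightarrow> x" using x unfolding closure_sequential by blast
  have "\<exists>y. y \<in> topspace Y \<and> t n = code y" for n using t(1)[of n] by blast
  then obtain y where y: "\<And>n. y n \<in> topspace Y" "\<And>n. t n = code (y n)" by metis
  have openC: "openin Y W" if W: "W \<in> \<C>" for W
  proof -
    obtain f e where "continuous_map Y euclideanreal f" "W = {y \<in> topspace Y. f y \<in> - cball (transfer f x) e}"
      using W unfolding \<C>_def by blast
    moreover have "openin euclideanreal (- cball (transfer f x) e)" by (simp add: open_Compl)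
    ultimately show ?thesis using openin_continuous_map_preimage by blast
  qed
  have "topspace Y \<subseteq> \<Union>\<C>"
  proof
    fix z assume z: "z \<in> topspace Y"
    then obtain f where f: "continuous_map Y euclideanreal f" "f z \<noteq> transfer f x" using no by blast
    define e where "e = dist (transfer f x) (f z) / 2"
    have "0 < e" "z \<in> {y \<in> topspace Y. f y \<in> - cball (transfer f x) e}" using f(2) z by (auto simp: e_def)
    then show "z \<in> \<Union>\<C>" using f(1) unfolding \<C>_def by blast
  qed
  with openC obtain \<F> where \<F>: "finite \<F>" "\<F> \<subseteq> \<C>" "topspace Y \<subseteq> \<Union>\<F>"
    by (rule finite_subcover_Y)
  have "eventually (\<lambda>n. y n \<notin> W) sequentially" if WF: "W \<in> \<F>" for W
  proof -
    obtain f e where f: "continuous_map Y euclideanreal f" "0 < e" "W = {y \<in> topspace Y. f y \<in> - cball (transfer f x) e}"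
      using subsetD[OF \<F>(2) WF] unfolding \<C>_def by blast
    have "(\<lambda>n. transfer f (t n)) \<longlonglongrightarrow> transfer f x"
      using continuous_on_tendsto_compose[OF transfer(1)[OF f(1)] t(2)] by simp
    then have "(\<lambda>n. f (y n)) \<longlonglongrightarrow> transfer f x" using transfer(3)[OF f(1)] y by simp
    from tendstoD[OF this f(2)] show ?thesis
      by eventually_elim (simp add: f(3) dist_commute)
  qed
  then have "eventually (\<lambda>n. \<forall>W\<in>\<F>. y n \<notin> W) sequentially" using \<F>(1) by (intro eventually_ball_finite) auto
  then obtain n where "\<forall>W\<in>\<F>. y n \<notin> W" unfolding eventually_sequentially by blast
  then show False using \<F>(3) y(1)[of n] by blast
qed

section \<open>Urysohn functions for nested pairs of base sets\<close>

definition bump :: "nat \<times> nat \<Rightarrow> 'a \<Rightarrow> real" where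
  "bump p = (SOME u. continuous_map Y euclideanreal u \<and> (\<forall>y\<in>topspace Y. 0 \<le> u y \<and> u y \<le> 1) \<and>
     (\<forall>y\<in>topspace Y - B (snd p). u y = 0) \<and> (\<forall>y\<in>B (fst p). u y = 1))"

definition nested :: "(nat \<times> nat) set" where
  "nested = {p. Y closure_of B (fst p) \<subseteq> B (snd p)}"

lemma normal_Y: "normal_space Y"
  using compact_Y Hausdorff_Y compact_Hausdorff_or_regular_imp_normal_space by blast

lemma bump:
  assumes "p \<in> nested"
  shows "continuous_map Y euclideanreal (bump p)"
    "\<And>y. y \<in> topspace Y \<Longrightarrow> 0 \<le> bump p y" "\<And>y. y \<in> topspace Y \<Longrightarrow> bump p y \<le> 1"
    "\<And>y. y \<in> topspace Y \<Longrightarrow> y \<notin> B (snd p) \<Longrightarrow> bump p y = 0" "\<And>y. y \<in> B (fst p) \<Longrightarrow> bump p y = 1"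
proof -
  have "closedin Y (topspace Y - B (snd p))" using open_B by blast
  moreover have "disjnt (topspace Y - B (snd p)) (Y closure_of B (fst p))"
    using assms by (auto simp: nested_def disjnt_iff)
  ultimately obtain u where u: "continuous_map Y (top_of_set {0..1::real}) u"
      "u ` (topspace Y - B (snd p)) \<subseteq> {0}" "u ` (Y closure_of B (fst p)) \<subseteq> {1}"
    using Urysohn_lemma[OF normal_Y, of "topspace Y - B (snd p)" "Y closure_of B (fst p)" 0 1] closedin_closure_of by (metis zero_le_one)
  have sub: "B (fst p) \<subseteq> Y closure_of B (fst p)" by (rule closure_of_subset[OF openin_subset[OF open_B]])
  have u01: "continuous_map Y euclideanreal u" "\<forall>y\<in>topspace Y. u y \<in> {0..1}"
    using u(1) by (auto simp: continuous_map_in_subtopology)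
  have "\<exists>u. continuous_map Y euclideanreal u \<and> (\<forall>y\<in>topspace Y. 0 \<le> u y \<and> u y \<le> 1) \<and>
     (\<forall>y\<in>topspace Y - B (snd p). u y = 0) \<and> (\<forall>y\<in>B (fst p). u y = 1)"
  proof (intro exI[of _ u] conjI)
    show "\<forall>y\<in>B (fst p). u y = 1" using u(3) sub by blast
  qed (use u01 u(2) in auto)
  from someI_ex[OF this] show "continuous_map Y euclideanreal (bump p)"
    "\<And>y. y \<in> topspace Y \<Longrightarrow> 0 \<le> bump p y" "\<And>y. y \<in> topspace Y \<Longrightarrow> bump p y \<le> 1"
    "\<And>y. y \<in> topspace Y \<Longrightarrow> y \<notin> B (snd p) \<Longrightarrow> bump p y = 0" "\<And>y. y \<in> B (fst p) \<Longrightarrow> bump p y = 1"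
    unfolding bump_def[symmetric] by auto
qed

text \<open>By regularity the nested pairs still resolve every neighbourhood, so that the countably
  many functions \<open>bump p\<close> suffice to detect open sets.\<close>

lemma nested_neighbourhood:
  assumes "openin Y U" "y \<in> U"
  obtains p where "p \<in> nested" "y \<in> B (fst p)" "B (snd p) \<subseteq> U"
proof -
  obtain j where j: "y \<in> B j" "B j \<subseteq> U" using base_B[OF assms] by blast
  have reg: "regular_space Y" using compact_Y Hausdorff_Y by (rule compact_Hausdorff_imp_regular_space)
  have "closedin Y (topspace Y - B j)" using open_B by blast
  moreover have "y \<in> topspace Y - (topspace Y - B j)" using j(1) openin_subset[OF open_B] by blast
  ultimately obtain V W where VW: "openin Y V" "openin Y W" "y \<in> V" "topspace Y - B j \<subseteq> W" "disjnt V W"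
    using reg[unfolded regular_space_def, rule_format, of "topspace Y - B j" y] by blast
  obtain i where i: "y \<in> B i" "B i \<subseteq> V" using base_B[OF VW(1,3)] by blast
  have "B i \<subseteq> topspace Y - W" using i(2) VW(5) openin_subset[OF VW(1)] by (auto simp: disjnt_iff)
  then have "Y closure_of B i \<subseteq> topspace Y - W" by (rule closure_of_minimal) (use VW(2) in blast)
  then have "(i, j) \<in> nested" using VW(4) by (auto simp: nested_def)
  then show thesis using i j by (intro that[of "(i, j)"]) auto
qed

section \<open>Sequential compactness through measures on the line\<close>

lemma sequentially_compact_measures:
  assumes M: "\<And>n. M n \<in> borel_prob_measures Y"
  obtains r \<mu> where "strict_mono (r :: nat \<Rightarrow> nat)" "\<mu> \<in> borel_prob_measures Y"
    "\<And>f. continuous_map Y euclideanreal f \<Longrightarrow> (\<lambda>n. \<integral>y. f y \<partial>M (r n)) \<longlonglongrightarrow> (\<integral>y. f y \<partial>\<mu>)"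
proof -
  define \<nu> where "\<nu> n = distr (M n) borel code" for n
  have dist: "real_distribution (\<nu> n)" for n
    unfolding \<nu>_def by (intro prob_space.real_distribution_distr prob_space_borel_prob_measures[OF M] code_measurable M)
  have meas1: "measure (\<nu> n) {-1<..2} = 1" for n
  proof -
    have "code -` {-1<..2} \<inter> space (M n) = space (M n)"
    proof -
      have "code y \<in> {-1<..2}" for y using code_bounds[of y] by simp
      then show ?thesis by auto
    qed
    then have "measure (\<nu> n) {-1<..2} = measure (M n) (space (M n))"
      unfolding \<nu>_def using measure_distr[OF code_measurable[OF M[of n]], of "{-1<..2}"] by simp
    then show ?thesis using prob_space.prob_space[OF prob_space_borel_prob_measures[OF M]] by simp
  qed
  \<comment> \<open>All codes lie between 0 and 3/2, so one bounded interval works for every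
    \<open>\<epsilon>\<close>.\<close>
  have "\<exists>a b. a < b \<and> (\<forall>n. 1 - \<epsilon> < measure (\<nu> n) {a<..b})" if "0 < \<epsilon>" for \<epsilon> :: real
    by (rule exI[of _ "-1"], rule exI[of _ 2]) (use meas1 that in auto)
  then have "tight \<nu>" unfolding tight_def using dist by blast
  then obtain r N where r: "strict_mono r" "real_distribution N" "weak_conv_m (\<nu> \<circ> id \<circ> r) N"
    using tight_imp_convergent_subsubsequence[of \<nu> id] by (auto simp: strict_mono_def)
  interpret N: real_distribution N by (rule r(2))
  have dist': "real_distribution ((\<nu> \<circ> id \<circ> r) n)" for n using dist by simp
  have conv: "(\<lambda>n. \<integral>y. g (code y) \<partial>M (r n)) \<longlonglongrightarrow> (\<integral>x. g x \<partial>N)"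
    if g: "continuous_on UNIV g" "bounded (range g)" for g :: "real \<Rightarrow> real"
  proof -
    obtain C where "\<And>x. norm (g x) \<le> C" using g(2) unfolding bounded_iff by auto
    moreover have "isCont g x" for x using g(1) by (simp add: continuous_on_eq_continuous_at)
    ultimately have "(\<lambda>n. integral\<^sup>L ((\<nu> \<circ> id \<circ> r) n) g) \<longlonglongrightarrow> integral\<^sup>L N g"
      using weak_conv_imp_integral_bdd_continuous_conv[OF dist' r(2,3)] by blast
    moreover have "integral\<^sup>L ((\<nu> \<circ> id \<circ> r) n) g = (\<integral>y. g (code y) \<partial>M (r n))" for n
      using g(1) by (simp add: \<nu>_def integral_distr[OF code_measurable[OF M]] borel_measurable_continuous_onI)
    ultimately show ?thesis by simp
  qed
  have intN: "integrable N g" if g: "continuous_on UNIV g" "bounded (range g)" for g :: "real \<Rightarrow> real"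
  proof -
    obtain C where "\<And>x. norm (g x) \<le> C" using g(2) unfolding bounded_iff by auto
    then show ?thesis
      using g(1) by (intro N.integrable_const_bound[of _ C]) (auto simp: borel_measurable_continuous_onI)
  qed
  have "topspace Y \<noteq> {}"
    using prob_space.not_empty[OF prob_space_borel_prob_measures[OF M[of 0]]]
    unfolding space_borel_prob_measures[OF M[of 0]] .
  then obtain y0 where y0: "y0 \<in> topspace Y" by blast
  define K where "K = closure (code ` topspace Y)"
  have K: "closed K" "K \<noteq> {}" using y0 by (auto simp: K_def)
  have codeK: "code y \<in> K" if "y \<in> topspace Y" for y
    using that closure_subset[of "code ` topspace Y"] by (auto simp: K_def)
  \<comment> \<open>A bounded continuous function vanishing exactly on \<open>K\<close>. Its
    integrals against the image measures are 0, hence so is its integral against \<open>N\<close>,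
    and \<open>N\<close> is concentrated on \<open>K\<close>.\<close>
  define \<kappa> where "\<kappa> x = min 1 (infdist x K)" for x
  have \<kappa>: "continuous_on UNIV \<kappa>" "bounded (range \<kappa>)" "\<And>x. 0 \<le> \<kappa> x"
  proof -
    show "continuous_on UNIV \<kappa>" unfolding \<kappa>_def by (intro continuous_intros)
    show \<kappa>0: "0 \<le> \<kappa> x" for x by (simp add: \<kappa>_def infdist_nonneg)
    have "norm (\<kappa> x) \<le> 1" for x using \<kappa>0[of x] by (simp add: \<kappa>_def)
    then show "bounded (range \<kappa>)" by (intro boundedI[of _ 1]) auto
  qed
  have "(\<integral>y. \<kappa> (code y) \<partial>M (r n)) = 0" for n
  proof -
    have "(\<integral>y. \<kappa> (code y) \<partial>M (r n)) = (\<integral>y. 0 \<partial>M (r n))"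
      using codeK by (intro Bochner_Integration.integral_cong) (auto simp: \<kappa>_def space_borel_prob_measures[OF M])
    then show ?thesis by simp
  qed
  then have "(\<integral>x. \<kappa> x \<partial>N) = 0" using conv[OF \<kappa>(1,2)] by (simp add: LIMSEQ_const_iff)
  then have "AE x in N. \<kappa> x = 0"
    using integral_nonneg_eq_0_iff_AE[OF intN[OF \<kappa>(1,2)]] \<kappa>(3) by simp
  then have AE_K: "AE x in N. x \<in> K"
  proof (rule AE_mp, intro AE_I2 impI)
    fix x assume "\<kappa> x = 0"
    then have "infdist x K = 0" by (auto simp: \<kappa>_def min_def split: if_splits)
    then show "x \<in> K" using K(1,2) by (simp add: in_closed_iff_infdist_zero)
  qed
  \<comment> \<open>A decoding chosen point by point. Off \<open>K\<close>, a null set for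
    \<open>N\<close>, the default \<open>y0\<close> keeps the values in \<open>Y\<close>.\<close>
  define \<phi> where "\<phi> x = (if x \<in> K then SOME y. y \<in> topspace Y \<and> (\<forall>f. continuous_map Y euclideanreal f \<longrightarrow> f y = transfer f x) else y0)" for x
  have \<phi>K: "\<phi> x \<in> topspace Y \<and> (\<forall>f. continuous_map Y euclideanreal f \<longrightarrow> f (\<phi> x) = transfer f x)" if "x \<in> K" for x
    unfolding \<phi>_def if_P[OF that]
    by (rule someI_ex[OF decode_exists[OF that[unfolded K_def], unfolded Bex_def]])
  have \<phi>Y: "\<phi> x \<in> topspace Y" for x using \<phi>K[of x] y0 by (cases "x \<in> K") (auto simp: \<phi>_def)
  \<comment> \<open>The zero measure is a placeholder: \<open>\<Sigma>\<close> serves as a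
    measurable space.\<close>
  define \<Sigma> where "\<Sigma> = measure_of (topspace Y) {U. openin Y U} (\<lambda>_. 0)"
  have sub: "{U. openin Y U} \<subseteq> Pow (topspace Y)" using openin_subset by auto
  have \<phi>_meas: "\<phi> \<in> measurable N \<Sigma>"
    unfolding \<Sigma>_def
  proof (rule measurable_measure_of[OF sub])
    show "\<phi> \<in> space N \<rightarrow> topspace Y" using \<phi>Y by auto
    fix U assume "U \<in> {U. openin Y U}"
    then have U: "openin Y U" by simp
    define P where "P = {p \<in> nested. B (snd p) \<subseteq> U}"
    \<comment> \<open>Why the chosen decoding is measurable: membership of \<open>\<phi> x\<close>
      in an open set is detected by the bumps that vanish outside of it, and their transfers are
      continuous on the line. So on \<open>K\<close> the preimage is relatively open.\<close>
    have "\<phi> x \<in> U \<longleftrightarrow> (\<exists>p\<in>P. 0 < transfer (bump p) x)" if x: "x \<in> K" for x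
    proof
      assume "\<phi> x \<in> U"
      then obtain p where p: "p \<in> nested" "\<phi> x \<in> B (fst p)" "B (snd p) \<subseteq> U" using nested_neighbourhood[OF U] by blast
      then have "transfer (bump p) x = 1" using \<phi>K[OF x] bump(1,5)[OF p(1)] by metis
      moreover have "p \<in> P" using p by (simp add: P_def)
      ultimately show "\<exists>p\<in>P. 0 < transfer (bump p) x" by (intro bexI[of _ p]) simp_all
    next
      assume "\<exists>p\<in>P. 0 < transfer (bump p) x"
      then obtain p where p: "p \<in> nested" "B (snd p) \<subseteq> U" "0 < transfer (bump p) x" by (auto simp: P_def)
      then have "0 < bump p (\<phi> x)" using \<phi>K[OF x] bump(1)[OF p(1)] by metis
      then have "\<phi> x \<in> B (snd p)" using bump(4)[OF p(1) \<phi>Y] by force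
      then show "\<phi> x \<in> U" using p(2) by blast
    qed
    moreover have "\<phi> x = y0" if "x \<notin> K" for x using that by (simp add: \<phi>_def)
    ultimately have "x \<in> \<phi> -` U \<inter> space N \<longleftrightarrow>
        x \<in> (K \<inter> (\<Union>p\<in>P. {x. 0 < transfer (bump p) x})) \<union> (if y0 \<in> U then - K else {})" for x
      by (cases "x \<in> K") simp_all
    then have "\<phi> -` U \<inter> space N = (K \<inter> (\<Union>p\<in>P. {x. 0 < transfer (bump p) x})) \<union> (if y0 \<in> U then - K else {})"
      by (rule set_eqI)
    moreover have "open (\<Union>p\<in>P. {x. 0 < transfer (bump p) x})"
    proof (intro open_UN ballI)
      fix p assume "p \<in> P"
      then have "continuous_on UNIV (transfer (bump p))" using transfer(1) bump(1) by (auto simp: P_def)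
      then show "open {x. 0 < transfer (bump p) x}" by (intro open_Collect_less continuous_on_const)
    qed
    ultimately show "\<phi> -` U \<inter> space N \<in> sets N" using K(1) by auto
  qed
  define \<mu> where "\<mu> = distr N \<Sigma> \<phi>"
  have "\<mu> \<in> borel_prob_measures Y"
    unfolding borel_prob_measures_def \<mu>_def
    using N.prob_space_distr[OF \<phi>_meas] sub by (simp add: \<Sigma>_def)
  moreover have "(\<lambda>n. \<integral>y. f y \<partial>M (r n)) \<longlonglongrightarrow> (\<integral>y. f y \<partial>\<mu>)" if f: "continuous_map Y euclideanreal f" for f
  proof -
    note tr = transfer[OF f]
    have "(\<integral>y. transfer f (code y) \<partial>M (r n)) = (\<integral>y. f y \<partial>M (r n))" for n
      using tr(3) by (intro Bochner_Integration.integral_cong) (auto simp: space_borel_prob_measures[OF M])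
    then have 1: "(\<lambda>n. \<integral>y. f y \<partial>M (r n)) \<longlonglongrightarrow> (\<integral>x. transfer f x \<partial>N)" using conv[OF tr(1,2)] by simp
    have fm: "f \<in> borel_measurable \<Sigma>"
      using continuous_map_borel_measurable[OF \<open>\<mu> \<in> borel_prob_measures Y\<close> f] by (simp add: \<mu>_def)
    have "(\<integral>y. f y \<partial>\<mu>) = (\<integral>x. f (\<phi> x) \<partial>N)"
      unfolding \<mu>_def by (rule integral_distr[OF \<phi>_meas fm])
    also have "\<dots> = (\<integral>x. transfer f x \<partial>N)"
    proof (rule integral_cong_AE)
      show "(\<lambda>x. f (\<phi> x)) \<in> borel_measurable N" using measurable_compose[OF \<phi>_meas fm] .
      show "transfer f \<in> borel_measurable N" using tr(1) by (simp add: borel_measurable_continuous_onI)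
      show "AE x in N. f (\<phi> x) = transfer f x" using AE_K by (rule AE_mp) (use \<phi>K f in auto)
    qed
    finally show ?thesis using 1 by simp
  qed
  ultimately show thesis using that[OF r(1)] by blast
qed

section \<open>Countably many integrals determine a measure and its topology\<close>

fun max_bump :: "(nat \<times> nat) list \<Rightarrow> 'a \<Rightarrow> real" where
  "max_bump [] y = 0"
| "max_bump (p # ps) y = (if p \<in> nested then max (bump p y) (max_bump ps y) else max_bump ps y)"

lemma continuous_map_max_bump: "continuous_map Y euclideanreal (max_bump ps)"
proof (induction ps)
  case (Cons p ps)
  have "continuous_map Y euclideanreal (\<lambda>y. max (bump p y) (max_bump ps y))" if "p \<in> nested"
    using bump(1)[OF that] Cons by (rule continuous_map_real_max)
  then show ?case using Cons by (cases "p \<in> nested") (simp_all add: max_bump.simps(2)[abs_def])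
qed (simp add: max_bump.simps(1)[abs_def])

lemma max_bump_bounds: "y \<in> topspace Y \<Longrightarrow> 0 \<le> max_bump ps y \<and> max_bump ps y \<le> 1"
  by (induction ps) (auto simp: bump le_max_iff_disj)

lemma max_bump_eq_1: "y \<in> topspace Y \<Longrightarrow> p \<in> set ps \<Longrightarrow> p \<in> nested \<Longrightarrow> y \<in> B (fst p) \<Longrightarrow> max_bump ps y = 1"
proof (induction ps)
  case (Cons q ps)
  then show ?case
    using max_bump_bounds[of y ps] bump(3)[of q y] bump(5)[of p y] by (auto simp: max_def)
qed simp

lemma max_bump_eq_0:
  "y \<in> topspace Y \<Longrightarrow> (\<And>p. p \<in> set ps \<Longrightarrow> y \<notin> B (snd p)) \<Longrightarrow> max_bump ps y = 0"
  by (induction ps) (auto simp: bump(4))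

text \<open>The indicator of an open \<open>U\<close> is the pointwise limit of
  \<open>max_bump\<close> over those of the first \<open>n\<close> pairs whose outer set lies in
  \<open>U\<close>. Dominated convergence recovers the measure of \<open>U\<close>, and the open
  sets form a generator stable under intersection.\<close>

lemma measure_determined:
  assumes M: "M \<in> borel_prob_measures Y" "M' \<in> borel_prob_measures Y"
    and eq: "\<And>ps. (\<integral>y. max_bump ps y \<partial>M) = (\<integral>y. max_bump ps y \<partial>M')"
  shows "M = M'"
proof -
  have approx: "(\<lambda>n. \<integral>y. max_bump (filter (\<lambda>p. B (snd p) \<subseteq> U) (map prod_decode [0..<n])) y \<partial>N) \<longlonglongrightarrow> measure N U"
    if N: "N \<in> borel_prob_measures Y" and U: "openin Y U" for N U
  proof -
    define L where "L n = filter (\<lambda>p. B (snd p) \<subseteq> U) (map prod_decode [0..<n])" for n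
    interpret N: prob_space N using N by (rule prob_space_borel_prob_measures)
    have sp: "space N = topspace Y" using N by (rule space_borel_prob_measures)
    have "(\<lambda>n. \<integral>y. max_bump (L n) y \<partial>N) \<longlonglongrightarrow> (\<integral>y. indicator U y \<partial>N)"
    proof (rule integral_dominated_convergence[where w = "\<lambda>_. 1"])
      show "indicator U \<in> borel_measurable N" using openin_sets_borel_prob[OF N U] by simp
      show "max_bump (L n) \<in> borel_measurable N" for n
        by (rule continuous_map_borel_measurable[OF N continuous_map_max_bump])
      show "AE y in N. (\<lambda>n. max_bump (L n) y) \<longlonglongrightarrow> indicator U y"
      proof (rule AE_I2)
        fix y assume "y \<in> space N"
        then have y: "y \<in> topspace Y" by (simp add: sp)
        show "(\<lambda>n. max_bump (L n) y) \<longlonglongrightarrow> indicator U y"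
        proof (cases "y \<in> U")
          case True
          then obtain p where p: "p \<in> nested" "y \<in> B (fst p)" "B (snd p) \<subseteq> U" using nested_neighbourhood[OF U] by blast
          have "max_bump (L n) y = 1" if "prod_encode p < n" for n
          proof (rule max_bump_eq_1[OF y _ p(1,2)])
            have "p \<in> set (map prod_decode [0..<n])" using that by (auto intro!: image_eqI[of _ _ "prod_encode p"])
            then show "p \<in> set (L n)" using p(3) by (simp add: L_def)
          qed
          then have "eventually (\<lambda>n. max_bump (L n) y = indicator U y) sequentially"
            unfolding eventually_sequentially using True by (intro exI[of _ "Suc (prod_encode p)"]) simp
          then show ?thesis by (rule tendsto_eventually)
        next
          case False
          then have "max_bump (L n) y = 0" for n by (intro max_bump_eq_0[OF y]) (auto simp: L_def)
          then show ?thesis using False by simp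
        qed
      qed
      show "AE y in N. norm (max_bump (L n) y) \<le> 1" for n
        using max_bump_bounds by (intro AE_I2) (auto simp: sp)
    qed simp
    moreover have "(\<integral>y. indicator U y \<partial>N) = measure N U"
      using openin_subset[OF U] by (simp add: sp Int_absorb2)
    ultimately show ?thesis by (simp add: L_def)
  qed
  interpret M: prob_space M using M(1) by (rule prob_space_borel_prob_measures)
  interpret M': prob_space M' using M(2) by (rule prob_space_borel_prob_measures)
  have "measure M U = measure M' U" if "openin Y U" for U
    using approx[OF M(1) that] approx[OF M(2) that] eq LIMSEQ_unique by simp
  then have emeq: "emeasure M U = emeasure M' U" if "openin Y U" for U
    using that by (simp add: M.emeasure_eq_measure M'.emeasure_eq_measure)
  show ?thesis
  proof (rule measure_eqI_generator_eq[where E = "{U. openin Y U}" and \<Omega> = "topspace Y" and A = "\<lambda>_. topspace Y"])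
    show "Int_stable {U. openin Y U}" by (auto simp: Int_stable_def)
    show "{U. openin Y U} \<subseteq> Pow (topspace Y)" using openin_subset by auto
    show "sets M = sigma_sets (topspace Y) {U. openin Y U}" "sets M' = sigma_sets (topspace Y) {U. openin Y U}"
      using M by (auto simp: sets_borel_prob_measures)
    show "emeasure M (topspace Y) \<noteq> \<infinity>" by simp
  qed (use emeq in auto)
qed

text \<open>Lists of pairs of naturals form a countable type, so \<open>from_nat\<close> runs
  through all functions \<open>max_bump ps\<close>.\<close>

definition moments :: "'a measure \<Rightarrow> nat \<Rightarrow> real" where
  "moments M k = (\<integral>y. max_bump (from_nat k) y \<partial>M)"

lemma inj_on_moments: "inj_on moments (borel_prob_measures Y)"
proof (rule inj_onI)
  fix M M' assume M: "M \<in> borel_prob_measures Y" "M' \<in> borel_prob_measures Y" "moments M = moments M'"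
  show "M = M'"
  proof (rule measure_determined[OF M(1,2)])
    show "(\<integral>y. max_bump ps y \<partial>M) = (\<integral>y. max_bump ps y \<partial>M')" for ps
      using fun_cong[OF M(3), of "to_nat ps"] by (simp add: moments_def)
  qed
qed

lemma tendsto_fun_iff: "(f \<longlonglongrightarrow> l) \<longleftrightarrow> (\<forall>k. (\<lambda>n. f n k) \<longlonglongrightarrow> l k)" for f :: "nat \<Rightarrow> nat \<Rightarrow> real"
  using limitin_componentwise[of "\<lambda>_. euclideanreal" UNIV f l sequentially]
  by (simp add: euclidean_product_topology flip: limitin_canonical_iff)

lemma moments_tendsto:
  assumes "\<And>f. continuous_map Y euclideanreal f \<Longrightarrow> (\<lambda>n. \<integral>y. f y \<partial>M n) \<longlonglongrightarrow> (\<integral>y. f y \<partial>\<mu>)"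
  shows "(\<lambda>n. moments (M n)) \<longlonglongrightarrow> moments \<mu>"
  unfolding tendsto_fun_iff moments_def using assms[OF continuous_map_max_bump] by blast

text \<open>The point is the continuity of the inverse. The target is metrizable, so sequences
  suffice: if the integrals of \<open>f\<close> stayed away from the expected limit along a
  subsequence, a further subsequence of the measures would converge, and by injectivity of
  \<open>moments\<close> its limit would be the expected measure.\<close>

lemma homeomorphic_map_moments:
  "homeomorphic_map (weak_star_topology Y) (top_of_set (moments ` borel_prob_measures Y)) moments"
proof -
  define Z where "Z = moments ` borel_prob_measures Y"
  define J where "J = inv_into (borel_prob_measures Y) moments"
  have J: "J (moments M) = M" if "M \<in> borel_prob_measures Y" for M
    using that inj_on_moments by (simp add: J_def)
  have contm: "continuous_map (weak_star_topology Y) euclidean moments"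
  proof -
    have "continuous_map (weak_star_topology Y) euclideanreal (\<lambda>M. moments M k)" for k
      unfolding continuous_map_def topspace_weak_star_topology
    proof (intro conjI allI impI)
      fix V :: "real set" assume "openin euclideanreal V"
      then have "{M \<in> borel_prob_measures Y. (\<integral>y. max_bump (from_nat k) y \<partial>M) \<in> V} \<in>
        {{M \<in> borel_prob_measures Y. (\<integral>x. f x \<partial>M) \<in> V} | f V. continuous_map Y euclideanreal f \<and> open V}"
        using continuous_map_max_bump by (auto intro!: exI[of _ "max_bump (from_nat k)"] exI[of _ V])
      then show "openin (weak_star_topology Y) {M \<in> borel_prob_measures Y. moments M k \<in> V}"
        unfolding weak_star_topology_def moments_def by (rule topology_generated_by_Basis)
    qed auto
    then have "continuous_map (weak_star_topology Y) (product_topology (\<lambda>_. euclideanreal) UNIV) moments"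
      by (simp add: continuous_map_componentwise_UNIV)
    then show ?thesis by (simp add: euclidean_product_topology)
  qed
  have contJ: "continuous_on Z (\<lambda>z. \<integral>y. f y \<partial>J z)" if f: "continuous_map Y euclideanreal f" for f
    unfolding continuous_on_sequentially
  proof (intro allI ballI impI)
    fix x :: "nat \<Rightarrow> nat \<Rightarrow> real" and z assume z: "z \<in> Z" and x: "(\<forall>n. x n \<in> Z) \<and> x \<longlonglongrightarrow> z"
    define F where "F z = (\<integral>y. f y \<partial>J z)" for z
    have "(\<lambda>n. F (x n)) \<longlonglongrightarrow> F z"
    proof (rule ccontr)
      assume "\<not> (\<lambda>n. F (x n)) \<longlonglongrightarrow> F z"
      then obtain e where e: "0 < e" "\<not> eventually (\<lambda>n. dist (F (x n)) (F z) < e) sequentially"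
        unfolding tendsto_iff by blast
      then have "frequently (\<lambda>n. \<not> dist (F (x n)) (F z) < e) sequentially" by (simp add: not_eventually)
      then have inf: "infinite {n. \<not> dist (F (x n)) (F z) < e}"
        by (simp add: frequently_cofinite flip: cofinite_eq_sequentially)
      obtain s :: "nat \<Rightarrow> nat" where s: "strict_mono s" "\<And>n. s n \<in> {n. \<not> dist (F (x n)) (F z) < e}"
        using infinite_enumerate[OF inf] by blast
      have "\<exists>M. M \<in> borel_prob_measures Y \<and> x n = moments M" for n using x unfolding Z_def by blast
      then obtain M where M: "\<And>n. M n \<in> borel_prob_measures Y" "\<And>n. x n = moments (M n)" by metis
      obtain r \<mu> where r: "strict_mono r" "\<mu> \<in> borel_prob_measures Y"
        "\<And>f. continuous_map Y euclideanreal f \<Longrightarrow> (\<lambda>n. \<integral>y. f y \<partial>M (s (r n))) \<longlonglongrightarrow> (\<integral>y. f y \<partial>\<mu>)"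
        using sequentially_compact_measures[of "\<lambda>n. M (s n)"] M(1) by metis
      have "(\<lambda>n. x (s (r n))) \<longlonglongrightarrow> moments \<mu>"
        using moments_tendsto[of "\<lambda>n. M (s (r n))" \<mu>] r(3) M(2) by simp
      moreover have "(\<lambda>n. x (s (r n))) \<longlonglongrightarrow> z"
        using LIMSEQ_subseq_LIMSEQ[OF LIMSEQ_subseq_LIMSEQ[OF conjunct2[OF x] s(1)] r(1)] by (simp add: o_def)
      ultimately have "z = moments \<mu>" by (rule LIMSEQ_unique[rotated])
      then have "F z = (\<integral>y. f y \<partial>\<mu>)" using J[OF r(2)] by (simp add: F_def)
      moreover have "F (x n) = (\<integral>y. f y \<partial>M n)" for n using J[OF M(1)] M(2) by (simp add: F_def)
      ultimately have "(\<lambda>n. F (x (s (r n)))) \<longlonglongrightarrow> F z" using r(3)[OF f] by simp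
      from tendstoD[OF this e(1)] obtain n where "dist (F (x (s (r n)))) (F z) < e"
        unfolding eventually_sequentially by blast
      then show False using s(2)[of "r n"] by simp
    qed
    then show "((\<lambda>z. \<integral>y. f y \<partial>J z) \<circ> x) \<longlonglongrightarrow> (\<integral>y. f y \<partial>J z)" by (simp add: F_def o_def)
  qed
  have "continuous_map (top_of_set Z) (weak_star_topology Y) J"
    unfolding weak_star_topology_def
  proof (rule continuous_on_generated_topo)
    fix U assume "U \<in> {{M \<in> borel_prob_measures Y. (\<integral>x. f x \<partial>M) \<in> V} | f V. continuous_map Y euclideanreal f \<and> open V}"
    then obtain f V where fV: "U = {M \<in> borel_prob_measures Y. (\<integral>x. f x \<partial>M) \<in> V}" "continuous_map Y euclideanreal f" "open V"
      by blast
    have "J -` U \<inter> topspace (top_of_set Z) = Z \<inter> (\<lambda>z. \<integral>y. f y \<partial>J z) -` V"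
      using J by (auto simp: fV(1) Z_def)
    then show "openin (top_of_set Z) (J -` U \<inter> topspace (top_of_set Z))"
      using continuous_openin_preimage_gen[OF contJ[OF fV(2)] fV(3)] by simp
  next
    show "J ` topspace (top_of_set Z) \<subseteq> \<Union> {{M \<in> borel_prob_measures Y. (\<integral>x. f x \<partial>M) \<in> V} | f V. continuous_map Y euclideanreal f \<and> open V}"
      using topspace_weak_star_topology[of Y] J unfolding weak_star_topology_def topology_generated_by_topspace
      by (auto simp: Z_def)
  qed
  moreover have "continuous_map (weak_star_topology Y) (top_of_set Z) moments"
    using contm by (auto simp: continuous_map_in_subtopology topspace_weak_star_topology Z_def)
  ultimately have "homeomorphic_maps (weak_star_topology Y) (top_of_set Z) moments J"
    using J by (auto simp: homeomorphic_maps_def topspace_weak_star_topology Z_def)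
  then show ?thesis unfolding Z_def using homeomorphic_map_maps by blast
qed

lemma compact_moments: "compact (moments ` borel_prob_measures Y)"
  unfolding compact_eq_seq_compact_metric seq_compact_def
proof (intro allI impI)
  fix x :: "nat \<Rightarrow> nat \<Rightarrow> real" assume x: "\<forall>n. x n \<in> moments ` borel_prob_measures Y"
  have "\<exists>M. M \<in> borel_prob_measures Y \<and> x n = moments M" for n using x by blast
  then obtain M where M: "\<And>n. M n \<in> borel_prob_measures Y" "\<And>n. x n = moments (M n)" by metis
  obtain r \<mu> where r: "strict_mono r" "\<mu> \<in> borel_prob_measures Y"
    "\<And>f. continuous_map Y euclideanreal f \<Longrightarrow> (\<lambda>n. \<integral>y. f y \<partial>M (r n)) \<longlonglongrightarrow> (\<integral>y. f y \<partial>\<mu>)"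
    using sequentially_compact_measures[of M] M(1) by metis
  have "(x \<circ> r) \<longlonglongrightarrow> moments \<mu>"
    using moments_tendsto[of "\<lambda>n. M (r n)" \<mu>] r(3) M(2) by (simp add: o_def)
  then show "\<exists>l\<in>moments ` borel_prob_measures Y. \<exists>r. strict_mono r \<and> (x \<circ> r) \<longlonglongrightarrow> l"
    using r(1,2) by blast
qed

end

theorem weak_star_topology_compact_metrizable:
  assumes "compact_space Y" "Hausdorff_space Y" "second_countable Y"
  shows "compact_space (weak_star_topology Y)" "metrizable_space (weak_star_topology Y)"
    "Hausdorff_space (weak_star_topology Y)"
proof -
  obtain \<B> where \<B>: "countable \<B>" "\<And>V. V \<in> \<B> \<Longrightarrow> openin Y V"
      "\<And>U x. openin Y U \<Longrightarrow> x \<in> U \<Longrightarrow> \<exists>V\<in>\<B>. x \<in> V \<and> V \<subseteq> U"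
    using assms(3) unfolding second_countable_def by metis
  \<comment> \<open>The empty set is added to make sure that the enumerated family is
    nonempty.\<close>
  define B where "B = from_nat_into (insert {} \<B>)"
  have ran: "range B = insert {} \<B>" unfolding B_def using \<B>(1) by (intro range_from_nat_into) auto
  interpret compact_based_space Y B
  proof
    show "openin Y (B n)" for n using \<B>(2) ran by (metis insertE openin_empty rangeI)
    show "\<exists>n. y \<in> B n \<and> B n \<subseteq> U" if "openin Y U" "y \<in> U" for U y
      using \<B>(3)[OF that] ran by (metis insertCI rangeE)
  qed (use assms in auto)
  have hom: "weak_star_topology Y homeomorphic_space top_of_set (moments ` borel_prob_measures Y)"
    using homeomorphic_map_moments by (rule homeomorphic_map_imp_homeomorphic_space)
  show "compact_space (weak_star_topology Y)"
    using homeomorphic_compact_space[OF hom] compact_moments by (simp add: compact_space_subtopology)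
  show m: "metrizable_space (weak_star_topology Y)"
    using homeomorphic_metrizable_space[OF hom] by (simp add: metrizable_space_subtopology metrizable_space_euclidean)
  show "Hausdorff_space (weak_star_topology Y)" using m by (rule metrizable_imp_Hausdorff_space)
qed

section \<open>Closed lower sets of an open order\<close>

declare topology_generated_by_topspace [simp del]

text \<open>A countable family of open sets that refines the generators at each point acts as a
  subbase, and its finite intersections form a base. Intersecting with the whole space gives the
  empty family its proper meaning.\<close>

lemma second_countable_generated:
  assumes "countable \<B>" "\<And>V. V \<in> \<B> \<Longrightarrow> openin (topology_generated_by \<S>) V"
    and "\<And>s x. s \<in> \<S> \<Longrightarrow> x \<in> s \<Longrightarrow> \<exists>V\<in>\<B>. x \<in> V \<and> V \<subseteq> s"
  shows "second_countable (topology_generated_by \<S>)"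
proof -
  let ?X = "topology_generated_by \<S>"
  let ?C = "(\<lambda>F. topspace ?X \<inter> \<Inter>F) ` {F. finite F \<and> F \<subseteq> \<B>}"
  have base: "\<exists>V\<in>?C. x \<in> V \<and> V \<subseteq> U" if "generate_topology_on \<S> U" "x \<in> U" for U x
    using that
  proof (induction arbitrary: x)
    case (Int a b)
    then obtain F G where "finite F" "F \<subseteq> \<B>" "x \<in> topspace ?X \<inter> \<Inter>F" "topspace ?X \<inter> \<Inter>F \<subseteq> a"
      "finite G" "G \<subseteq> \<B>" "x \<in> topspace ?X \<inter> \<Inter>G" "topspace ?X \<inter> \<Inter>G \<subseteq> b"
      by (smt (verit) IntD1 IntD2 imageE mem_Collect_eq)
    then show ?case
      by (intro bexI[of _ "topspace ?X \<inter> \<Inter>(F \<union> G)"] imageI) auto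
  next
    case (UN K)
    then show ?case by (meson Union_iff Sup_upper order_trans)
  next
    case (Basis s)
    then obtain V where V: "V \<in> \<B>" "x \<in> V" "V \<subseteq> s" using assms(3) by blast
    then have "V \<subseteq> topspace ?X" using assms(2) openin_subset by blast
    then show ?case using V
      by (intro bexI[of _ "topspace ?X \<inter> \<Inter>{V}"] imageI) auto
  qed auto
  have "openin ?X (topspace ?X \<inter> \<Inter>F)" if "finite F" "F \<subseteq> \<B>" for F
    using that
  proof (induction F)
    case (insert V F)
    have "topspace ?X \<inter> \<Inter>(insert V F) = V \<inter> (topspace ?X \<inter> \<Inter>F)" by auto
    with insert show ?case using assms(2) by (simp add: openin_Int)
  qed auto
  moreover have "countable ?C"
    using countable_Collect_finite_subset[OF assms(1)] by blast
  ultimately show ?thesis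
    unfolding second_countable_def
    using base by (intro exI[of _ ?C]) (auto simp: openin_topology_generated_by_iff)
qed

text \<open>A model is \<open><\<close> on the reals: the closed lower sets are the closed left
  half-lines, the empty set and the whole line, and their space is the extended real line.\<close>

locale open_order =
  fixes X :: "'a topology" and R :: "'a \<Rightarrow> 'a \<Rightarrow> bool"
  assumes R_open: "R x y \<Longrightarrow> \<exists>U V. openin X U \<and> openin X V \<and> x \<in> U \<and> y \<in> V \<and> (\<forall>u\<in>U. \<forall>v\<in>V. R u v)"
    and R_trans: "R x y \<Longrightarrow> R y z \<Longrightarrow> R x z"
    and R_approx: "openin X U \<Longrightarrow> x \<in> U \<Longrightarrow> \<exists>y\<in>U. R y x"
begin

definition closed_lower :: "'a set set" where
  "closed_lower = {S. closedin X S \<and> (\<forall>x\<in>S. \<forall>y\<in>topspace X. R y x \<longrightarrow> y \<in> S)}"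

definition generators :: "'a set set set" where
  "generators = {closed_lower} \<union> {{S \<in> closed_lower. S \<inter> U \<noteq> {}} | U. openin X U} \<union>
     {{S \<in> closed_lower. q \<notin> S} | q. q \<in> topspace X}"

abbreviation lower_topology :: "'a set topology" where
  "lower_topology \<equiv> topology_generated_by generators"

lemma topspace_lower_topology: "topspace lower_topology = closed_lower"
  unfolding topology_generated_by_topspace generators_def by auto

lemma openin_hit: "openin X U \<Longrightarrow> openin lower_topology {S \<in> closed_lower. S \<inter> U \<noteq> {}}"
  by (rule topology_generated_by_Basis) (auto simp: generators_def)

lemma openin_miss: "q \<in> topspace X \<Longrightarrow> openin lower_topology {S \<in> closed_lower. q \<notin> S}"
  by (rule topology_generated_by_Basis) (auto simp: generators_def)

lemma R_topspace: "R x y \<Longrightarrow> x \<in> topspace X \<and> y \<in> topspace X"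
  using R_open openin_subset by blast

lemma closed_lowerD: "S \<in> closed_lower \<Longrightarrow> x \<in> S \<Longrightarrow> R y x \<Longrightarrow> y \<in> S"
  using R_topspace[of y x] unfolding closed_lower_def by simp

lemma openin_above: "openin X {y. R x y}"
proof (subst openin_subopen, intro ballI)
  fix y assume "y \<in> {y. R x y}"
  then obtain U V where "openin X V" "x \<in> U" "y \<in> V" "\<forall>u\<in>U. \<forall>v\<in>V. R u v"
    using R_open by (metis mem_Collect_eq)
  then show "\<exists>V. openin X V \<and> y \<in> V \<and> V \<subseteq> {y. R x y}" by blast
qed

lemma openin_below: "openin X {x. R x y}"
proof (subst openin_subopen, intro ballI)
  fix x assume "x \<in> {x. R x y}"
  then obtain U V where "openin X U" "x \<in> U" "y \<in> V" "\<forall>u\<in>U. \<forall>v\<in>V. R u v"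
    using R_open by (metis mem_Collect_eq)
  then show "\<exists>U. openin X U \<and> x \<in> U \<and> U \<subseteq> {x. R x y}" by blast
qed

text \<open>For \<open>x\<close> in the closure and \<open>R y x\<close>, the points above
  \<open>y\<close> form an open neighbourhood of \<open>x\<close>, which therefore meets
  \<open>A\<close>. Hence \<open>y\<close> is below a point of \<open>A\<close> and already belongs
  to \<open>A\<close>.\<close>

lemma closure_of_lower:
  assumes "A \<subseteq> topspace X" "\<And>x y. x \<in> A \<Longrightarrow> R y x \<Longrightarrow> y \<in> A"
  shows "X closure_of A \<in> closed_lower"
proof -
  have "y \<in> X closure_of A" if "x \<in> X closure_of A" "R y x" for x y
  proof -
    from that obtain z where "z \<in> A" "R y z"
      using openin_above[of y] unfolding in_closure_of by blast
    then have "y \<in> A" using assms(2) by metis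
    then show ?thesis using closure_of_subset[OF assms(1)] by (rule subsetD[rotated])
  qed
  then show ?thesis
    unfolding closed_lower_def by simp
qed

text \<open>Given a cover by generators, take all \<open>q\<close> whose missing set occurs in it.
  The closure of the points on or below some such \<open>q\<close> lies in no missing set of the
  cover, so a hitting set for an open \<open>U\<close> covers it. Then \<open>U\<close> contains a
  point on or below one \<open>q\<close>, and the hitting set together with the missing set of this
  \<open>q\<close> covers everything.\<close>

lemma compact_lower_topology: "compact_space lower_topology"
proof (rule Alexander_subbase)
  \<comment> \<open>Both sides are the coarsest topology in which the generators are open;
    Alexander's theorem is phrased for the presentation by a subbase.\<close>
  show "topology (arbitrary union_of (finite intersection_of (\<lambda>x. x \<in> generators) relative_to \<Union> generators)) = lower_topology"
  proof (rule topology_eq[THEN iffD2], intro allI iffI)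
    let ?L = "topology (arbitrary union_of (finite intersection_of (\<lambda>x. x \<in> generators) relative_to \<Union> generators))"
    show "openin lower_topology U" if "openin ?L U" for U
      by (rule minimal_topology_subbase[OF _ _ that])
        (auto intro: topology_generated_by_Basis simp flip: topology_generated_by_topspace)
    have basis: "openin ?L s" if "s \<in> generators" for s
    proof -
      have "\<Union> generators \<inter> s = s" using that by blast
      then have "((\<lambda>x. x \<in> generators) relative_to \<Union> generators) s"
        unfolding relative_to_def using that by metis
      then show ?thesis
        unfolding openin_subbase
        by (metis (mono_tags, lifting) arbitrary_union_of_inc finite_intersection_of_inc relative_to_mono)
    qed
    show "openin ?L U" if "openin lower_topology U" for U
      using that generate_topology_on_coarsest[OF istopology_openin basis]
      unfolding openin_topology_generated_by_iff by blast
  qed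
next
  fix C assume C: "C \<subseteq> generators" "\<Union> C = topspace lower_topology"
  show "\<exists>C'. finite C' \<and> C' \<subseteq> C \<and> \<Union> C' = topspace lower_topology"
  proof (cases "closed_lower \<in> C")
    case True
    then show ?thesis by (intro exI[of _ "{closed_lower}"]) (auto simp: topspace_lower_topology)
  next
    case False
    define Q where "Q = {q \<in> topspace X. {S \<in> closed_lower. q \<notin> S} \<in> C}"
    define A where "A = Q \<union> {y. \<exists>q\<in>Q. R y q}"
    have A: "A \<subseteq> topspace X"
      unfolding A_def Q_def by (blast dest: R_topspace)
    then have "X closure_of A \<in> closed_lower"
      by (rule closure_of_lower) (unfold A_def, blast intro: R_trans)
    then obtain c where c: "c \<in> C" "X closure_of A \<in> c"
      using C(2) by (auto simp: topspace_lower_topology)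
    have QA: "Q \<subseteq> X closure_of A"
      by (rule order_trans[OF _ closure_of_subset[OF A]]) (auto simp: A_def)
    have neq: "c \<noteq> {S \<in> closed_lower. q \<notin> S}" if "q \<in> topspace X" for q
    proof
      assume *: "c = {S \<in> closed_lower. q \<notin> S}"
      then have "q \<in> Q" using that c(1) unfolding Q_def by simp
      with QA have "q \<in> X closure_of A" by blast
      with c(2) show False unfolding * by simp
    qed
    from c(1) C(1) have "c \<in> generators" by (rule subsetD[rotated])
    then consider "c = closed_lower" | (hit) U where "openin X U" "c = {S \<in> closed_lower. S \<inter> U \<noteq> {}}"
      | q where "q \<in> topspace X" "c = {S \<in> closed_lower. q \<notin> S}"
      unfolding generators_def by (elim UnE CollectE exE conjE) auto
    then obtain U where U: "openin X U" "c = {S \<in> closed_lower. S \<inter> U \<noteq> {}}"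
      using c(1) False neq by cases metis+
    have "X closure_of A \<inter> U \<noteq> {}" using c(2) U(2) by simp
    then obtain y where y: "y \<in> A" "y \<in> U"
      using openin_Int_closure_of_eq_empty[OF U(1), of A] by (metis Int_commute disjoint_iff)
    then obtain q where q: "q \<in> Q" "y = q \<or> R y q" unfolding A_def by blast
    have "{c, {S \<in> closed_lower. q \<notin> S}} \<subseteq> C" using c(1) q(1) by (auto simp: Q_def)
    moreover have "\<Union>{c, {S \<in> closed_lower. q \<notin> S}} = closed_lower"
    proof -
      have "S \<inter> U \<noteq> {}" if "S \<in> closed_lower" "q \<in> S" for S
      proof -
        have "y \<in> S" using q(2) that(2) closed_lowerD[OF that] by auto
        with y(2) show ?thesis by blast
      qed
      then show ?thesis unfolding U(2) by auto
    qed
    ultimately show ?thesis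
      unfolding topspace_lower_topology by (intro exI[of _ "{c, {S \<in> closed_lower. q \<notin> S}}"]) simp
  qed
qed

lemma R_approx_off:
  assumes "S \<in> closed_lower" "x \<in> topspace X" "x \<notin> S"
  obtains y where "R y x" "y \<notin> S"
proof -
  have "openin X (topspace X - S)" using assms(1) by (auto simp: closed_lower_def)
  from R_approx[OF this, of x] assms that show ?thesis by auto
qed

text \<open>For \<open>x\<close> in \<open>S\<close> but not in \<open>T\<close>, take
  \<open>y\<close> below \<open>x\<close> and still outside \<open>T\<close>. Closed lower sets that
  meet the open set of points above \<open>y\<close> contain \<open>y\<close>, so they are separated
  from those missing \<open>y\<close>.\<close>

lemma Hausdorff_lower_topology: "Hausdorff_space lower_topology"
proof -
  have sep: "\<exists>U V. openin lower_topology U \<and> openin lower_topology V \<and> S \<in> U \<and> T \<in> V \<and> disjnt U V"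
    if ST: "S \<in> closed_lower" "T \<in> closed_lower" "x \<in> S" "x \<notin> T" for S T x
  proof -
    have x: "x \<in> topspace X" using ST(1,3) closedin_subset by (auto simp: closed_lower_def)
    then obtain y where y: "R y x" "y \<notin> T" using R_approx_off ST by metis
    let ?U = "{S \<in> closed_lower. S \<inter> {z. R y z} \<noteq> {}}" and ?V = "{S \<in> closed_lower. y \<notin> S}"
    have "disjnt ?U ?V"
      using R_topspace[OF y(1)] unfolding disjnt_iff closed_lower_def by blast
    moreover have "openin lower_topology ?U" "openin lower_topology ?V"
      using openin_hit[OF openin_above] openin_miss R_topspace[OF y(1)] by blast+
    ultimately show ?thesis using ST y by blast
  qed
  show ?thesis
    unfolding Hausdorff_space_def topspace_lower_topology
  proof clarify
    fix S T assume "S \<in> closed_lower" "T \<in> closed_lower" "S \<noteq> T"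
    then consider x where "x \<in> S" "x \<notin> T" | x where "x \<in> T" "x \<notin> S" by blast
    then show "\<exists>U V. openin lower_topology U \<and> openin lower_topology V \<and> S \<in> U \<and> T \<in> V \<and> disjnt U V"
      using sep \<open>S \<in> closed_lower\<close> \<open>T \<in> closed_lower\<close> by cases (blast, metis disjnt_sym)
  qed
qed

text \<open>For the hitting sets, basic open sets suffice. If \<open>S\<close> misses
  \<open>q\<close>, it also misses some \<open>y\<close> below \<open>q\<close>; close to
  \<open>y\<close> there is a point \<open>z\<close> of a countable dense set, still below
  \<open>q\<close> and off \<open>S\<close>, and missing \<open>z\<close> implies missing
  \<open>q\<close>.\<close>

lemma second_countable_lower_topology:
  assumes "second_countable X"
  shows "second_countable lower_topology"
proof -
  obtain \<B> where \<B>: "countable \<B>" "\<And>V. V \<in> \<B> \<Longrightarrow> openin X V"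
      "\<And>U x. openin X U \<Longrightarrow> x \<in> U \<Longrightarrow> \<exists>V\<in>\<B>. x \<in> V \<and> V \<subseteq> U"
    using assms unfolding second_countable_def by metis
  obtain Z where Z: "countable Z" "Z \<subseteq> topspace X" "X closure_of Z = topspace X"
    using second_countable_imp_separable_space[OF assms] unfolding separable_space_def by blast
  let ?\<C> = "{closed_lower} \<union> (\<lambda>U. {S \<in> closed_lower. S \<inter> U \<noteq> {}}) ` \<B> \<union> (\<lambda>q. {S \<in> closed_lower. q \<notin> S}) ` Z"
  show ?thesis
  proof (rule second_countable_generated)
    show "countable ?\<C>" using \<B>(1) Z(1) by auto
    show "openin lower_topology V" if "V \<in> ?\<C>" for V
    proof -
      have "openin lower_topology closed_lower"
        using openin_topspace[of lower_topology] unfolding topspace_lower_topology .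
      with that show ?thesis using openin_hit openin_miss \<B>(2) Z(2) by blast
    qed
    fix s S assume s: "s \<in> generators" "S \<in> s"
    consider "s = closed_lower" | U where "openin X U" "s = {S \<in> closed_lower. S \<inter> U \<noteq> {}}"
      | q where "q \<in> topspace X" "s = {S \<in> closed_lower. q \<notin> S}"
      using s(1) unfolding generators_def by blast
    then show "\<exists>V\<in>?\<C>. S \<in> V \<and> V \<subseteq> s"
    proof cases
      case 1
      then show ?thesis using s(2) by blast
    next
      case 2
      then obtain x where "x \<in> S" "x \<in> U" using s(2) by blast
      then obtain V where "V \<in> \<B>" "x \<in> V" "V \<subseteq> U" using \<B>(3) 2(1) by blast
      then show ?thesis using s(2) 2 \<open>x \<in> S\<close>
        by (intro bexI[of _ "{S \<in> closed_lower. S \<inter> V \<noteq> {}}"]) auto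
    next
      case 3
      then have S: "S \<in> closed_lower" "q \<notin> S" using s(2) by auto
      then obtain y where y: "R y q" "y \<notin> S" using R_approx_off 3(1) by metis
      have "openin X ({x. R x q} \<inter> (topspace X - S))"
        using S(1) openin_below by (intro openin_Int) (auto simp: closed_lower_def)
      moreover have "y \<in> {x. R x q} \<inter> (topspace X - S)" using y R_topspace[OF y(1)] by simp
      moreover have "y \<in> X closure_of Z" using R_topspace[OF y(1)] Z(3) by simp
      ultimately have "\<exists>z\<in>Z. z \<in> {x. R x q} \<inter> (topspace X - S)"
        unfolding in_closure_of by metis
      then obtain z where z: "z \<in> Z" "R z q" "z \<notin> S" by auto
      have "q \<notin> T" if "T \<in> closed_lower" "z \<notin> T" for T
        using closed_lowerD[OF that(1) _ z(2)] that(2) by (rule contrapos_nn[rotated])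
      then have "{S \<in> closed_lower. z \<notin> S} \<subseteq> s" unfolding 3 by auto
      then show ?thesis using S(1) z(1,3)
        by (intro bexI[of _ "{S \<in> closed_lower. z \<notin> S}"]) simp_all
    qed
  qed
qed

end

section \<open>Koebe's lemma and Caratheodory's theorem\<close>

definition continuous_log_on :: "(complex \<Rightarrow> complex) \<Rightarrow> complex set \<Rightarrow> bool" where
  "continuous_log_on L J \<longleftrightarrow> continuous_on J L \<and> (\<forall>z\<in>J. z = exp (L z))"

text \<open>If the component of 0 were unbounded, Borsuk's criterion would make the radial
  projection of \<open>J\<close> to the circle null-homotopic. The resulting continuous argument,
  together with the logarithm of the modulus, would be a continuous logarithm.\<close>

lemma bounded_component_no_log:
  assumes "compact J" "0 \<notin> J" "\<nexists>L. continuous_log_on L J"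
  shows "bounded (connected_component_set (- J) 0)"
proof (rule ccontr)
  assume "\<not> ?thesis"
  then obtain c where "homotopic_with_canon (\<lambda>x. True) J (sphere 0 1)
      (\<lambda>x. inverse (norm (x - 0)) *\<^sub>R (x - 0)) (\<lambda>x. c)"
    using Borsuk_map_essential_bounded_component[OF assms(1,2)] by blast
  then obtain g :: "complex \<Rightarrow> real" where g: "continuous_on J g"
      "\<And>x. x \<in> J \<Longrightarrow> inverse (norm x) *\<^sub>R x = exp (\<i> * of_real (g x))"
    using inessential_eq_continuous_logarithm_circle[of J "\<lambda>x. inverse (norm x) *\<^sub>R x"] by auto
  define L where "L z = complex_of_real (ln (norm z)) + \<i> * of_real (g z)" for z
  have "continuous_on J L"
    unfolding L_def using assms(2) by (intro continuous_intros g) auto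
  moreover have "exp (L z) = z" if "z \<in> J" for z
  proof -
    have "norm z > 0" using that assms(2) by auto
    have "exp (L z) = complex_of_real (exp (ln (norm z))) * (inverse (norm z) *\<^sub>R z)"
      unfolding L_def exp_add exp_of_real g(2)[OF that] ..
    also have "\<dots> = z" using \<open>norm z > 0\<close> by (simp add: scaleR_conv_of_real)
    finally show ?thesis .
  qed
  ultimately show False using assms(3) by (metis continuous_log_on_def)
qed

text \<open>A set without continuous logarithm surrounds 0: the component of 0 in its complement
  stays in the disc and its frontier lies in \<open>J\<close>, so the maximum principle carries the
  bound on \<open>J\<close> to the centre.\<close>

lemma norm_le_of_no_log:
  assumes "h holomorphic_on ball 0 1" "compact J" "J \<subseteq> ball 0 1 - {0}"
    and "\<And>z. z \<in> J \<Longrightarrow> norm (h z) \<le> \<epsilon>" "\<nexists>L. continuous_log_on L J"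
  shows "norm (h 0) \<le> \<epsilon>"
proof -
  define W where "W = connected_component_set (- J) 0"
  have J: "0 \<notin> J" "closed J" using assms(2,3) compact_imp_closed by auto
  then have W: "open W" "0 \<in> W" "bounded W"
    using assms bounded_component_no_log by (auto simp: W_def open_connected_component open_Compl)
  have frontW: "frontier W \<subseteq> J"
    using frontier_of_connected_component_subset[of "- J" 0] frontier_subset_closed[OF J(2)]
    unfolding W_def by auto
  \<comment> \<open>The complement of the disc is connected and avoids \<open>J\<close>. If
    \<open>W\<close> met it, \<open>W\<close> would contain it and be unbounded.\<close>
  have "W \<inter> - ball 0 1 = {}"
  proof (rule ccontr)
    assume "W \<inter> - ball 0 1 \<noteq> {}"
    then obtain x where x: "x \<in> W" "x \<in> - ball 0 1" by blast
    have "connected (- ball (0::complex) 1)"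
      by (intro connected_complement_bounded_convex) auto
    moreover have "- ball 0 1 \<subseteq> - J" using assms(3) by auto
    ultimately have "- ball 0 1 \<subseteq> connected_component_set (- J) x"
      using x(2) connected_component_maximal by blast
    also have "\<dots> = W" using x(1) connected_component_eq unfolding W_def by blast
    finally have "bounded (- ball (0::complex) 1)" using W(3) bounded_subset by blast
    then show False
      using cobounded_imp_unbounded[of "ball (0::complex) 1"] by auto
  qed
  then have "W \<subseteq> ball 0 1" by auto
  moreover have "frontier W \<subseteq> ball 0 1" using frontW assms(3) by auto
  ultimately have "closure W \<subseteq> ball 0 1" unfolding closure_Un_frontier by auto
  moreover have "h holomorphic_on interior W"
    using assms(1) \<open>W \<subseteq> ball 0 1\<close> W(1) by (metis holomorphic_on_subset interior_eq)
  ultimately show ?thesis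
    using maximum_modulus_frontier[of h W \<epsilon> 0] W frontW assms(4)
      holomorphic_on_imp_continuous_on[OF assms(1)] continuous_on_subset by blast
qed

text \<open>The difference is continuous with values in the discrete set of integer multiples of
  \<open>2 * pi * \<i>\<close>.\<close>

lemma continuous_logs_differ_by_constant:
  assumes "continuous_log_on L J" "continuous_log_on L' J" "connected J"
  obtains c where "\<And>z. z \<in> J \<Longrightarrow> L' z = L z + c"
proof -
  have "(\<lambda>z. L' z - L z) constant_on J"
  proof (rule continuous_discrete_range_constant[OF assms(3)])
    show "continuous_on J (\<lambda>z. L' z - L z)"
      using assms by (auto simp: continuous_log_on_def intro!: continuous_intros)
    fix x assume x: "x \<in> J"
    have eq: "exp (L' z - L z) = 1" if "z \<in> J" for z
      using assms that unfolding continuous_log_on_def exp_diff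
      by (metis divide_self exp_not_eq_zero)
    have "2 * pi \<le> norm ((L' y - L y) - (L' x - L x))"
      if "y \<in> J" "L' y - L y \<noteq> L' x - L x" for y
    proof -
      have "exp (L' y - L y) = exp (L' x - L x)" using eq[OF that(1)] eq[OF x] by simp
      then obtain n :: int where n: "L' y - L y = L' x - L x + (of_int (2 * n) * pi) * \<i>"
        unfolding exp_eq by blast
      then have "norm ((L' y - L y) - (L' x - L x)) = 2 * \<bar>real_of_int n\<bar> * pi"
        by (simp add: norm_mult)
      moreover have "n \<noteq> 0" using n that(2) by auto
      then have "\<bar>real_of_int n\<bar> \<ge> 1" by linarith
      ultimately show ?thesis by simp
    qed
    then show "\<exists>e>0. \<forall>y. y \<in> J \<and> L' y - L y \<noteq> L' x - L x \<longrightarrow> e \<le> norm ((L' y - L y) - (L' x - L x))"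
      by (intro exI[of _ "2 * pi"]) auto
  qed
  then obtain c where "\<And>z. z \<in> J \<Longrightarrow> L' z - L z = c" unfolding constant_on_def by blast
  then show thesis by (intro that[of c]) (simp add: algebra_simps)
qed

text \<open>
  Adding to \<open>J\<close> its reflection in the line through \<open>0\<close> and \<open>a\<close> doubles its angular extent. If the
  extent already is at least \<open>pi\<close>, the result surrounds \<open>0\<close>, so that it has no continuous logarithm.
\<close>

lemma reflection_doubling:
  assumes h: "h holomorphic_on ball 0 1" "\<And>z. z \<in> ball 0 1 \<Longrightarrow> norm (h z) \<le> 1"
    and J: "compact J" "connected J" "J \<subseteq> ball 0 1 - {0}" "\<And>z. z \<in> J \<Longrightarrow> norm (h z) \<le> \<epsilon>"
    and L: "continuous_log_on L J" "a \<in> J" "b \<in> J" "t \<le> Im (L b) - Im (L a)"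
  obtains h' J' where "h' holomorphic_on ball 0 1" "\<And>z. z \<in> ball 0 1 \<Longrightarrow> norm (h' z) \<le> 1"
    "compact J'" "connected J'" "J' \<subseteq> ball 0 1 - {0}" "\<And>z. z \<in> J' \<Longrightarrow> norm (h' z) \<le> \<epsilon>"
    "norm (h' 0) = (norm (h 0))\<^sup>2"
    "\<And>L'. continuous_log_on L' J' \<Longrightarrow> t < pi \<and> (\<exists>a'\<in>J'. \<exists>b'\<in>J'. 2 * t \<le> Im (L' b') - Im (L' a'))"
proof -
  \<comment> \<open>With this \<open>u\<close>, the map \<open>\<sigma>\<close> is the reflection in
    the line through 0 and \<open>a\<close>, because \<open>Im (L a)\<close> is an argument of
    \<open>a\<close>.\<close>
  define u where "u = exp (2 * \<i> * of_real (Im (L a)))"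
  define \<sigma> where "\<sigma> z = u * cnj z" for z
  have u: "norm u = 1" unfolding u_def by (simp add: norm_exp_eq_Re)
  then have ucnj: "u * cnj u = 1" by (simp add: complex_norm_square[symmetric])
  have \<sigma>\<sigma>: "\<sigma> (\<sigma> z) = z" for z
  proof -
    have "\<sigma> (\<sigma> z) = (u * cnj u) * z" unfolding \<sigma>_def by simp
    with ucnj show ?thesis by simp
  qed
  have norm\<sigma>: "norm (\<sigma> z) = norm z" for z unfolding \<sigma>_def by (simp add: norm_mult u)
  have \<sigma>_fix: "\<sigma> z = z" if "z = exp w" "Im w = Im (L a)" for z w
  proof -
    have "\<sigma> z = exp (2 * \<i> * of_real (Im (L a)) + cnj w)"
      unfolding \<sigma>_def that(1) u_def by (simp add: exp_add exp_cnj)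
    also have "2 * \<i> * of_real (Im (L a)) + cnj w = w"
      using that(2) by (simp add: complex_eq_iff)
    finally show ?thesis using that(1) by simp
  qed
  have \<sigma>_fix': "\<sigma> z = z" if "z = exp w" "Im w = Im (L a) + pi" for z w
  proof -
    have "\<sigma> (exp (w - \<i> * pi)) = exp (w - \<i> * pi)"
      by (rule \<sigma>_fix[OF refl]) (use that in simp)
    moreover have "exp (w - \<i> * pi) = - z"
      unfolding exp_diff that(1) by simp
    ultimately have "\<sigma> (- z) = - z" by simp
    then show ?thesis unfolding \<sigma>_def by simp
  qed
  have aexp: "a = exp (L a)" and bexp: "b = exp (L b)" using L by (auto simp: continuous_log_on_def)
  \<comment> \<open>Conjugating twice keeps the reflected factor holomorphic. At 0 both factors have
    the same modulus, which squares \<open>norm (h 0)\<close>, while on \<open>J\<close> and on its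
    reflection one factor is at most \<open>\<epsilon>\<close> and the other at most 1.\<close>
  define h' where "h' z = h z * (cnj \<circ> (\<lambda>w. h (u * w)) \<circ> cnj) z" for z
  have h'eq: "h' z = h z * cnj (h (\<sigma> z))" for z by (simp add: h'_def \<sigma>_def)
  define J' where "J' = J \<union> \<sigma> ` J"
  have cont\<sigma>: "continuous_on A \<sigma>" for A unfolding \<sigma>_def by (intro continuous_intros)
  have eps: "0 \<le> \<epsilon>" using J(4)[OF L(2)] norm_ge_zero order_trans by blast
  show thesis
  proof (rule that[of h' J'])
    have "(\<lambda>w. h (u * w)) holomorphic_on ball 0 1"
      by (rule holomorphic_on_compose[of "\<lambda>w. u * w" _ h, unfolded o_def])
        (auto intro!: holomorphic_intros holomorphic_on_subset[OF h(1)] simp: norm_mult u)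
    moreover have "cnj ` ball 0 1 = ball 0 1"
    proof -
      have "x \<in> cnj ` ball 0 1" if "norm x < 1" for x
        using that by (intro image_eqI[of _ _ "cnj x"]) auto
      then show ?thesis by auto
    qed
    ultimately show "h' holomorphic_on ball 0 1"
      unfolding h'_def
      by (intro holomorphic_intros h(1) holomorphic_on_compose_cnj_cnj) (auto simp: open_ball)
    show h'1: "norm (h' z) \<le> 1" if "z \<in> ball 0 1" for z
      using h(2)[of z] h(2)[of "\<sigma> z"] that
      by (simp add: h'eq norm_mult norm\<sigma> mult_le_one)
    show "compact J'" unfolding J'_def
      using J(1) compact_continuous_image[OF cont\<sigma> J(1)] by (rule compact_Un)
    have "a = \<sigma> a" using \<sigma>_fix[OF aexp refl] by simp
    then have a: "a \<in> J \<inter> \<sigma> ` J" using L(2) by blast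
    then show "connected J'" unfolding J'_def
      using J(2) connected_continuous_image[OF cont\<sigma> J(2)] by (intro connected_Un) auto
    show "J' \<subseteq> ball 0 1 - {0}"
    proof -
      have "\<sigma> z \<noteq> 0" if "z \<noteq> 0" for z using that norm\<sigma>[of z] by auto
      then show ?thesis using J(3) norm\<sigma> unfolding J'_def by auto
    qed
    have "norm (h' z) \<le> \<epsilon>" "norm (h' (\<sigma> z)) \<le> \<epsilon>" if "z \<in> J" for z
    proof -
      have "norm (h z) \<le> \<epsilon>" "norm (h (\<sigma> z)) \<le> 1"
        using that J(3,4) h(2)[of "\<sigma> z"] norm\<sigma>[of z] by auto
      then have "norm (h z) * norm (h (\<sigma> z)) \<le> \<epsilon> * 1"
        by (intro mult_mono) (use eps in auto)
      then show "norm (h' z) \<le> \<epsilon>" "norm (h' (\<sigma> z)) \<le> \<epsilon>"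
        by (auto simp: h'eq \<sigma>\<sigma> norm_mult mult.commute)
    qed
    then show "norm (h' z) \<le> \<epsilon>" if "z \<in> J'" for z using that unfolding J'_def by auto
    show "norm (h' 0) = (norm (h 0))\<^sup>2"
      by (simp add: h'eq \<sigma>_def norm_mult power2_eq_square)
    fix L' assume L': "continuous_log_on L' J'"
    \<comment> \<open>The reflected logarithm on the reflected set, normalised to agree with
      \<open>L\<close> at the fixed point \<open>a\<close>. Hence \<open>L'\<close> differs from
      \<open>L\<close> and from \<open>L2\<close> by the same constant.\<close>
    define L2 where "L2 w = cnj (L (\<sigma> w)) + 2 * \<i> * of_real (Im (L a))" for w
    have "continuous_log_on L' J" "continuous_log_on L' (\<sigma> ` J)"
      using L' continuous_on_subset unfolding continuous_log_on_def J'_def by auto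
    moreover have "continuous_log_on L2 (\<sigma> ` J)"
    proof -
      have "continuous_on (\<sigma> ` J) (\<lambda>w. L (\<sigma> w))"
        by (rule continuous_on_compose2[OF _ cont\<sigma>])
          (use L(1) in \<open>auto simp: continuous_log_on_def \<sigma>\<sigma>\<close>)
      then have "continuous_on (\<sigma> ` J) L2" unfolding L2_def by (intro continuous_intros)
      moreover have "\<sigma> z = exp (L2 (\<sigma> z))" if "z \<in> J" for z
      proof -
        have "exp (L z) = z" using L(1) that by (auto simp: continuous_log_on_def)
        then show ?thesis unfolding L2_def \<sigma>\<sigma> exp_add by (simp add: \<sigma>_def u_def flip: exp_cnj)
      qed
      ultimately show ?thesis by (auto simp: continuous_log_on_def)
    qed
    moreover have "connected (\<sigma> ` J)" by (rule connected_continuous_image[OF cont\<sigma> J(2)])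
    ultimately obtain c c' where c: "\<And>z. z \<in> J \<Longrightarrow> L' z = L z + c"
        and c': "\<And>z. z \<in> \<sigma> ` J \<Longrightarrow> L' z = L2 z + c'"
      using L(1) J(2) continuous_logs_differ_by_constant by metis
    have "L2 a = L a" unfolding L2_def \<open>a = \<sigma> a\<close>[symmetric] by (simp add: complex_eq_iff)
    then have "c' = c" using c[of a] c'[of a] a by simp
    have L'\<sigma>: "Im (L' (\<sigma> z)) = 2 * Im (L a) - Im (L z) + Im c" if "z \<in> J" for z
      using c'[of "\<sigma> z"] that by (simp add: L2_def \<sigma>\<sigma> \<open>c' = c\<close>)
    \<comment> \<open>With angular extent \<open>pi\<close> or more, \<open>J\<close> meets the
      opposite half of the axis in a point fixed by \<open>\<sigma>\<close>. There the two
      expressions for \<open>L'\<close> have imaginary parts that differ by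
      \<open>2 * pi\<close>.\<close>
    have "t < pi"
    proof (rule ccontr)
      assume "\<not> t < pi"
      then have "Im (L a) \<le> Im (L a) + pi" "Im (L a) + pi \<le> Im (L b)" using L(4) by auto
      moreover have "connected ((\<lambda>z. Im (L z)) ` J)"
        using L(1) J(2) unfolding continuous_log_on_def
        by (intro connected_continuous_image continuous_intros) auto
      ultimately have "Im (L a) + pi \<in> (\<lambda>z. Im (L z)) ` J"
        using L(2,3) unfolding connected_iff_interval by blast
      then obtain z where z: "z \<in> J" "Im (L z) = Im (L a) + pi" by auto
      then have "z = exp (L z)" using L(1) by (auto simp: continuous_log_on_def)
      then have "\<sigma> z = z" using \<sigma>_fix' z(2) by blast
      then show False using L'\<sigma>[OF z(1)] c[OF z(1)] z(2) pi_gt_zero by simp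
    qed
    moreover have "2 * t \<le> Im (L' b) - Im (L' (\<sigma> b))"
      using L'\<sigma>[OF L(3)] c[OF L(3)] L(4) by simp
    ultimately show "t < pi \<and> (\<exists>a'\<in>J'. \<exists>b'\<in>J'. 2 * t \<le> Im (L' b') - Im (L' a'))"
      using L(3) unfolding J'_def by blast
  qed
qed

text \<open>Each reflection doubles the angular extent \<open>pi / 2 ^ k\<close> and squares the
  modulus at the centre. After \<open>k\<close> of them the extent is \<open>pi\<close>, and one
  more leaves no logarithm; this is the exponent \<open>2 ^ Suc k\<close>. If the logarithm
  disappears earlier, the bound is only better, as the modulus at 0 is at most 1.\<close>

lemma norm_centre_le_aux:
  assumes "h holomorphic_on ball 0 1" "\<And>z. z \<in> ball 0 1 \<Longrightarrow> norm (h z) \<le> 1"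
    and "compact J" "connected J" "J \<subseteq> ball 0 1 - {0}" "\<And>z. z \<in> J \<Longrightarrow> norm (h z) \<le> \<epsilon>"
    and "continuous_log_on L J" "a \<in> J" "b \<in> J" "pi / 2 ^ k \<le> Im (L b) - Im (L a)"
  shows "norm (h 0) ^ (2 ^ Suc k) \<le> \<epsilon>"
  using assms
proof (induction k arbitrary: h J L a b)
  case 0
  obtain h' J' where h': "h' holomorphic_on ball 0 1" "\<And>z. z \<in> ball 0 1 \<Longrightarrow> norm (h' z) \<le> 1"
    "compact J'" "connected J'" "J' \<subseteq> ball 0 1 - {0}" "\<And>z. z \<in> J' \<Longrightarrow> norm (h' z) \<le> \<epsilon>"
    "norm (h' 0) = (norm (h 0))\<^sup>2"
    "\<And>L'. continuous_log_on L' J' \<Longrightarrow> pi < pi \<and> (\<exists>a'\<in>J'. \<exists>b'\<in>J'. 2 * pi \<le> Im (L' b') - Im (L' a'))"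
    by (rule reflection_doubling[OF 0(1,2,3,4,5,6,7,8,9), of pi]) (use 0(10) in auto)
  then have no: "\<nexists>L'. continuous_log_on L' J'" by blast
  have "norm (h' 0) \<le> \<epsilon>" by (rule norm_le_of_no_log[OF h'(1,3,5,6) no])
  then show ?case using h'(7) by simp
next
  case (Suc k)
  obtain h' J' where h': "h' holomorphic_on ball 0 1" "\<And>z. z \<in> ball 0 1 \<Longrightarrow> norm (h' z) \<le> 1"
    "compact J'" "connected J'" "J' \<subseteq> ball 0 1 - {0}" "\<And>z. z \<in> J' \<Longrightarrow> norm (h' z) \<le> \<epsilon>"
    "norm (h' 0) = (norm (h 0))\<^sup>2"
    "\<And>L'. continuous_log_on L' J' \<Longrightarrow>
      pi / 2 ^ Suc k < pi \<and> (\<exists>a'\<in>J'. \<exists>b'\<in>J'. 2 * (pi / 2 ^ Suc k) \<le> Im (L' b') - Im (L' a'))"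
    by (rule reflection_doubling[OF Suc.prems]) auto
  have "norm (h' 0) ^ (2 ^ Suc k) \<le> \<epsilon>"
  proof (cases "\<exists>L'. continuous_log_on L' J'")
    case True
    then obtain L' where L': "continuous_log_on L' J'" by blast
    then obtain a' b' where "a' \<in> J'" "b' \<in> J'" "2 * (pi / 2 ^ Suc k) \<le> Im (L' b') - Im (L' a')"
      using h'(8) by blast
    then show ?thesis by (intro Suc.IH[OF h'(1-6) L']) auto
  next
    case False
    have "norm (h' 0) \<le> \<epsilon>" by (rule norm_le_of_no_log[OF h'(1,3,5,6) False])
    moreover have "norm (h' 0) ^ (2 ^ Suc k) \<le> norm (h' 0) ^ 1"
      by (rule power_decreasing) (use h'(2)[of 0] in auto)
    ultimately show ?thesis by simp
  qed
  then show ?case unfolding h'(7) by (simp flip: power_mult)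
qed

text \<open>A quantitative form of Koebe's lemma.\<close>

lemma norm_centre_le:
  assumes h: "h holomorphic_on ball 0 1" "\<And>z. z \<in> ball 0 1 \<Longrightarrow> norm (h z) \<le> M" "0 < M"
    and J: "compact J" "connected J" "J \<subseteq> ball 0 1 - ball 0 r" "\<And>z. z \<in> J \<Longrightarrow> norm (h z) \<le> \<epsilon>"
    and ab: "a \<in> J" "b \<in> J" "0 < r" "pi / 2 ^ k + ln (1 / r) \<le> dist a b"
  shows "(norm (h 0) / M) ^ (2 ^ Suc k) \<le> \<epsilon> / M"
proof -
  define g where "g z = h z / of_real M" for z
  have g: "g holomorphic_on ball 0 1" unfolding g_def using h by (intro holomorphic_intros) auto
  have g1: "norm (g z) \<le> 1" if "z \<in> ball 0 1" for z
    using h(2)[OF that] h(3) by (simp add: g_def norm_divide)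
  have J0: "J \<subseteq> ball 0 1 - {0}" using J(3) ab(3) by auto
  have g\<epsilon>: "norm (g z) \<le> \<epsilon> / M" if "z \<in> J" for z
    using J(4)[OF that] h(3) by (simp add: g_def norm_divide divide_right_mono)
  have "norm (g 0) ^ (2 ^ Suc k) \<le> \<epsilon> / M"
  proof (cases "\<exists>L. continuous_log_on L J")
    case True
    then obtain L where L: "continuous_log_on L J" by blast
    have Re: "ln r \<le> Re (L z)" "Re (L z) \<le> 0" if "z \<in> J" for z
    proof -
      have "norm z = exp (Re (L z))"
        using L that by (metis continuous_log_on_def norm_exp_eq_Re)
      moreover have "r \<le> norm z" "norm z < 1" using that J(3) by auto
      ultimately have "Re (L z) = ln (norm z)" "r \<le> norm z" "norm z < 1" by auto
      then show "ln r \<le> Re (L z)" "Re (L z) \<le> 0"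
        using ab(3) ln_le_cancel_iff[of r "norm z"] ln_le_zero_iff[of "norm z"]
          less_le_trans[of 0 r "norm z"] by simp_all
    qed
    \<comment> \<open>\<open>exp\<close> is 1-Lipschitz on the left half-plane. As the real parts of
      \<open>L\<close> vary by at most \<open>ln (1 / r)\<close>, the rest of the distance must come
      from the arguments.\<close>
    have "dist a b \<le> norm (L a - L b)"
    proof -
      have "norm (exp (L a) - exp (L b)) \<le> 1 * norm (L a - L b)"
      proof (rule field_differentiable_bound[of "{z. Re z \<le> 0}" exp exp])
        show "(exp has_field_derivative exp z) (at z within {z. Re z \<le> 0})" for z
          by (auto intro!: derivative_eq_intros)
      qed (use Re ab in \<open>auto simp: convex_halfspace_Re_le\<close>)
      then show ?thesis using L ab by (auto simp: continuous_log_on_def dist_norm)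
    qed
    also have "\<dots> \<le> \<bar>Re (L a) - Re (L b)\<bar> + \<bar>Im (L a) - Im (L b)\<bar>"
      using cmod_le[of "L a - L b"] by simp
    also have "\<bar>Re (L a) - Re (L b)\<bar> \<le> ln (1 / r)"
      using Re[OF ab(1)] Re[OF ab(2)] ab(3) by (simp add: ln_div)
    finally have "pi / 2 ^ k \<le> \<bar>Im (L a) - Im (L b)\<bar>" using ab(4) by simp
    then consider "pi / 2 ^ k \<le> Im (L b) - Im (L a)" | "pi / 2 ^ k \<le> Im (L a) - Im (L b)"
      by linarith
    then show ?thesis
      using norm_centre_le_aux[OF g g1 J(1,2) J0 g\<epsilon> L] ab(1,2) by cases auto
  next
    case False
    have "norm (g 0) \<le> \<epsilon> / M" by (rule norm_le_of_no_log[OF g J(1) J0 g\<epsilon> False])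
    moreover have "norm (g 0) ^ (2 ^ Suc k) \<le> norm (g 0) ^ 1"
      by (rule power_decreasing) (use g1[of 0] in auto)
    ultimately show ?thesis by simp
  qed
  then show ?thesis using h(3) by (simp add: g_def norm_divide)
qed

section \<open>Boundary behaviour of the Riemann map of a Jordan domain\<close>

text \<open>Let \<open>B\<close> be the curve without a small open arc around \<open>w\<close>. It
  is connected, and it is the intersection of the curve with \<open>B \<union> sphere w e\<close>.
  Two points of the domain near \<open>w\<close> are separated neither by the curve nor by
  \<open>B \<union> sphere w e\<close>, hence by Janiszewski's theorem not by their union. A
  connected set avoiding this union can leave neither the domain nor the ball.\<close>

lemma inside_Jordan_locally_connected_at_boundary:
  fixes c :: "real \<Rightarrow> complex"
  assumes c: "simple_path c" "pathfinish c = pathstart c" and w: "w \<in> path_image c" and "0 < e"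
  obtains d where "0 < d"
    "\<And>a b. a \<in> inside (path_image c) \<inter> ball w d \<Longrightarrow> b \<in> inside (path_image c) \<inter> ball w d \<Longrightarrow>
      path_component (inside (path_image c) \<inter> ball w e) a b"
proof -
  define C where "C = path_image c"
  obtain s where s: "s \<in> {0..1}" "c s = w" using w unfolding path_image_def by auto
  define p where "p = shiftpath s c"
  have p: "simple_path p" "pathfinish p = pathstart p" "path_image p = C"
    unfolding p_def C_def using c s(1)
    by (auto simp: simple_path_shiftpath path_image_shiftpath closed_shiftpath)
  have p0: "p 0 = w" "p 1 = w"
    using p(2) s pathstart_shiftpath[of s c] by (auto simp: p_def pathstart_def pathfinish_def)
  have contp: "continuous_on {0..1} p" using p(1) by (simp add: simple_path_def path_def)
  obtain t where t: "0 < t" "t < 1/2" "\<And>x. x \<in> {0..1} \<Longrightarrow> x < t \<or> 1 - t < x \<Longrightarrow> p x \<in> ball w e"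
  proof -
    obtain t1 where t1: "t1 > 0" "\<And>x. x \<in> {0..1} \<Longrightarrow> dist x 0 < t1 \<Longrightarrow> dist (p x) w < e"
      using contp \<open>0 < e\<close> p0 unfolding continuous_on_iff by (metis atLeastAtMost_iff zero_le_one order_refl)
    obtain t2 where t2: "t2 > 0" "\<And>x. x \<in> {0..1} \<Longrightarrow> dist x 1 < t2 \<Longrightarrow> dist (p x) w < e"
      using contp \<open>0 < e\<close> p0 unfolding continuous_on_iff by (metis atLeastAtMost_iff zero_le_one order_refl)
    show thesis
    proof (rule that[of "min (1/4) (min t1 t2)"])
      fix x :: real assume "x \<in> {0..1}" "x < min (1/4) (min t1 t2) \<or> 1 - min (1/4) (min t1 t2) < x"
      then have "dist x 0 < t1 \<or> dist x 1 < t2" by (auto simp: dist_real_def)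
      then show "p x \<in> ball w e"
        using t1(2) t2(2) \<open>x \<in> {0..1}\<close> by (auto simp: dist_commute)
    qed (use t1(1) t2(1) in auto)
  qed
  define B where "B = p ` {t..1 - t}"
  have contB: "continuous_on {t..1 - t} p" using contp t(1) by (auto intro: continuous_on_subset)
  have B: "compact B" "connected B" "B \<noteq> {}"
    unfolding B_def using contB t(1,2)
    by (auto intro: compact_continuous_image connected_continuous_image)
  have BC: "B \<subseteq> C" unfolding B_def p(3)[symmetric] path_image_def using t(1) by auto
  have CB: "C - B \<subseteq> ball w e"
    unfolding p(3)[symmetric] path_image_def B_def using t(3) by (fastforce simp: not_le)
  have "w \<notin> B"
  proof
    assume "w \<in> B"
    then obtain x where "x \<in> {t..1 - t}" "p x = p 0" using p0 unfolding B_def by auto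
    then show False using p(1) t(1,2) unfolding simple_path_def loop_free_def by force
  qed
  have cl: "closed (B \<union> sphere w e)" using B(1) by (intro closed_Un) (auto simp: compact_imp_closed)
  have "w \<in> - (B \<union> sphere w e)" using \<open>w \<notin> B\<close> \<open>0 < e\<close> by auto
  then obtain d where d: "d > 0" "ball w d \<subseteq> - (B \<union> sphere w e)"
    using cl open_Compl openE by (metis (no_types, lifting))
  have J: "connected (inside C)" "open (inside C)" "frontier (inside C) = C"
    using Jordan_inside_outside[OF c] unfolding C_def by auto
  have "path_component (inside C \<inter> ball w e) a b"
    if ab: "a \<in> inside C \<inter> ball w d" "b \<in> inside C \<inter> ball w d" for a b
  proof -
    have eq: "C \<inter> (B \<union> sphere w e) = B" using BC CB by auto
    have "connected_component (- (C \<union> (B \<union> sphere w e))) a b"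
    proof (rule Janiszewski)
      show "compact C" unfolding C_def by (simp add: c(1) compact_simple_path_image)
      show "connected (C \<inter> (B \<union> sphere w e))" using B(2) eq by simp
      have "inside C \<subseteq> - C" using inside_no_overlap[of C] by blast
      then show "connected_component (- C) a b"
        using J(1) ab unfolding connected_component_def by blast
      show "connected_component (- (B \<union> sphere w e)) a b"
        using d(2) ab unfolding connected_component_def
        by (intro exI[of _ "ball w d"]) auto
    qed (rule cl)
    then obtain W where W: "connected W" "W \<subseteq> - (C \<union> (B \<union> sphere w e))" "a \<in> W" "b \<in> W"
      unfolding connected_component_def by blast
    have "W \<subseteq> inside C"
    proof (rule ccontr)
      assume "\<not> W \<subseteq> inside C"
      then have "W \<inter> frontier (inside C) \<noteq> {}"
        using W(1,3) ab by (intro connected_Int_frontier) auto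
      then show False using W(2) J(3) by auto
    qed
    moreover have "W \<subseteq> ball w e"
    proof (rule ccontr)
      assume "\<not> W \<subseteq> ball w e"
      moreover have "d \<le> e"
      proof (rule ccontr)
        assume "\<not> d \<le> e"
        then have "w + of_real e \<in> ball w d \<inter> sphere w e" using \<open>0 < e\<close> by (auto simp: dist_norm)
        then show False using d(2) by blast
      qed
      then have "a \<in> ball w e" using ab by auto
      ultimately have "W \<inter> frontier (ball w e) \<noteq> {}"
        using W(1,3) by (intro connected_Int_frontier) auto
      then show False using W(2) \<open>0 < e\<close> by (auto simp: frontier_ball)
    qed
    ultimately have "connected_component (inside C \<inter> ball w e) a b"
      using W unfolding connected_component_def by blast
    then show ?thesis using J(2) by (metis open_Int open_ball open_path_connected_component)
  qed
  then show thesis using d(1) that unfolding C_def by blast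
qed

text \<open>The points \<open>a\<close> and \<open>b\<close> cut the curve into two arcs. If each
  contained a point outside \<open>T\<close>, these two points would cut the curve into closed arcs
  that separate \<open>a\<close> from \<open>b\<close> in \<open>T\<close>. So one of the open arcs
  lies in \<open>T\<close>, and a point inside it has the required neighbourhood.\<close>

lemma connected_subset_Jordan_interior:
  fixes c :: "real \<Rightarrow> complex"
  assumes c: "simple_path c" "pathfinish c = pathstart c"
    and T: "closed T" "connected T" "T \<subseteq> path_image c" "a \<in> T" "b \<in> T" "a \<noteq> b"
  obtains p r where "p \<in> T" "0 < r" "path_image c \<inter> ball p r \<subseteq> T"
proof -
  define C where "C = path_image c"
  obtain s where s: "s \<in> {0..1}" "c s = a" using T(3,4) unfolding path_image_def by auto
  define p where "p = shiftpath s c"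
  have p: "simple_path p" "pathfinish p = pathstart p" "path_image p = C"
    unfolding p_def C_def using c s(1)
    by (auto simp: simple_path_shiftpath path_image_shiftpath closed_shiftpath)
  have p0: "p 0 = a" "p 1 = a"
    using p(2) s pathstart_shiftpath[of s c] by (auto simp: p_def pathstart_def pathfinish_def)
  have inj: "x = y \<or> x = 0 \<and> y = 1 \<or> x = 1 \<and> y = 0" if "x \<in> {0..1}" "y \<in> {0..1}" "p x = p y" for x y
    using p(1) that unfolding simple_path_def loop_free_def by blast
  have contp: "continuous_on {0..1} p" using p(1) by (simp add: simple_path_def path_def)
  have comp: "compact (p ` A)" if "compact A" "A \<subseteq> {0..1}" for A
    using that contp by (intro compact_continuous_image) (auto intro: continuous_on_subset)
  have C: "C = p ` {0..1}" using p(3) by (simp add: path_image_def)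
  obtain u where u: "u \<in> {0..1}" "p u = b" using T(3,5) C unfolding C_def by auto
  have u01: "0 < u" "u < 1" using u p0 T(6) by (auto simp: less_le)
  have key: "p ` {0<..<u} \<subseteq> T \<or> p ` {u<..<1} \<subseteq> T"
  proof (rule ccontr)
    assume "\<not> ?thesis"
    then obtain x y where xy: "x \<in> {0<..<u}" "p x \<notin> T" "y \<in> {u<..<1}" "p y \<notin> T" by blast
    define P where "P = p ` {x..y}"
    define R where "R = p ` ({0..x} \<union> {y..1})"
    have "closed P" "closed R" unfolding P_def R_def using xy u01 by (auto intro!: compact_imp_closed comp)
    moreover have "T \<subseteq> P \<union> R" using T(3) C xy unfolding P_def R_def C_def by force
    moreover have "P \<inter> R \<inter> T = {}"
    proof (rule ccontr)
      assume "P \<inter> R \<inter> T \<noteq> {}"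
      then obtain v v' where v: "v \<in> {x..y}" "v' \<in> {0..x} \<union> {y..1}" "p v = p v'" "p v \<in> T"
        unfolding P_def R_def by blast
      then have "v = v'" using inj[of v v'] xy u01 by auto
      then have "v = x \<or> v = y" using v by auto
      then show False using xy v(4) by auto
    qed
    moreover have "p u \<in> P" "p 0 \<in> R" unfolding P_def R_def using xy by auto
    then have "b \<in> P \<inter> T" "a \<in> R \<inter> T" using T(4,5) u(2) p0(1) by auto
    ultimately show False using T(2) unfolding connected_closed by blast
  qed
  note result = that
  have fin: thesis if lu: "0 \<le> l" "l < u'" "u' \<le> 1" "p ` {l<..<u'} \<subseteq> T" for l u'
  proof -
    define m where "m = (l + u') / 2"
    have m: "l < m" "m < u'" using lu by (auto simp: m_def)
    let ?K = "p ` ({0..l} \<union> {u'..1})"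
    have "p m \<notin> ?K"
    proof
      assume "p m \<in> ?K"
      then obtain v where "v \<in> {0..l} \<union> {u'..1}" "p m = p v" by blast
      then show False using inj[of m v] m lu by auto
    qed
    moreover have "closed ?K" using lu by (intro compact_imp_closed comp) auto
    ultimately obtain r where r: "r > 0" "ball (p m) r \<inter> ?K = {}"
      by (metis Compl_iff disjoint_eq_subset_Compl open_Compl openE)
    have "C \<inter> ball (p m) r \<subseteq> T" using C r(2) lu(4) by (force simp: not_le)
    moreover have "p m \<in> T" using m lu(4) by auto
    ultimately show thesis using result[of "p m" r] r(1) unfolding C_def by blast
  qed
  show thesis using key fin[of 0 u] fin[of u 1] u01 by auto
qed

text \<open>The maximum principle is applied to \<open>G z - \<zeta>\<close> divided by high powers
  of \<open>z - ou\<close>, where \<open>ou\<close> is outside the closed domain and near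
  \<open>p\<close>. On the frontier of \<open>V\<close> this vanishes at frontier points of the
  domain, and elsewhere the distance to \<open>ou\<close> is at least 3/8 of \<open>r\<close>,
  whereas \<open>q\<close> is within 1/4 of \<open>r\<close>. Each power gains a factor 2/3, so
  \<open>G q = \<zeta>\<close>.\<close>

lemma holomorphic_boundary_arc_not_constant:
  fixes G :: "complex \<Rightarrow> complex"
  assumes "open \<Omega>" "G holomorphic_on \<Omega>" "continuous_on (closure \<Omega>) G"
    and M: "\<And>z. z \<in> closure \<Omega> \<Longrightarrow> norm (G z - \<zeta>) \<le> M"
    and p: "p \<in> frontier \<Omega>" "p \<in> closure (- closure \<Omega>)" "0 < r"
    and zero: "\<And>z. z \<in> frontier \<Omega> \<inter> ball p r \<Longrightarrow> G z = \<zeta>"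
  obtains q where "q \<in> \<Omega>" "G q = \<zeta>"
proof -
  obtain q where q: "q \<in> \<Omega>" "dist q p < r / 8"
    using p(1,3) unfolding frontier_def closure_approachable by (metis DiffD1 closure_approachable zero_less_divide_iff zero_less_numeral)
  obtain ou where ou: "ou \<notin> closure \<Omega>" "dist ou p < r / 8"
    using p(2,3) unfolding closure_approachable by (metis Compl_iff closure_approachable zero_less_divide_iff zero_less_numeral)
  define V where "V = \<Omega> \<inter> ball p (r / 2)"
  have V: "open V" "bounded V" "closure V \<subseteq> closure \<Omega>" "q \<in> V"
    using assms(1) q p(3) by (auto simp: V_def dist_commute closure_mono intro: bounded_subset[OF bounded_ball])
  have clV: "closure V \<subseteq> cball p (r / 2)"
    by (rule closure_minimal) (auto simp: V_def)
  have bound: "norm (G q - \<zeta>) \<le> M * (2 / 3) ^ n" for n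
  proof -
    define h where "h z = (G z - \<zeta>) * (inverse (z - ou)) ^ n" for z
    have "norm (h q) \<le> M * inverse (3 * r / 8) ^ n"
    proof (rule maximum_modulus_frontier[of h V])
      have "h holomorphic_on V"
        unfolding h_def using assms(2) ou(1) closure_subset
        by (intro holomorphic_intros) (auto simp: V_def intro: holomorphic_on_subset)
      then show "h holomorphic_on interior V" using V(1) by (simp add: interior_open)
      show "continuous_on (closure V) h"
        unfolding h_def using assms(3) ou(1) V(3)
        by (intro continuous_intros) (auto intro: continuous_on_subset)
      fix z assume z: "z \<in> frontier V"
      then have zc: "z \<in> closure \<Omega>" "z \<in> cball p (r/2)" "z \<notin> V"
        using V(1,3) clV by (auto simp: frontier_def interior_open)
      have M0: "0 \<le> M" using M[OF zc(1)] norm_ge_zero order_trans by blast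
      show "norm (h z) \<le> M * inverse (3 * r / 8) ^ n"
      proof (cases "z \<in> \<Omega>")
        case True
        then have "dist p z = r / 2" using zc by (auto simp: V_def)
        then have "3 * r / 8 \<le> norm (z - ou)"
          using ou(2) dist_triangle[of p z ou] by (simp add: dist_norm norm_minus_commute)
        then have "inverse (norm (z - ou)) \<le> inverse (3 * r / 8)"
          using p(3) by (intro le_imp_inverse_le) auto
        then have "inverse (norm (z - ou)) ^ n \<le> inverse (3 * r / 8) ^ n"
          by (rule power_mono) simp
        then show ?thesis
          unfolding h_def norm_mult norm_power norm_inverse
          by (intro mult_mono M zc M0) auto
      next
        case False
        then have "z \<in> frontier \<Omega>" using zc assms(1) by (simp add: frontier_def interior_open)
        then have "G z = \<zeta>" using zero zc(2) p(3) by auto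
        then show ?thesis using M0 p(3) by (simp add: h_def)
      qed
    qed (use V in auto)
    moreover have "norm (G q - \<zeta>) = norm (h q) * norm (q - ou) ^ n"
    proof -
      have "q \<noteq> ou" using q(1) ou(1) closure_subset by auto
      then show ?thesis
        by (simp add: h_def norm_mult norm_power norm_inverse power_inverse)
    qed
    moreover have "norm (q - ou) ^ n \<le> (r / 4) ^ n"
    proof (rule power_mono)
      show "norm (q - ou) \<le> r / 4"
        using q(2) ou(2) dist_triangle2[of q ou p] by (simp add: dist_norm)
    qed simp
    ultimately have "norm (G q - \<zeta>) \<le> (M * inverse (3 * r / 8) ^ n) * (r / 4) ^ n"
      by (auto intro!: mult_mono elim: order_trans[OF norm_ge_zero])
    also have "\<dots> = M * (inverse (3 * r / 8) * (r / 4)) ^ n" by (simp only: power_mult_distrib mult.assoc)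
    also have "inverse (3 * r / 8) * (r / 4) = 2 / 3" using p(3) by (simp add: field_simps)
    finally show ?thesis .
  qed
  have "(\<lambda>n. M * (2 / 3) ^ n) \<longlonglongrightarrow> M * 0"
    by (intro tendsto_mult tendsto_const LIMSEQ_realpow_zero) auto
  then have "norm (G q - \<zeta>) \<le> M * 0"
    using bound by (intro LIMSEQ_le_const) auto
  then show thesis using that[of q] q(1) by auto
qed

text \<open>Otherwise there are points ever closer to each other with images at least
  \<open>e\<close> apart, accumulating at some \<open>w\<close>, which has to lie on the curve.
  Paths in the domain join them near \<open>w\<close>; the images of these paths under
  \<open>G\<close> are continua of diameter at least \<open>e\<close> near the circle, on which
  \<open>F - w\<close> is tiny. Koebe's lemma excludes this because
  \<open>F 0 \<noteq> w\<close>.\<close>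

lemma Riemann_map_inverse_uniformly_continuous:
  fixes c :: "real \<Rightarrow> complex"
  assumes c: "simple_path c" "pathfinish c = pathstart c"
    and F: "F holomorphic_on ball 0 1" "\<And>z. z \<in> ball 0 1 \<Longrightarrow> F z \<in> inside (path_image c) \<and> G (F z) = z"
    and G: "G holomorphic_on inside (path_image c)"
      "\<And>z. z \<in> inside (path_image c) \<Longrightarrow> G z \<in> ball 0 1 \<and> F (G z) = z"
  shows "uniformly_continuous_on (inside (path_image c)) G"
proof (rule ccontr)
  define C where "C = path_image c"
  define \<Omega> where "\<Omega> = inside C"
  have J: "open \<Omega>" "bounded \<Omega>" "frontier \<Omega> = C"
    using Jordan_inside_outside[OF c] unfolding C_def \<Omega>_def by auto
  have F': "F z \<in> \<Omega>" "G (F z) = z" if "z \<in> ball 0 1" for z using F(2)[OF that] by (auto simp: \<Omega>_def C_def)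
  have G': "G z \<in> ball 0 1" "F (G z) = z" if "z \<in> \<Omega>" for z using G(2) that by (auto simp: \<Omega>_def C_def)
  have contG: "continuous_on \<Omega> G" using G(1) by (simp add: \<Omega>_def C_def holomorphic_on_imp_continuous_on)
  have contF: "continuous_on (ball 0 1) F" using F(1) by (simp add: holomorphic_on_imp_continuous_on)
  assume "\<not> ?thesis"
  then obtain e where e: "e > 0" "\<And>d. d > 0 \<Longrightarrow> \<exists>x\<in>\<Omega>. \<exists>y\<in>\<Omega>. dist y x < d \<and> e \<le> dist (G y) (G x)"
    unfolding uniformly_continuous_on_def \<Omega>_def C_def by (metis not_le)
  have "\<exists>x y. x \<in> \<Omega> \<and> y \<in> \<Omega> \<and> dist y x < inverse (real (Suc n)) \<and> e \<le> dist (G y) (G x)" for n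
    using e(2)[of "inverse (real (Suc n))"] by auto
  then obtain X Y where XY: "\<And>n. X n \<in> \<Omega>" "\<And>n. Y n \<in> \<Omega>"
      "\<And>n. dist (Y n) (X n) < inverse (real (Suc n))" "\<And>n. e \<le> dist (G (Y n)) (G (X n))"
    by metis
  have "compact (closure \<Omega>)" using J(2) by (simp add: compact_closure)
  moreover have "X n \<in> closure \<Omega>" for n using XY(1) closure_subset by blast
  ultimately obtain w \<rho> where w: "w \<in> closure \<Omega>" "strict_mono (\<rho> :: nat \<Rightarrow> nat)" "(X \<circ> \<rho>) \<longlonglongrightarrow> w"
    unfolding compact_def by metis
  have Xw: "(\<lambda>n. X (\<rho> n)) \<longlonglongrightarrow> w" using w(3) by (simp add: o_def)
  have inv0: "(\<lambda>n. inverse (real (Suc (\<rho> n)))) \<longlonglongrightarrow> 0"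
    using LIMSEQ_subseq_LIMSEQ[OF LIMSEQ_inverse_real_of_nat w(2)] by (simp add: o_def)
  have "\<forall>n. norm (dist (Y (\<rho> n)) (X (\<rho> n))) \<le> inverse (real (Suc (\<rho> n)))"
  proof
    show "norm (dist (Y (\<rho> n)) (X (\<rho> n))) \<le> inverse (real (Suc (\<rho> n)))" for n
      using XY(3)[of "\<rho> n"] by simp
  qed
  then have YX: "(\<lambda>n. dist (Y (\<rho> n)) (X (\<rho> n))) \<longlonglongrightarrow> 0"
    by (rule Lim_null_comparison[OF always_eventually inv0])
  have XW: "(\<lambda>n. dist (X (\<rho> n)) w) \<longlonglongrightarrow> 0" by (rule tendsto_dist_iff[THEN iffD1, OF Xw])
  have "\<forall>n. norm (dist (Y (\<rho> n)) w) \<le> dist (Y (\<rho> n)) (X (\<rho> n)) + dist (X (\<rho> n)) w"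
    using dist_triangle by auto
  then have "(\<lambda>n. dist (Y (\<rho> n)) w) \<longlonglongrightarrow> 0"
    by (rule Lim_null_comparison[OF always_eventually tendsto_add_zero[OF YX XW]])
  then have Yw: "(\<lambda>n. Y (\<rho> n)) \<longlonglongrightarrow> w" by (rule tendsto_dist_iff[THEN iffD2])
  show False
  proof (cases "w \<in> \<Omega>")
    case True
    then have "isCont G w" using contG by (simp add: continuous_on_eq_continuous_at[OF J(1)])
    then have "(\<lambda>n. dist (G (Y (\<rho> n))) (G (X (\<rho> n)))) \<longlonglongrightarrow> dist (G w) (G w)"
      by (intro tendsto_dist isCont_tendsto_compose[OF _ Xw] isCont_tendsto_compose[OF _ Yw])
    then have "e \<le> dist (G w) (G w)" using XY(4) by (intro LIMSEQ_le_const) auto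
    then show False using e(1) by simp
  next
    case False
    then have wC: "w \<in> path_image c" using w(1) J(3) closure_Un_frontier[of \<Omega>] by (auto simp: C_def)
    obtain M where M: "M > 0" "\<And>z. z \<in> \<Omega> \<Longrightarrow> norm (z - w) \<le> M"
    proof -
      have "bounded ((\<lambda>z. z - w) ` \<Omega>)" using J(2) bounded_translation_minus by blast
      then show thesis using that unfolding bounded_pos by blast
    qed
    define h where "h z = F z - w" for z
    have h: "h holomorphic_on ball 0 1" "\<And>z. z \<in> ball 0 1 \<Longrightarrow> norm (h z) \<le> M"
      unfolding h_def using F(1) M(2) F' by (auto intro!: holomorphic_intros)
    have h0: "norm (h 0) > 0" using F'(1)[of 0] False by (auto simp: h_def)
    \<comment> \<open>In \<open>norm_centre_le\<close>, one half of \<open>e\<close> pays for the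
      angle \<open>pi / 2 ^ k\<close> and the other half for the radial variation
      \<open>ln (1 / r)\<close>.\<close>
    obtain k where k: "pi / 2 ^ k < e / 2"
    proof -
      obtain k where "(1/2) ^ k < e / (2 * pi)"
        using real_arch_pow_inv[of "e / (2 * pi)" "1/2"] e(1) by auto
      then have "pi / 2 ^ k < e / 2" by (simp add: field_simps power_divide)
      then show thesis by (rule that)
    qed
    define r where "r = exp (- e / 2)"
    have r: "0 < r" "r < 1" "ln (1 / r) = e / 2" using e(1) by (auto simp: r_def ln_div)
    \<comment> \<open>Half of the least value that \<open>norm_centre_le\<close> would
      permit.\<close>
    define \<epsilon> where "\<epsilon> = M * (norm (h 0) / M) ^ (2 ^ Suc k) / 2"
    have \<epsilon>: "\<epsilon> > 0" using M(1) h0 by (simp add: \<epsilon>_def)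
    have "cball 0 r \<subseteq> ball (0::complex) 1" using r by auto
    then have "compact (F ` cball 0 r)" "w \<notin> F ` cball 0 r"
      using contF F' False by (auto intro!: compact_continuous_image intro: continuous_on_subset)
    \<comment> \<open>A path within \<open>\<delta>\<close> of \<open>w\<close> has its image under
      \<open>G\<close> outside the disc of radius \<open>r\<close>.\<close>
    then obtain \<delta> where \<delta>: "\<delta> > 0" "ball w \<delta> \<subseteq> - F ` cball 0 r"
      by (metis Compl_iff compact_imp_closed open_Compl openE)
    have "min \<epsilon> \<delta> > 0" using \<epsilon> \<delta> by auto
    obtain d where d: "0 < d" "\<And>a b. a \<in> \<Omega> \<inter> ball w d \<Longrightarrow> b \<in> \<Omega> \<inter> ball w d \<Longrightarrow>
      path_component (\<Omega> \<inter> ball w (min \<epsilon> \<delta>)) a b"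
      using inside_Jordan_locally_connected_at_boundary[OF c wC \<open>min \<epsilon> \<delta> > 0\<close>]
      unfolding \<Omega>_def C_def by metis
    have "eventually (\<lambda>n. X (\<rho> n) \<in> ball w d \<and> Y (\<rho> n) \<in> ball w d) sequentially"
      using tendstoD[OF Xw d(1)] tendstoD[OF Yw d(1)] by eventually_elim (auto simp: dist_commute)
    then obtain n where "X (\<rho> n) \<in> ball w d" "Y (\<rho> n) \<in> ball w d"
      unfolding eventually_sequentially by blast
    then obtain P where P: "path P" "path_image P \<subseteq> \<Omega> \<inter> ball w (min \<epsilon> \<delta>)"
        "pathstart P = X (\<rho> n)" "pathfinish P = Y (\<rho> n)"
      using d(2)[of "X (\<rho> n)" "Y (\<rho> n)"] XY(1,2) unfolding path_component_def by auto
    define J where "J = G ` path_image P"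
    have contP: "continuous_on (path_image P) G" using P(2) contG by (auto intro: continuous_on_subset)
    have JF: "z \<in> ball 0 1 \<and> F z \<in> ball w (min \<epsilon> \<delta>)" if "z \<in> J" for z
      using that P(2) G' by (auto simp: J_def subset_eq)
    have "compact J" unfolding J_def using contP P(1) by (intro compact_continuous_image compact_path_image)
    moreover have "connected J"
      unfolding J_def using contP P(1) by (intro connected_continuous_image connected_path_image)
    moreover have "J \<subseteq> ball 0 1 - ball 0 r"
    proof
      fix z assume z: "z \<in> J"
      then have "F z \<in> ball w \<delta>" using JF by auto
      then have "z \<notin> cball 0 r" using \<delta>(2) by blast
      then show "z \<in> ball 0 1 - ball 0 r" using JF[OF z] by auto
    qed
    moreover have "norm (h z) \<le> \<epsilon>" if "z \<in> J" for z
      using JF[OF that] by (simp add: h_def dist_norm norm_minus_commute)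
    moreover have "G (X (\<rho> n)) \<in> J" "G (Y (\<rho> n)) \<in> J"
      unfolding J_def P(3,4)[symmetric] by auto
    moreover have "pi / 2 ^ k + ln (1 / r) \<le> dist (G (X (\<rho> n))) (G (Y (\<rho> n)))"
      using k r(3) XY(4)[of "\<rho> n"] dist_commute[of "G (Y (\<rho> n))" "G (X (\<rho> n))"] by linarith
    ultimately have "(norm (h 0) / M) ^ (2 ^ Suc k) \<le> \<epsilon> / M"
      using norm_centre_le[OF h M(1)] r(1) by blast
    moreover have "(norm (h 0) / M) ^ (2 ^ Suc k) > 0" using h0 M(1) by simp
    moreover have "\<epsilon> / M = (norm (h 0) / M) ^ (2 ^ Suc k) / 2" using M(1) by (simp add: \<epsilon>_def)
    ultimately show False by linarith
  qed
qed

text \<open>Caratheodory's theorem for Jordan domains.\<close>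

theorem Jordan_inside_homeomorphism:
  fixes c :: "real \<Rightarrow> complex"
  assumes c: "simple_path c" "pathfinish c = pathstart c"
  obtains f g where "homeomorphism (closure (inside (path_image c))) (cball (0::complex) 1) g f"
    "g ` path_image c = sphere 0 1"
proof -
  define C where "C = path_image c"
  define \<Omega> where "\<Omega> = inside C"
  have J: "\<Omega> \<noteq> {}" "open \<Omega>" "connected \<Omega>" "bounded \<Omega>" "frontier \<Omega> = C" "frontier (outside C) = C"
    "\<Omega> \<inter> outside C = {}" "\<Omega> \<union> outside C = - C"
    using Jordan_inside_outside[OF c] unfolding C_def \<Omega>_def by auto
  have clos: "closure \<Omega> = \<Omega> \<union> C" "\<Omega> \<inter> C = {}"
    using J(2,5) closure_Un_frontier[of \<Omega>] frontier_disjoint_eq[of \<Omega>] by auto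
  have "simply_connected \<Omega>"
  proof -
    have "- \<Omega> = closure (outside C)" using J(6,7,8) clos closure_Un_frontier[of "outside C"] by auto
    then have "connected (- \<Omega>)" using Jordan_inside_outside[OF c] by (simp add: C_def connected_imp_connected_closure)
    then show ?thesis using J simply_connected_iff_simple by blast
  qed
  moreover have "\<Omega> \<noteq> UNIV" using J(4) not_bounded_UNIV by metis
  ultimately obtain G F where G: "G holomorphic_on \<Omega>" and F: "F holomorphic_on ball 0 1"
      and G': "\<And>z. z \<in> \<Omega> \<Longrightarrow> G z \<in> ball 0 1 \<and> F (G z) = z"
      and F': "\<And>z. z \<in> ball 0 1 \<Longrightarrow> F z \<in> \<Omega> \<and> G (F z) = z"
    using Riemann_mapping_theorem[of \<Omega>] J(1,2) by metis
  have "uniformly_continuous_on \<Omega> G"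
    unfolding \<Omega>_def C_def
    by (rule Riemann_map_inverse_uniformly_continuous[OF c F
        F'[unfolded \<Omega>_def C_def] G[unfolded \<Omega>_def C_def] G'[unfolded \<Omega>_def C_def]])
  then obtain H where H: "uniformly_continuous_on (closure \<Omega>) H" "\<And>z. z \<in> \<Omega> \<Longrightarrow> G z = H z"
    by (metis uniformly_continuous_on_extension_on_closure)
  have contH: "continuous_on (closure \<Omega>) H" using H(1) uniformly_continuous_imp_continuous by blast
  have contF: "continuous_on (ball 0 1) F" using F holomorphic_on_imp_continuous_on by blast
  have comp: "compact (closure \<Omega>)" using J(4) by (simp add: compact_closure)
  have holH: "H holomorphic_on \<Omega>" using G H(2) holomorphic_transform by blast
  have Hball: "H z \<in> ball 0 1" "F (H z) = z" if "z \<in> \<Omega>" for z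
    using G'[OF that] H(2)[OF that] by auto
  have HF: "H (F z) = z" if "z \<in> ball 0 1" for z using F'[OF that] H(2) by auto
  have Hcball: "H ` closure \<Omega> \<subseteq> cball 0 1"
  proof (rule image_closure_subset[OF contH])
    show "H ` \<Omega> \<subseteq> cball 0 1" using Hball(1) ball_subset_cball by blast
  qed auto
  have Hlim: "(\<lambda>n. H (x n)) \<longlonglongrightarrow> H z" if "z \<in> closure \<Omega>" "\<And>n. x n \<in> \<Omega>" "x \<longlonglongrightarrow> z" for x z
    by (rule continuous_on_tendsto_compose[OF contH that(3,1)])
      (intro always_eventually allI subsetD[OF closure_subset] that(2))
  \<comment> \<open>If \<open>H w\<close> were in the open disc, \<open>F\<close> would be
    continuous there, and points of the domain converging to \<open>w\<close> would also converge to
    \<open>F (H w)\<close>, which lies in the domain.\<close>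
  have Hsphere: "norm (H w) = 1" if w: "w \<in> C" for w
  proof (rule ccontr)
    assume "norm (H w) \<noteq> 1"
    moreover have "H w \<in> cball 0 1" using Hcball w clos by blast
    ultimately have Hw: "H w \<in> ball 0 1" by simp
    have "w \<in> closure \<Omega>" using w clos by auto
    then obtain x where x: "\<And>n. x n \<in> \<Omega>" "x \<longlonglongrightarrow> w" unfolding closure_sequential by auto
    then have "(\<lambda>n. H (x n)) \<longlonglongrightarrow> H w"
      using Hlim \<open>w \<in> closure \<Omega>\<close> by blast
    moreover have "isCont F (H w)" using contF Hw continuous_on_eq_continuous_at open_ball by blast
    ultimately have "(\<lambda>n. F (H (x n))) \<longlonglongrightarrow> F (H w)" by (rule isCont_tendsto_compose[rotated])
    then have "x \<longlonglongrightarrow> F (H w)" using x(1) Hball(2) by simp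
    then have "w = F (H w)" using x(2) LIMSEQ_unique by blast
    then show False using F'[OF Hw] w clos by auto
  qed
  have Hsurj: "H ` closure \<Omega> = cball 0 1"
  proof -
    have "ball 0 1 \<subseteq> H ` closure \<Omega>" using HF F' closure_subset by (metis image_eqI subset_iff)
    moreover have "closed (H ` closure \<Omega>)" using comp contH compact_continuous_image compact_imp_closed by blast
    ultimately have "closure (ball 0 1) \<subseteq> H ` closure \<Omega>" by (rule closure_minimal)
    then show ?thesis using Hcball by auto
  qed
  have injC: "x = y" if xy: "x \<in> C" "y \<in> C" "H x = H y" for x y
  proof (rule ccontr)
    assume "x \<noteq> y"
    define \<zeta> where "\<zeta> = H x"
    have \<zeta>: "norm \<zeta> = 1" using Hsphere xy(1) by (simp add: \<zeta>_def)
    define T where "T = {z \<in> closure \<Omega>. H z = \<zeta>}"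
    \<comment> \<open>The fibre \<open>T\<close> over a boundary point is connected, being a nested
      intersection of compact connected sets: each \<open>B n\<close> is convex. A fibre with two
      points contains a piece of the curve, on which \<open>H\<close> would be constant.\<close>
    define B where "B n = ball \<zeta> (inverse (real (Suc n))) \<inter> ball 0 1" for n
    have BF: "F ` B n \<subseteq> \<Omega>" for n using F' by (auto simp: B_def)
    have "T = \<Inter> (range (\<lambda>n. closure (F ` B n)))"
    proof (intro equalityI subsetI INT_I)
      fix z n assume "z \<in> T"
      then have z: "z \<in> closure \<Omega>" "H z = \<zeta>" by (auto simp: T_def)
      then obtain x where x: "\<And>n. x n \<in> \<Omega>" "x \<longlonglongrightarrow> z" unfolding closure_sequential by auto
      then have "(\<lambda>n. H (x n)) \<longlonglongrightarrow> \<zeta>"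
        using Hlim[OF z(1), of x] z(2) by simp
      then have "eventually (\<lambda>m. dist (H (x m)) \<zeta> < inverse (real (Suc n))) sequentially"
        by (rule tendstoD) auto
      then have "eventually (\<lambda>m. x m \<in> F ` B n) sequentially"
      proof eventually_elim
        case (elim m)
        then show ?case using Hball[OF x(1)[of m]]
          by (intro image_eqI[of _ _ "H (x m)"]) (auto simp: B_def dist_commute)
      qed
      then have "eventually (\<lambda>m. x m \<in> closure (F ` B n)) sequentially"
        by (rule eventually_mono) (rule subsetD[OF closure_subset])
      then show "z \<in> closure (F ` B n)"
        by (rule Lim_in_closed_set[OF closed_closure _ sequentially_bot x(2)])
    next
      fix z assume z: "z \<in> \<Inter> (range (\<lambda>n. closure (F ` B n)))"
      have zc: "z \<in> closure \<Omega>" using z closure_mono[OF BF[of 0]] by blast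
      have le: "norm (H z - \<zeta>) \<le> inverse (real (Suc n))" for n
      proof -
        have "H ` closure (F ` B n) \<subseteq> cball \<zeta> (inverse (real (Suc n)))"
          by (rule image_closure_subset[OF continuous_on_subset[OF contH closure_mono[OF BF]]])
            (auto simp: B_def HF)
        then show ?thesis using z by (auto simp: dist_norm norm_minus_commute image_subset_iff)
      qed
      have "norm (H z - \<zeta>) \<le> 0"
        by (rule LIMSEQ_le_const[OF LIMSEQ_inverse_real_of_nat]) (use le in auto)
      then show "z \<in> T" using zc by (simp add: T_def)
    qed
    moreover have "connected (\<Inter> (range (\<lambda>n. closure (F ` B n))))"
    proof (rule connected_nest)
      fix n
      show "compact (closure (F ` B n))"
        using BF J(4) bounded_subset compact_closure by blast
      have "connected (B n)" unfolding B_def by (intro convex_connected convex_Int) auto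
      moreover have "continuous_on (B n) F" using contF by (auto simp: B_def intro: continuous_on_subset)
      ultimately show "connected (closure (F ` B n))"
        using connected_continuous_image connected_imp_connected_closure by blast
    next
      fix m n :: nat assume "m \<le> n"
      then have "B n \<subseteq> B m" unfolding B_def by (force intro: order_less_le_trans le_imp_inverse_le)
      then show "closure (F ` B n) \<subseteq> closure (F ` B m)" by (intro closure_mono image_mono)
    qed
    ultimately have "connected T" by simp
    moreover have "T \<subseteq> C" using Hball(1) \<zeta> clos unfolding T_def by force
    moreover have "closed T"
      unfolding T_def using continuous_closed_preimage_constant[OF contH closed_closure] .
    moreover have "x \<in> T" "y \<in> T" using xy clos by (auto simp: T_def \<zeta>_def)
    ultimately obtain p r where p: "p \<in> T" "0 < r" "C \<inter> ball p r \<subseteq> T"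
      using connected_subset_Jordan_interior[OF c, of T x y] \<open>x \<noteq> y\<close> unfolding C_def by blast
    obtain q where q: "q \<in> \<Omega>" "H q = \<zeta>"
    proof (rule holomorphic_boundary_arc_not_constant[OF J(2) holH contH])
      show "norm (H z - \<zeta>) \<le> 2" if "z \<in> closure \<Omega>" for z
        using Hcball that \<zeta> norm_triangle_ineq4[of "H z" \<zeta>] by force
      show "H z = \<zeta>" if "z \<in> frontier \<Omega> \<inter> ball p r" for z
        using p \<open>T \<subseteq> C\<close> J(5) that by (auto simp: T_def)
      show "p \<in> frontier \<Omega>" using p \<open>T \<subseteq> C\<close> J(5) by auto
      have "outside C \<subseteq> - closure \<Omega>" using J(7,8) clos by auto
      moreover have "p \<in> closure (outside C)"
        using p(1) \<open>T \<subseteq> C\<close> J(6) closure_Un_frontier[of "outside C"] by auto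
      ultimately show "p \<in> closure (- closure \<Omega>)" using closure_mono by blast
      show "0 < r" by (rule p(2))
    qed
    then show False using Hball(1)[OF q(1)] \<zeta> by simp
  qed
  have inj: "inj_on H (closure \<Omega>)"
  proof (rule inj_onI)
    fix x y assume "x \<in> closure \<Omega>" "y \<in> closure \<Omega>" "H x = H y"
    then consider "x \<in> \<Omega>" "y \<in> \<Omega>" | "x \<in> C" "y \<in> C" | "x \<in> \<Omega>" "y \<in> C" | "x \<in> C" "y \<in> \<Omega>"
      using clos by blast
    then show "x = y"
    proof cases
      case 1
      then show ?thesis using Hball(2) \<open>H x = H y\<close> by metis
    next
      case 2
      then show ?thesis using injC \<open>H x = H y\<close> by blast
    next
      case 3
      then show ?thesis using Hball(1)[of x] Hsphere[of y] \<open>H x = H y\<close> by simp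
    next
      case 4
      then show ?thesis using Hball(1)[of y] Hsphere[of x] \<open>H x = H y\<close> by simp
    qed
  qed
  obtain f where f: "homeomorphism (closure \<Omega>) (cball 0 1) H f"
    using homeomorphism_compact[OF comp contH Hsurj inj] by blast
  moreover have "H ` C = sphere 0 1"
  proof
    show "H ` C \<subseteq> sphere 0 1" using Hsphere by auto
    show "sphere 0 1 \<subseteq> H ` C"
    proof
      fix z :: complex assume z: "z \<in> sphere 0 1"
      then obtain x where "x \<in> closure \<Omega>" "H x = z" using Hsurj by (metis imageE sphere_cball subsetD)
      then show "z \<in> H ` C" using z Hball(1)[of x] clos by auto
    qed
  qed
  ultimately show thesis using that unfolding C_def \<Omega>_def by blast
qed

section \<open>Extension of an embedded square\<close>

lemma punctured_unit_sphere_homeomorphism: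
  fixes b :: "complex \<times> real"
  assumes "norm b = 1"
  obtains f g where "homeomorphism (sphere 0 1 - {b}) (UNIV :: complex set) f g"
proof -
  have "(sphere 0 1 - {b}) homeomorphic (UNIV :: complex set)"
    by (rule homeomorphic_punctured_sphere_affine) (use assms in auto)
  then show thesis using that by (auto simp: homeomorphic_def)
qed

text \<open>Projection from the omitted point \<open>b\<close> turns \<open>r\<close> into an
  injection between planes, to which invariance of domain applies.\<close>

lemma continuous_injection_plane_sphere_open:
  fixes r :: "real \<times> real \<Rightarrow> complex \<times> real"
  assumes r: "continuous_on UNIV r" "inj r" "range r \<subseteq> sphere 0 1 - {b}" and b: "norm b = 1"
  obtains R where "openin (top_of_set (sphere 0 1)) (range r)" "continuous_on (range r) R" "\<And>z. R (r z) = z"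
proof -
  obtain f g where fg: "homeomorphism (sphere 0 1 - {b}) (UNIV :: complex set) f g"
    using punctured_unit_sphere_homeomorphism[OF b] .
  have contf: "continuous_on (range r) f"
    using fg r(3) by (auto simp: homeomorphism_def intro: continuous_on_subset)
  have contfr: "continuous_on UNIV (f \<circ> r)" using r(1) contf by (rule continuous_on_compose)
  have gf: "g (f (r z)) = r z" for z using fg r(3) by (auto simp: homeomorphism_def)
  have injfr: "inj (f \<circ> r)" 
  proof (rule injI)
    fix x y assume "(f \<circ> r) x = (f \<circ> r) y"
    then have "g (f (r x)) = g (f (r y))" by simp
    then have "r x = r y" unfolding gf .
    then show "x = y" using r(2) by (simp add: inj_eq)
  qed
  have "open (range (f \<circ> r))"
    by (rule invariance_of_domain_gen[OF open_UNIV contfr injfr]) simp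
  obtain R where R: "homeomorphism UNIV (range (f \<circ> r)) (f \<circ> r) R"
    by (rule invariance_of_domain_homeomorphism[OF open_UNIV contfr _ injfr]) simp
  show thesis
  proof (rule that[of "R \<circ> f"])
    have "openin (top_of_set (sphere 0 1 - {b})) (g ` range (f \<circ> r))"
      using homeomorphism_imp_open_map[OF homeomorphism_symD[OF fg], of "range (f \<circ> r)"] \<open>open (range (f \<circ> r))\<close>
      by auto
    moreover have "g ` range (f \<circ> r) = range r" using gf by (auto simp: image_image)
    moreover have "openin (top_of_set (sphere 0 1)) (sphere 0 1 - {b})"
      by (intro openin_delete) auto
    ultimately show "openin (top_of_set (sphere 0 1)) (range r)" using openin_trans by metis
    show "continuous_on (range r) (R \<circ> f)"
      using R by (intro continuous_on_compose contf) (auto simp: homeomorphism_def image_image)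
    show "(R \<circ> f) (r z) = z" for z using homeomorphism_apply1[OF R, of z] by simp
  qed
qed

text \<open>The maximum norm about the centre of the square, scaled so that the boundary of the
  square is the level set 1.\<close>

definition square_gauge :: "real \<times> real \<Rightarrow> real" where
  "square_gauge z = max \<bar>2 * fst z - 1\<bar> \<bar>2 * snd z - 1\<bar>"

lemma unit_square_gauge: "unit_square = {z. square_gauge z \<le> 1}"
  by (auto simp: unit_square_def square_gauge_def abs_le_iff)

lemma continuous_on_square_gauge [continuous_intros]:
  "continuous_on A f \<Longrightarrow> continuous_on A (\<lambda>z. square_gauge (f z))"
  unfolding square_gauge_def by (intro continuous_intros)

lemma square_gauge_ray:
  "square_gauge ((1/2, 1/2) + t *\<^sub>R (z - (1/2, 1/2))) = \<bar>t\<bar> * square_gauge z"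
proof -
  have "2 * (1/2 + t * (x - 1/2)) - 1 = t * (2 * x - 1)" for x :: real by (simp add: algebra_simps)
  then have "2 * fst ((1/2, 1/2) + t *\<^sub>R (z - (1/2, 1/2))) - 1 = t * (2 * fst z - 1)"
    "2 * snd ((1/2, 1/2) + t *\<^sub>R (z - (1/2, 1/2))) - 1 = t * (2 * snd z - 1)" by auto
  then show ?thesis
    unfolding square_gauge_def by (simp only: abs_mult max_mult_distrib_left abs_ge_zero if_True)
qed

lemma square_gauge_eq_0: "square_gauge z = 0 \<longleftrightarrow> z = (1/2, 1/2)"
  by (cases z) (auto simp: square_gauge_def max_def)

lemma square_gauge_nonneg [simp]: "0 \<le> square_gauge z"
  by (simp add: square_gauge_def)

lemma square_boundary_loop:
  obtains p :: "real \<Rightarrow> real \<times> real" where "simple_path p" "pathfinish p = pathstart p"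
    "path_image p = {z. square_gauge z = 1}"
proof -
  define f where "f z = (Re z, Im z)" for z
  have contf: "continuous_on A f" for A unfolding f_def by (intro continuous_intros)
  have injf: "inj f" by (auto simp: f_def inj_def complex_eq_iff)
  define r where "r = rectpath 0 (1 + \<i>)"
  have r: "simple_path r" "pathfinish r = pathstart r"
    "path_image r = {z. Re z \<in> {0, 1} \<and> Im z \<in> {0..1}} \<union> {z. Im z \<in> {0, 1} \<and> Re z \<in> {0..1}}"
    unfolding r_def by (auto simp: simple_path_rectpath path_image_rectpath)
  have "z \<in> path_image r \<longleftrightarrow> square_gauge (f z) = 1" for z
    unfolding r(3) f_def square_gauge_def by (auto simp: max_def abs_if)
  moreover have "w = f (Complex (fst w) (snd w))" for w by (simp add: f_def)
  ultimately have "f ` path_image r = {z. square_gauge z = 1}" by (force intro: image_eqI)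
  moreover have "simple_path (f \<circ> r)"
    by (rule simple_path_continuous_image[OF r(1) contf]) (use injf in \<open>auto intro: inj_on_subset\<close>)
  ultimately show thesis
    using that[of "f \<circ> r"] r by (simp add: path_image_compose pathfinish_compose pathstart_compose)
qed

theorem square_embedding_extends:
  fixes q :: "real \<times> real \<Rightarrow> complex \<times> real"
  assumes q: "continuous_on unit_square q" "inj_on q unit_square" "q ` unit_square \<subseteq> sphere 0 1"
  obtains r R where "continuous_on UNIV r" "openin (top_of_set (sphere 0 1)) (range r)"
    "continuous_on (range r) R" "\<And>z. R (r z) = z" "\<And>z. z \<in> unit_square \<Longrightarrow> r z = q z"
proof -
  define N where "N = square_gauge"
  define c0 :: "real \<times> real" where "c0 = (1/2, 1/2)"
  have sq: "unit_square = {z. N z \<le> 1}" by (simp add: N_def unit_square_gauge)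
  have contN: "continuous_on A N" for A unfolding N_def by (intro continuous_intros)
  have N0: "N z = 0 \<longleftrightarrow> z = c0" for z by (simp add: N_def c0_def square_gauge_eq_0)
  have Nge: "0 \<le> N z" for z by (simp add: N_def)
  have Nray: "N (c0 + t *\<^sub>R (z - c0)) = \<bar>t\<bar> * N z" for t z
    unfolding N_def c0_def by (rule square_gauge_ray)
  have comp_sq: "compact unit_square" unfolding unit_square_def by (intro compact_Times) auto
  have int_sq: "{z. N z < 1} = {0<..<1} \<times> {0<..<1}"
    by (auto simp: N_def square_gauge_def abs_less_iff)
  have open_int: "open {z. N z < 1}" unfolding int_sq by (intro open_Times) auto
  have c0: "c0 \<in> unit_square" "N c0 < 1" using N0[of c0] by (auto simp: sq)
  define b where "b = q c0"
  have b: "norm b = 1" using q(3) c0 by (auto simp: b_def)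
  obtain \<psi> \<phi> where hom: "homeomorphism (sphere 0 1 - {b}) (UNIV :: complex set) \<psi> \<phi>"
    using punctured_unit_sphere_homeomorphism[OF b] .
  have \<psi>: "continuous_on (sphere 0 1 - {b}) \<psi>" "\<And>x. x \<in> sphere 0 1 - {b} \<Longrightarrow> \<phi> (\<psi> x) = x"
    and \<phi>: "continuous_on UNIV \<phi>" "\<And>y. \<psi> (\<phi> y) = y"
    using hom by (auto simp: homeomorphism_def)
  have \<phi>_sphere: "\<phi> y \<in> sphere 0 1 - {b}" for y using homeomorphism_image2[OF hom] by blast
  have qs: "q z \<in> sphere 0 1 - {b}" if "z \<in> unit_square" "z \<noteq> c0" for z
    using that q(2,3) c0 by (auto simp: b_def inj_on_def)
  define m where "m z = \<psi> (q z)" for z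
  have \<phi>m: "\<phi> (m z) = q z" if "z \<in> unit_square" "z \<noteq> c0" for z
    unfolding m_def using \<psi>(2) qs[OF that] by blast
  have contm: "continuous_on (unit_square - {c0}) m"
    unfolding m_def
  proof (rule continuous_on_compose2[OF \<psi>(1)])
    show "continuous_on (unit_square - {c0}) q" using q(1) by (rule continuous_on_subset) simp
    show "q ` (unit_square - {c0}) \<subseteq> sphere 0 1 - {b}"
      by (rule image_subsetI, rule qs) simp_all
  qed
  have injm: "inj_on m (unit_square - {c0})"
    using \<phi>m q(2) by (intro inj_onI) (metis DiffE inj_onD singletonI)
  obtain p where p: "simple_path p" "pathfinish p = pathstart p" "path_image p = {z. N z = 1}"
    unfolding N_def by (rule square_boundary_loop)
  have bd_sub: "{z. N z = 1} \<subseteq> unit_square - {c0}" using N0[of c0] by (auto simp: sq)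
  define \<gamma> where "\<gamma> = m \<circ> p"
  define \<Gamma> where "\<Gamma> = path_image \<gamma>"
  have \<Gamma>: "\<Gamma> = m ` {z. N z = 1}" by (simp add: \<Gamma>_def \<gamma>_def path_image_compose p(3))
  have \<gamma>: "simple_path \<gamma>" "pathfinish \<gamma> = pathstart \<gamma>"
    unfolding \<gamma>_def using p bd_sub contm injm
    by (auto intro!: simple_path_continuous_image intro: continuous_on_subset inj_on_subset
        simp: pathfinish_compose pathstart_compose)
  define \<Omega> where "\<Omega> = inside \<Gamma>"
  have J: "open \<Omega>" "bounded \<Omega>" "open (outside \<Gamma>)" "connected (outside \<Gamma>)"
    "\<Omega> \<inter> outside \<Gamma> = {}" "\<Omega> \<union> outside \<Gamma> = - \<Gamma>" "frontier \<Omega> = \<Gamma>"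
    using Jordan_inside_outside[OF \<gamma>] unfolding \<Omega>_def \<Gamma>_def by auto
  define V where "V = m ` ({z. N z < 1} - {c0})"
  have V_sub: "{z. N z < 1} - {c0} \<subseteq> unit_square - {c0}" by (auto simp: sq)
  have VT: "V \<union> \<Gamma> = {y. \<phi> y \<in> q ` unit_square}"
  proof -
    have "V \<union> \<Gamma> = m ` (unit_square - {c0})"
      using bd_sub unfolding V_def \<Gamma> sq by (auto simp: image_iff less_le)
    also have "\<dots> = {y. \<phi> y \<in> q ` unit_square}"
    proof (intro equalityI subsetI)
      fix y assume "y \<in> m ` (unit_square - {c0})"
      then show "y \<in> {y. \<phi> y \<in> q ` unit_square}" using \<phi>m by auto
    next
      fix y assume "y \<in> {y. \<phi> y \<in> q ` unit_square}"
      then obtain z where z: "z \<in> unit_square" "\<phi> y = q z" by auto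
      then have "z \<noteq> c0" using \<phi>_sphere[of y] by (auto simp: b_def)
      moreover have "y = m z" using z(2) \<phi>(2)[of y] by (simp add: m_def)
      ultimately show "y \<in> m ` (unit_square - {c0})" using z(1) by auto
    qed
    finally show ?thesis .
  qed
  have openV: "open V"
    unfolding V_def using contm injm V_sub open_int
    by (intro invariance_of_domain_gen) (auto intro: continuous_on_subset inj_on_subset open_delete)
  have connV: "connected V"
    unfolding V_def
  proof (rule connected_continuous_image)
    show "continuous_on ({z. N z < 1} - {c0}) m" using contm V_sub by (rule continuous_on_subset)
    have "aff_dim {z. N z < 1} = 2"
    proof -
      have "{z. N z < 1} \<noteq> {}" using c0(2) by blast
      then show ?thesis using aff_dim_open[OF open_int] by simp
    qed
    then show "connected ({z. N z < 1} - {c0})"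
      by (intro connected_punctured_convex) (auto simp: int_sq intro!: convex_Times)
  qed
  have clVT: "closed (V \<union> \<Gamma>)"
  proof -
    have "closed (q ` unit_square)" using comp_sq q(1) compact_continuous_image compact_imp_closed by blast
    then have "closed (\<phi> -` (q ` unit_square))" using \<phi>(1) by (simp add: continuous_closed_vimage continuous_on_eq_continuous_at)
    then show ?thesis unfolding VT by (simp add: vimage_def)
  qed
  have VG: "V \<inter> \<Gamma> = {}"
  proof -
    have "m x \<noteq> m y" if "N x < 1" "x \<noteq> c0" "N y = 1" for x y
    proof
      assume "m x = m y"
      moreover have "x \<in> unit_square - {c0}" "y \<in> unit_square - {c0}"
        using that bd_sub V_sub by auto
      ultimately have "x = y" using injm by (simp add: inj_on_eq_iff)
      then show False using that by simp
    qed
    then show ?thesis unfolding V_def \<Gamma> by blast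
  qed
  \<comment> \<open>If \<open>V\<close> were bounded, \<open>q\<close> would map the punctured
    interior, and by continuity also the centre, into a compact set avoiding
    \<open>b\<close>.\<close>
  have unbV: "\<not> bounded V"
  proof
    assume "bounded V"
    then obtain B where "\<And>x. x \<in> V \<Longrightarrow> norm x \<le> B" unfolding bounded_iff by blast
    then have B: "V \<subseteq> cball 0 B" by auto
    define K where "K = \<phi> ` cball 0 B"
    have "compact K" unfolding K_def using \<phi>(1) by (intro compact_continuous_image) (auto intro: continuous_on_subset)
    have "q ` ({z. N z < 1} - {c0}) \<subseteq> K"
    proof
      fix x assume "x \<in> q ` ({z. N z < 1} - {c0})"
      then obtain z where z: "x = q z" "z \<in> {z. N z < 1} - {c0}" by blast
      then have "m z \<in> cball 0 B" "q z = \<phi> (m z)" using B \<phi>m[of z] V_sub by (auto simp: V_def)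
      then show "x \<in> K" unfolding K_def z(1) by (metis imageI)
    qed
    moreover have cl: "closure ({z. N z < 1} - {c0}) \<subseteq> unit_square"
      using V_sub comp_sq by (intro closure_minimal) (auto intro: compact_imp_closed)
    ultimately have "q ` closure ({z. N z < 1} - {c0}) \<subseteq> K"
      using \<open>compact K\<close> q(1) by (intro image_closure_subset) (auto intro: compact_imp_closed continuous_on_subset)
    moreover have "c0 \<in> closure ({z. N z < 1} - {c0})"
    proof -
      have "c0 islimpt {z. N z < 1}" using open_int c0(2) by (intro interior_limit_point) (simp add: interior_open)
      then have "c0 islimpt ({z. N z < 1} - {c0})" by (simp add: islimpt_punctured[symmetric])
      then show ?thesis by (simp add: closure_def)
    qed
    ultimately have "b \<in> K" by (auto simp: b_def)
    then show False using \<phi>_sphere unfolding K_def by blast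
  qed
  \<comment> \<open>\<open>V\<close> is connected and unbounded, hence contained in the outside. It
    is open and \<open>V \<union> \<Gamma>\<close> is closed, hence it exhausts the outside, which
    is connected.\<close>
  have V_out: "V = outside \<Gamma>"
  proof -
    have sub: "V \<subseteq> \<Omega> \<union> outside \<Gamma>" using VG J(6) by blast
    have ne: "V \<inter> outside \<Gamma> \<noteq> {}" using sub unbV J(2) bounded_subset by blast
    have "V \<inter> \<Omega> = {}"
    proof (rule ccontr)
      assume "V \<inter> \<Omega> \<noteq> {}"
      moreover have "\<Omega> \<inter> outside \<Gamma> \<inter> V = {}" using J(5) by blast
      ultimately show False
        using connV J(1,3) sub ne unfolding connected_def by (metis Int_commute)
    qed
    then have "V \<subseteq> outside \<Gamma>" using sub by blast
    moreover have "outside \<Gamma> \<subseteq> V"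
    proof (rule ccontr)
      assume "\<not> outside \<Gamma> \<subseteq> V"
      then have "- (V \<union> \<Gamma>) \<inter> outside \<Gamma> \<noteq> {}" using J(6) by blast
      moreover have "open (- (V \<union> \<Gamma>))" using clVT by (rule open_Compl)
      moreover have "outside \<Gamma> \<subseteq> V \<union> - (V \<union> \<Gamma>)" using J(6) by blast
      moreover have "V \<inter> - (V \<union> \<Gamma>) \<inter> outside \<Gamma> = {}" by blast
      ultimately show False using J(4) openV ne unfolding connected_def by metis
    qed
    ultimately show ?thesis by blast
  qed
  have \<Omega>_off: "\<phi> y \<notin> q ` unit_square" if "y \<in> \<Omega>" for y
    using that J(5,6) VT unfolding V_out by blast
  obtain F G where FG: "homeomorphism (closure \<Omega>) (cball (0::complex) 1) G F" "G ` \<Gamma> = sphere 0 1"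
    unfolding \<Omega>_def \<Gamma>_def using Jordan_inside_homeomorphism[OF \<gamma>] .
  have clos: "closure \<Omega> = \<Omega> \<union> \<Gamma>" using J(7) closure_Un_frontier by metis
  have F: "continuous_on (cball 0 1) F" "\<And>y. y \<in> cball 0 1 \<Longrightarrow> F y \<in> closure \<Omega>" "\<And>y. y \<in> cball 0 1 \<Longrightarrow> G (F y) = y"
    and G: "continuous_on (closure \<Omega>) G" "\<And>x. x \<in> closure \<Omega> \<Longrightarrow> G x \<in> cball 0 1" "\<And>x. x \<in> closure \<Omega> \<Longrightarrow> F (G x) = x"
    using FG(1) unfolding homeomorphism_def by auto
  have F\<Omega>: "F y \<in> \<Omega>" if "norm y < 1" for y
  proof (rule ccontr)
    assume "F y \<notin> \<Omega>"
    then have "F y \<in> \<Gamma>" using F(2)[of y] that clos by auto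
    then have "G (F y) \<in> sphere 0 1" using FG(2) by blast
    then show False using F(3)[of y] that by auto
  qed
  \<comment> \<open>The boundary of the square read on the unit circle through the Caratheodory
    homeomorphism.\<close>
  define \<beta> where "\<beta> z = G (m z)" for z
  have \<beta>: "norm (\<beta> z) = 1" "\<phi> (F (\<beta> z)) = q z" if "N z = 1" for z
  proof -
    have mz: "m z \<in> \<Gamma>" using that \<Gamma> by blast
    then show "norm (\<beta> z) = 1" using FG(2) by (force simp: \<beta>_def)
    have "F (\<beta> z) = m z" using G(3) mz clos by (auto simp: \<beta>_def)
    moreover have "z \<in> unit_square - {c0}" using that bd_sub by blast
    ultimately show "\<phi> (F (\<beta> z)) = q z" using \<phi>m[of z] by simp
  qed
  have inj\<beta>: "x = y" if "N x = 1" "N y = 1" "\<beta> x = \<beta> y" for x y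
  proof -
    have "q x = q y" using \<beta>(2) that by metis
    then show ?thesis by (rule inj_onD[OF q(2)]) (simp_all add: sq that)
  qed
  have cont\<beta>: "continuous_on {z. N z = 1} \<beta>"
    unfolding \<beta>_def
    by (rule continuous_on_compose2[OF G(1)])
      (use contm bd_sub \<Gamma> clos in \<open>auto intro: continuous_on_subset\<close>)
  define \<pi> where "\<pi> z = c0 + (1 / N z) *\<^sub>R (z - c0)" for z
  have N\<pi>: "N (\<pi> z) = 1" if "1 \<le> N z" for z unfolding \<pi>_def Nray using that by simp
  have \<pi>1: "\<pi> z = z" if "N z = 1" for z using that by (simp add: \<pi>_def)
  have \<pi>_inv: "z = c0 + N z *\<^sub>R (\<pi> z - c0)" if "1 \<le> N z" for z using that by (simp add: \<pi>_def)
  \<comment> \<open>An inversion in the square: \<open>\<pi>\<close> projects radially to the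
    boundary of the square, and the level \<open>N z\<close> goes to the circle of radius
    \<open>1 / N z\<close>. The centre of the disc plays the part of infinity, which is why its
    image \<open>\<omega>\<close> is not a value of \<open>r\<close>.\<close>
  define s where "s z = (1 / N z) *\<^sub>R \<beta> (\<pi> z)" for z
  have norms: "norm (s z) = 1 / N z" if "1 \<le> N z" for z
    unfolding s_def using \<beta>(1)[OF N\<pi>[OF that]] that by simp
  have s_ball: "norm (s z) < 1" if "1 < N z" for z using norms[of z] that by simp
  have s_cball: "s z \<in> cball 0 1" if "1 \<le> N z" for z using norms[OF that] that by simp
  have conts: "continuous_on {z. 1 \<le> N z} s"
  proof -
    have "continuous_on {z. 1 \<le> N z} \<pi>" unfolding \<pi>_def by (intro continuous_intros contN) auto
    then have "continuous_on {z. 1 \<le> N z} (\<lambda>z. \<beta> (\<pi> z))"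
      by (rule continuous_on_compose2[OF cont\<beta>]) (auto simp: N\<pi>)
    then show ?thesis unfolding s_def by (intro continuous_intros contN) auto
  qed
  define r where "r z = (if N z \<le> 1 then q z else \<phi> (F (s z)))" for z
  have contr: "continuous_on UNIV r"
  proof -
    have "continuous_on ({z. N z \<le> 1} \<union> {z. 1 \<le> N z}) r"
      unfolding r_def
    proof (rule continuous_on_cases)
      show "closed {z. N z \<le> 1}" "closed {z. 1 \<le> N z}"
        by (intro closed_Collect_le contN continuous_on_const)+
      show "continuous_on {z. N z \<le> 1} q" using q(1) sq by simp
      have "continuous_on {z. 1 \<le> N z} (\<lambda>z. F (s z))"
        by (rule continuous_on_compose2[OF F(1) conts]) (use s_cball in auto)
      then show "continuous_on {z. 1 \<le> N z} (\<lambda>z. \<phi> (F (s z)))"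
        by (rule continuous_on_compose2[OF \<phi>(1)]) auto
      have "q z = \<phi> (F (s z))" if "N z = 1" for z
        using \<beta>(2)[OF that] that by (simp add: s_def \<pi>1)
      then show "\<forall>z. z \<in> {z. N z \<le> 1} \<and> \<not> N z \<le> 1 \<or> z \<in> {z. 1 \<le> N z} \<and> N z \<le> 1 \<longrightarrow> q z = \<phi> (F (s z))"
        by auto
    qed
    moreover have "{z. N z \<le> 1} \<union> {z. 1 \<le> N z} = UNIV" by auto
    ultimately show ?thesis by simp
  qed
  have inj_out: "x = y" if "1 < N x" "1 < N y" "\<phi> (F (s x)) = \<phi> (F (s y))" for x y
  proof -
    have "F (s x) = F (s y)" using that(3) \<phi>(2) by metis
    then have sxy: "s x = s y" using F(3) s_cball that(1,2) less_imp_le by metis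
    then have "1 / N x = 1 / N y" using norms that(1,2) less_imp_le by metis
    then have Nxy: "N x = N y" using that(1,2) by (simp add: field_simps)
    then have "\<beta> (\<pi> x) = \<beta> (\<pi> y)" using sxy that(1) by (simp add: s_def)
    then have "\<pi> x = \<pi> y" using inj\<beta> N\<pi> that(1,2) less_imp_le by metis
    then show ?thesis using \<pi>_inv that(1,2) Nxy less_imp_le by metis
  qed
  have off: "\<phi> (F (s y)) \<notin> q ` unit_square" if "1 < N y" for y
    using \<Omega>_off F\<Omega> s_ball[OF that] by blast
  have injr: "inj r"
  proof (rule injI)
    fix x y assume eq: "r x = r y"
    consider "N x \<le> 1" "N y \<le> 1" | "N x \<le> 1" "1 < N y" | "1 < N x" "N y \<le> 1" | "1 < N x" "1 < N y"
      by linarith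
    then show "x = y"
    proof cases
      case 1
      then have "q x = q y" using eq by (simp add: r_def)
      then show ?thesis by (rule inj_onD[OF q(2)]) (simp_all add: sq 1)
    next
      case 2
      then have "\<phi> (F (s y)) = q x" "x \<in> unit_square" using eq by (simp_all add: r_def sq)
      then show ?thesis using off[OF 2(2)] by simp
    next
      case 3
      then have "\<phi> (F (s x)) = q y" "y \<in> unit_square" using eq by (simp_all add: r_def sq)
      then show ?thesis using off[OF 3(1)] by simp
    next
      case 4
      then show ?thesis using eq inj_out by (auto simp: r_def)
    qed
  qed
  define \<omega> where "\<omega> = \<phi> (F 0)"
  have \<omega>: "norm \<omega> = 1" using \<phi>_sphere[of "F 0"] by (simp add: \<omega>_def)
  have "r z \<noteq> \<omega>" for z
  proof (cases "N z \<le> 1")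
    case True
    then have "r z \<in> q ` unit_square" by (simp add: r_def sq)
    then show ?thesis using \<Omega>_off[OF F\<Omega>[of 0]] by (auto simp: \<omega>_def)
  next
    case False
    then have Nz: "1 \<le> N z" by simp
    have "s z \<noteq> 0" using norms[OF Nz] Nz by auto
    then have "F (s z) \<noteq> F 0" using F(3)[OF s_cball[OF Nz]] F(3)[of 0] by auto
    then show ?thesis using False \<phi>(2) unfolding r_def \<omega>_def by metis
  qed
  moreover have "r z \<in> sphere 0 1" for z
    using q(3) \<phi>_sphere[of "F (s z)"] by (auto simp: r_def sq)
  ultimately have "range r \<subseteq> sphere 0 1 - {\<omega>}" by blast
  from continuous_injection_plane_sphere_open[OF contr injr this \<omega>]
  obtain R where "openin (top_of_set (sphere 0 1)) (range r)" "continuous_on (range r) R" "\<And>z. R (r z) = z"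
    by blast
  then show thesis using contr by (intro that[of r R]) (auto simp: r_def sq)
qed

section \<open>Crossings of a stretched square\<close>

text \<open>A quad precomposed with \<open>stretch \<delta>\<close> is narrower and taller, hence easier to cross.\<close>

definition stretch :: "real \<Rightarrow> real \<times> real \<Rightarrow> real \<times> real" where
  "stretch \<delta> z = (\<delta> + (1 - 2 * \<delta>) * fst z, (1 + 2 * \<delta>) * snd z - \<delta>)"

lemma continuous_on_stretch: "continuous_on A (stretch \<delta>)"
  unfolding stretch_def by (intro continuous_intros)

lemma inj_stretch: "0 < \<delta> \<Longrightarrow> \<delta> < 1/2 \<Longrightarrow> inj (stretch \<delta>)"
  by (auto simp: inj_def stretch_def)

lemma dist_stretch:
  assumes "z \<in> unit_square" "0 < \<delta>"
  shows "dist z (stretch \<delta> z) \<le> 2 * \<delta>"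
proof -
  obtain x y where z: "z = (x, y)" "0 \<le> x" "x \<le> 1" "0 \<le> y" "y \<le> 1"
    using assms(1) by (auto simp: unit_square_def)
  have "x - (\<delta> + (1 - 2 * \<delta>) * x) = \<delta> * (2 * x - 1)" "y - ((1 + 2 * \<delta>) * y - \<delta>) = \<delta> * (1 - 2 * y)"
    by (simp_all add: algebra_simps)
  moreover have "\<bar>2 * x - 1\<bar> \<le> 1" "\<bar>1 - 2 * y\<bar> \<le> 1" using z by auto
  ultimately have "\<bar>x - (\<delta> + (1 - 2 * \<delta>) * x)\<bar> \<le> \<delta>" "\<bar>y - ((1 + 2 * \<delta>) * y - \<delta>)\<bar> \<le> \<delta>"
    using assms(2) by (simp_all only: abs_mult) (simp_all add: mult_left_le)
  moreover have "dist z (stretch \<delta> z) \<le> \<bar>x - (\<delta> + (1 - 2 * \<delta>) * x)\<bar> + \<bar>y - ((1 + 2 * \<delta>) * y - \<delta>)\<bar>"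
    using sqrt_sum_squares_le_sum_abs[of "x - (\<delta> + (1 - 2 * \<delta>) * x)" "y - ((1 + 2 * \<delta>) * y - \<delta>)"]
    by (simp add: z stretch_def dist_prod_def dist_real_def)
  ultimately show ?thesis by linarith
qed

lemma dist_less_components:
  fixes p p' :: "real \<times> real"
  assumes "dist p p' < e"
  shows "\<bar>fst p - fst p'\<bar> < e" "\<bar>snd p - snd p'\<bar> < e"
  using assms dist_fst_le[of p p'] dist_snd_le[of p p'] by (auto simp: dist_real_def)

text \<open>\<open>B\<close> inverts \<open>stretch \<delta>\<close>, so that \<open>B (g z)\<close>
  is a small displacement of \<open>z\<close>. The point \<open>B p\<close> has enough room in the
  square to be moved by \<open>z - B (g z)\<close>, and Brouwer's theorem yields a preimage of
  \<open>p\<close>. It is interior because \<open>g\<close> maps the boundary of the square away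
  from the middle segment.\<close>

lemma middle_segment_covered:
  fixes g :: "real \<times> real \<Rightarrow> real \<times> real"
  assumes \<delta>: "0 < \<delta>" "\<delta> \<le> 1/4" and \<eta>: "0 < \<eta>" "\<eta> \<le> \<delta> / 4"
    and g: "continuous_on unit_square g" "\<And>z. z \<in> unit_square \<Longrightarrow> dist (g z) (stretch \<delta> z) < \<eta>"
    and p: "fst p = 1/2" "-\<eta> \<le> snd p" "snd p \<le> 1 + \<eta>"
  shows "p \<in> g ` ({0<..<1} \<times> {0<..<1})"
proof -
  define B where "B w = ((fst w - \<delta>) / (1 - 2 * \<delta>), (snd w + \<delta>) / (1 + 2 * \<delta>))" for w :: "real \<times> real"
  have pos: "1 - 2 * \<delta> > 0" "1 + 2 * \<delta> > 0" using \<delta> by auto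
  have "\<exists>z\<in>unit_square. B (g z) = B p"
  proof (rule brouwer_surjective[of unit_square "\<lambda>z. B (g z)" "{B p}"])
    show "compact unit_square" unfolding unit_square_def by (intro compact_Times) auto
    show "convex unit_square" unfolding unit_square_def by (intro convex_Times) auto
    show "unit_square \<noteq> {}" unfolding unit_square_def by auto
    show "continuous_on unit_square (\<lambda>z. B (g z))"
      unfolding B_def using pos by (intro continuous_intros g(1)) auto
    fix b z assume b: "b \<in> {B p}" and z: "z \<in> unit_square"
    define u v where "u = fst (g z) - fst (stretch \<delta> z)" and "v = snd (g z) - snd (stretch \<delta> z)"
    have uv: "\<bar>u\<bar> < \<eta>" "\<bar>v\<bar> < \<eta>"
      using dist_less_components[OF g(2)[OF z]] by (auto simp: u_def v_def)
    have "fst (B (g z)) = fst z + u / (1 - 2 * \<delta>)" "snd (B (g z)) = snd z + v / (1 + 2 * \<delta>)"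
      using pos by (simp_all add: B_def u_def v_def stretch_def field_simps)
    then have "b + (z - B (g z)) = ((1/2 - \<delta> - u) / (1 - 2 * \<delta>), (snd p + \<delta> - v) / (1 + 2 * \<delta>))"
      using b p(1) by (simp add: prod_eq_iff B_def diff_divide_distrib)
    moreover have "0 \<le> 1/2 - \<delta> - u" "1/2 - \<delta> - u \<le> 1 - 2 * \<delta>" "0 \<le> snd p + \<delta> - v" "snd p + \<delta> - v \<le> 1 + 2 * \<delta>"
      using uv \<delta> \<eta> p by auto
    ultimately show "b + (z - B (g z)) \<in> unit_square"
      using pos by (simp add: unit_square_def divide_le_eq)
  qed simp
  then obtain z where z: "z \<in> unit_square" "B (g z) = B p" by blast
  then have gz: "g z = p" using pos by (auto simp: B_def prod_eq_iff)
  have "\<bar>fst p - fst (stretch \<delta> z)\<bar> < \<eta>" "\<bar>snd p - snd (stretch \<delta> z)\<bar> < \<eta>"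
    using dist_less_components[OF g(2)[OF z(1)]] by (auto simp: gz)
  then have "fst z \<noteq> 0" "fst z \<noteq> 1" "snd z \<noteq> 0" "snd z \<noteq> 1"
    using p \<delta> \<eta> by (auto simp: stretch_def abs_if split: if_splits)
  then have "z \<in> {0<..<1} \<times> {0<..<1}" using z(1) by (auto simp: unit_square_def)
  then show ?thesis using gz by blast
qed

text \<open>Otherwise the cut wire fence theorem splits \<open>A\<close> into closed pieces
  containing its left and its right side. Adding to them the parts of \<open>K\<close> off the open
  image \<open>U\<close> on either side of the line \<open>fst p = 1/2\<close> splits
  \<open>K\<close>: on that line \<open>K\<close> lies in \<open>U\<close>, and a point of
  \<open>A\<close> off \<open>U\<close> is on the left or the right side, since the top and bottom
  sides are outside the strip that contains \<open>K\<close>.\<close>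

proposition stretched_square_crossing:
  fixes g :: "real \<times> real \<Rightarrow> real \<times> real"
  assumes \<delta>: "0 < \<delta>" "\<delta> \<le> 1/4" and \<eta>: "0 < \<eta>" "\<eta> \<le> \<delta> / 4"
    and g: "continuous_on unit_square g" "inj_on g unit_square"
      "\<And>z. z \<in> unit_square \<Longrightarrow> dist (g z) (stretch \<delta> z) < \<eta>"
    and K: "compact K" "connected K" "\<And>p. p \<in> K \<Longrightarrow> -\<eta> \<le> snd p \<and> snd p \<le> 1 + \<eta>"
    and ends: "a \<in> K" "fst a \<le> \<eta>" "b \<in> K" "1 - \<eta> \<le> fst b"
  obtains L where "L \<subseteq> K" "compact L" "connected L" "L \<subseteq> g ` unit_square"
    "L \<inter> g ` ({0} \<times> {0..1}) \<noteq> {}" "L \<inter> g ` ({1} \<times> {0..1}) \<noteq> {}"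
proof -
  have comp_sq: "compact unit_square" unfolding unit_square_def by (intro compact_Times) auto
  define A where "A = K \<inter> g ` unit_square"
  define Left where "Left = K \<inter> g ` ({0} \<times> {0..1})"
  define Right where "Right = K \<inter> g ` ({1} \<times> {0..1})"
  define U where "U = g ` ({0<..<1} \<times> {0<..<1})"
  have sub_sq: "{0} \<times> {0..1} \<subseteq> unit_square" "{1} \<times> {0..1} \<subseteq> unit_square" "{0<..<1} \<times> {0<..<1} \<subseteq> unit_square"
    by (auto simp: unit_square_def)
  have img: "compact (g ` X)" if "compact X" "X \<subseteq> unit_square" for X
    using that g(1) by (intro compact_continuous_image) (auto intro: continuous_on_subset)
  have comp: "compact A" "compact Left" "compact Right"
    unfolding A_def Left_def Right_def using K(1) comp_sq sub_sq
    by (auto intro!: compact_Int img compact_Times)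
  have LA: "Left \<subseteq> A" and RA: "Right \<subseteq> A" using sub_sq by (auto simp: A_def Left_def Right_def)
  have "open U"
    unfolding U_def
    by (rule invariance_of_domain_gen)
      (use g sub_sq in \<open>auto intro: continuous_on_subset inj_on_subset open_Times\<close>)
  have near: "\<bar>fst (g z) - fst (stretch \<delta> z)\<bar> < \<eta>" "\<bar>snd (g z) - snd (stretch \<delta> z)\<bar> < \<eta>"
    if "z \<in> unit_square" for z
    using dist_less_components[OF g(3)[OF that]] by auto
  have side: "p \<in> Left \<and> fst p < 1/2 \<or> p \<in> Right \<and> 1/2 < fst p" if p: "p \<in> A" "p \<notin> U" for p
  proof -
    obtain z where z: "z \<in> unit_square" "p = g z" "p \<in> K" using p(1) by (auto simp: A_def)
    then have "z \<notin> {0<..<1} \<times> {0<..<1}" using p(2) by (auto simp: U_def)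
    then consider "fst z = 0" | "fst z = 1" | "snd z = 0" | "snd z = 1"
      using z(1) by (cases z) (force simp: unit_square_def)
    then show ?thesis
    proof cases
      case 1
      then have "z \<in> {0} \<times> {0..1}" using z(1) by (auto simp: unit_square_def)
      moreover have "fst p < 1/2" using near(1)[OF z(1)] 1 \<delta> \<eta> by (simp add: z(2) stretch_def)
      ultimately show ?thesis using z by (auto simp: Left_def)
    next
      case 2
      then have "z \<in> {1} \<times> {0..1}" using z(1) by (auto simp: unit_square_def)
      moreover have "1/2 < fst p" using near(1)[OF z(1)] 2 \<delta> \<eta> by (simp add: z(2) stretch_def)
      ultimately show ?thesis using z by (auto simp: Right_def)
    next
      case 3
      then show ?thesis using near(2)[OF z(1)] K(3)[OF z(3)] \<delta> \<eta> by (simp add: z(2) stretch_def)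
    next
      case 4
      then show ?thesis using near(2)[OF z(1)] K(3)[OF z(3)] \<delta> \<eta> by (simp add: z(2) stretch_def)
    qed
  qed
  \<comment> \<open>Here narrowness enters: the ends \<open>a\<close> and \<open>b\<close> of
    \<open>K\<close> are outside the image, so they fall into different pieces.\<close>
  have far: "\<eta> < fst p \<and> fst p < 1 - \<eta>" if p: "p \<in> g ` unit_square" for p
  proof -
    obtain z where z: "z \<in> unit_square" "p = g z" using p by auto
    have "0 \<le> (1 - 2 * \<delta>) * fst z" "(1 - 2 * \<delta>) * fst z \<le> 1 - 2 * \<delta>"
      using z(1) \<delta> by (auto simp: unit_square_def mult_left_le)
    moreover have "\<bar>fst p - (\<delta> + (1 - 2 * \<delta>) * fst z)\<bar> < \<eta>"
      using near(1)[OF z(1)] by (simp add: z(2) stretch_def)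
    ultimately show ?thesis using \<delta> \<eta> by linarith
  qed
  have "\<exists>C. connected C \<and> C \<subseteq> A \<and> C \<inter> Left \<noteq> {} \<and> C \<inter> Right \<noteq> {}"
  proof (rule ccontr)
    assume no: "\<not> ?thesis"
    have "separated_between (top_of_set A) Left Right"
    proof (rule cut_wire_fence_theorem)
      show "compact_space (top_of_set A)" using comp(1) by (simp add: compact_space_subtopology)
      show "Hausdorff_space (top_of_set A)" by (simp add: Hausdorff_space_subtopology)
      show "closedin (top_of_set A) Left" "closedin (top_of_set A) Right"
        using LA RA comp by (auto intro: closed_subset compact_imp_closed)
      show "disjnt C Left \<or> disjnt C Right" if "connectedin (top_of_set A) C" for C
        using that no by (auto simp: connectedin_subtopology disjnt_def)
    qed
    then obtain A1 A2 where sep: "openin (top_of_set A) A1" "openin (top_of_set A) A2" "A1 \<union> A2 = A"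
        "A1 \<inter> A2 = {}" "Left \<subseteq> A1" "Right \<subseteq> A2"
      unfolding separated_between_def disjnt_def by auto
    have "A1 = A - A2" "A2 = A - A1" using sep(3,4) by auto
    then have "closedin (top_of_set A) A1" "closedin (top_of_set A) A2"
      using sep(1,2) by (metis closedin_def Diff_Diff_Int inf.absorb_iff2 openin_subset topspace_euclidean_subtopology Diff_subset)+
    then have clA: "closed A1" "closed A2" using comp(1) compact_imp_closed closedin_closed_trans by blast+
    define C1 where "C1 = K \<inter> {p. fst p \<le> 1/2} \<inter> - U"
    define C2 where "C2 = K \<inter> {p. 1/2 \<le> fst p} \<inter> - U"
    have clK: "closed K" using K(1) compact_imp_closed by blast
    have "closed C1" "closed C2"
      unfolding C1_def C2_def using clK \<open>open U\<close>
      by (intro closed_Int closed_Compl closed_Collect_le continuous_intros; simp)+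
    then have cl: "closed (A1 \<union> C1)" "closed (A2 \<union> C2)" using clA by (auto intro: closed_Un)
    have cover: "K \<subseteq> (A1 \<union> C1) \<union> (A2 \<union> C2)"
    proof
      fix p assume p: "p \<in> K"
      show "p \<in> (A1 \<union> C1) \<union> (A2 \<union> C2)"
      proof (cases "p \<in> U")
        case True
        then have "p \<in> A" using p sub_sq(3) by (auto simp: U_def A_def)
        then show ?thesis using sep(3) by blast
      next
        case False
        then show ?thesis using p by (auto simp: C1_def C2_def)
      qed
    qed
    have disj: "(A1 \<union> C1) \<inter> (A2 \<union> C2) \<inter> K = {}"
    proof -
      have "C1 \<inter> C2 = {}"
      proof -
        have False if "p \<in> C1" "p \<in> C2" for p
        proof -
          have "fst p = 1/2" "p \<in> K" "p \<notin> U" using that by (auto simp: C1_def C2_def)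
          then show False
            using middle_segment_covered[OF \<delta> \<eta> g(1,3), of p] K(3)[of p] by (auto simp: U_def)
        qed
        then show ?thesis by blast
      qed
      moreover have "A1 \<inter> C2 = {}"
      proof -
        have False if "p \<in> A1" "p \<in> C2" for p
        proof -
          have "p \<in> A" "p \<notin> U" "1/2 \<le> fst p" using that sep(3) by (auto simp: C2_def)
          then have "p \<in> Right" using side[of p] by linarith
          then show False using that(1) sep(4,6) by blast
        qed
        then show ?thesis by blast
      qed
      moreover have "C1 \<inter> A2 = {}"
      proof -
        have False if "p \<in> A2" "p \<in> C1" for p
        proof -
          have "p \<in> A" "p \<notin> U" "fst p \<le> 1/2" using that sep(3) by (auto simp: C1_def)
          then have "p \<in> Left" using side[of p] by linarith
          then show False using that(1) sep(4,5) by blast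
        qed
        then show ?thesis by blast
      qed
      ultimately show ?thesis using sep(4) by blast
    qed
    have "U \<subseteq> g ` unit_square" using sub_sq(3) by (auto simp: U_def)
    then have "a \<notin> U" "b \<notin> U" using far[of a] far[of b] ends by auto
    then have "a \<in> C1" "b \<in> C2" using ends \<eta> \<delta> by (auto simp: C1_def C2_def)
    then have "(A1 \<union> C1) \<inter> K \<noteq> {}" "(A2 \<union> C2) \<inter> K \<noteq> {}" using ends by auto
    then show False using K(2) cl cover disj unfolding connected_closed by blast
  qed
  then obtain C where C: "connected C" "C \<subseteq> A" "C \<inter> Left \<noteq> {}" "C \<inter> Right \<noteq> {}" by blast
  have "closure C \<subseteq> A" using C(2) comp(1) by (intro closure_minimal compact_imp_closed)
  moreover have "compact (closure C)"
    using C(2) comp(1) bounded_subset compact_imp_bounded by (metis compact_closure)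
  moreover have "connected (closure C)" using C(1) by (rule connected_imp_connected_closure)
  ultimately show thesis
    using C(3,4) closure_subset[of C] by (intro that[of "closure C"]) (auto simp: A_def Left_def Right_def)
qed

section \<open>The metric on the Riemann sphere\<close>

lemma riemann_sphere_topspace: "topspace riemann_sphere = UNIV"
  unfolding riemann_sphere_def by (simp add: UNIV_option_conv)

lemma openin_riemann_sphere:
  "openin riemann_sphere V \<longleftrightarrow>
     (\<exists>U. open U \<and> V = Some ` U) \<or> (\<exists>C. compact C \<and> V = insert None (Some ` (- C)))"
  unfolding riemann_sphere_def openin_Alexandroff_compactification
  by (auto simp: Compl_eq_Diff_UNIV compact_imp_closed)

lemma dist_inv_stereographic_None:
  "(dist (inv_stereographic (Some z)) (inv_stereographic None))\<^sup>2 = 4 / (1 + (cmod z)\<^sup>2)"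
proof -
  define n where "n = (cmod z)\<^sup>2"
  have n: "n + 1 > 0" unfolding n_def by (rule add_nonneg_pos) auto
  have "(dist (inv_stereographic (Some z)) (inv_stereographic None))\<^sup>2
      = (2 / (1 + n))\<^sup>2 * n + ((n - 1) / (n + 1) - 1)\<^sup>2"
    by (simp add: dist_prod_def dist_real_def power_mult_distrib power_divide n_def)
  also have "(n - 1) / (n + 1) - 1 = - 2 / (n + 1)" using n by (simp add: field_simps)
  also have "(2 / (1 + n))\<^sup>2 * n + (- 2 / (n + 1))\<^sup>2 = 4 * (n + 1) / (n + 1)\<^sup>2"
    by (simp add: power_divide add_divide_distrib add.commute)
  also have "\<dots> = 4 / (1 + n)"
    unfolding power2_eq_square using n
    by (subst nonzero_mult_divide_mult_cancel_right) (auto simp: add.commute)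
  finally show ?thesis by (simp add: n_def)
qed

lemma continuous_map_inv_stereographic: "continuous_map riemann_sphere euclidean inv_stereographic"
  unfolding continuous_map_def riemann_sphere_topspace
proof (intro conjI allI impI)
  fix V :: "(complex \<times> real) set" assume "openin euclidean V"
  then have V: "open V" by simp
  define U where "U = {z. inv_stereographic (Some z) \<in> V}"
  have pos: "1 + (cmod z)\<^sup>2 \<noteq> 0" "(cmod z)\<^sup>2 + 1 \<noteq> 0" for z
    using zero_le_power2[of "cmod z"] by linarith+
  have "continuous_on UNIV (\<lambda>z. inv_stereographic (Some z))"
    unfolding inv_stereographic.simps using pos by (intro continuous_intros) auto
  then have U: "open U" unfolding U_def using V by (simp add: continuous_on_open_vimage vimage_def)
  show "openin riemann_sphere {x \<in> UNIV. inv_stereographic x \<in> V}"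
  proof (cases "inv_stereographic None \<in> V")
    case True
    then obtain e where e: "e > 0" "\<And>y. dist y (inv_stereographic None) < e \<Longrightarrow> y \<in> V"
      using V unfolding open_dist by blast
    \<comment> \<open>The squared chordal distance of \<open>z\<close> to infinity is
      \<open>4 / (1 + (cmod z)\<^sup>2)\<close>, so points at distance at least \<open>e\<close>
      from infinity are bounded.\<close>
    have "- U \<subseteq> cball 0 (2 / e)"
    proof
      fix z assume "z \<in> - U"
      have "e \<le> dist (inv_stereographic (Some z)) (inv_stereographic None)"
      proof (rule ccontr)
        assume "\<not> e \<le> dist (inv_stereographic (Some z)) (inv_stereographic None)"
        then have "z \<in> U" using e(2) unfolding U_def by (simp only: not_le mem_Collect_eq)
        with \<open>z \<in> - U\<close> show False by simp
      qed
      then have "e\<^sup>2 \<le> 4 / (1 + (cmod z)\<^sup>2)"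
        using e(1) power_mono[of e _ 2] by (metis dist_inv_stereographic_None less_imp_le)
      then have "e\<^sup>2 * (1 + (cmod z)\<^sup>2) \<le> 4"
        using pos(1)[of z] zero_le_power2[of "cmod z"] by (simp add: pos_le_divide_eq)
      moreover have "e\<^sup>2 * (1 + (cmod z)\<^sup>2) = e\<^sup>2 + e\<^sup>2 * (cmod z)\<^sup>2" by (simp add: distrib_left)
      ultimately have "e\<^sup>2 * (cmod z)\<^sup>2 \<le> 4" using zero_le_power2[of e] by linarith
      then have "(e * cmod z)\<^sup>2 \<le> 2\<^sup>2" by (simp add: power_mult_distrib)
      then have "e * cmod z \<le> 2" by (rule power2_le_imp_le) simp
      then show "z \<in> cball 0 (2 / e)" using e(1) by (simp add: field_simps)
    qed
    then have "compact (- U)" using U by (auto simp: compact_eq_bounded_closed intro: bounded_subset)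
    moreover have "{x \<in> UNIV. inv_stereographic x \<in> V} = insert None (Some ` (- (- U)))"
    proof (rule set_eqI)
      show "x \<in> {x \<in> UNIV. inv_stereographic x \<in> V} \<longleftrightarrow> x \<in> insert None (Some ` (- (- U)))" for x
        by (cases x) (use True in \<open>auto simp: U_def simp del: inv_stereographic.simps\<close>)
    qed
    ultimately show ?thesis unfolding openin_riemann_sphere by blast
  next
    case False
    have "{x \<in> UNIV. inv_stereographic x \<in> V} = Some ` U"
    proof (rule set_eqI)
      show "x \<in> {x \<in> UNIV. inv_stereographic x \<in> V} \<longleftrightarrow> x \<in> Some ` U" for x
        by (cases x) (use False in \<open>auto simp: U_def simp del: inv_stereographic.simps\<close>)
    qed
    then show ?thesis unfolding openin_riemann_sphere using U by blast
  qed
qed auto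

lemma inj_inv_stereographic: "inj inv_stereographic"
proof -
  have snd_less: "snd (inv_stereographic (Some z)) < 1" for z
    by (simp add: divide_less_eq_1 add_nonneg_pos)
  have "z = w" if "inv_stereographic (Some z) = inv_stereographic (Some w)" for z w
  proof -
    define n where "n z = (cmod z)\<^sup>2" for z
    have n: "n z + 1 > 0" for z unfolding n_def by (rule add_nonneg_pos) auto
    have "(n z - 1) / (n z + 1) = (n w - 1) / (n w + 1)" using that by (simp add: n_def)
    then have "n z = n w" using n[of z] n[of w] by (simp add: field_simps)
    moreover have "(2 / (1 + n z)) *\<^sub>R z = (2 / (1 + n w)) *\<^sub>R w" using that by (simp add: n_def)
    ultimately show ?thesis using n[of w] by (simp add: add.commute)
  qed
  moreover have "inv_stereographic (Some z) \<noteq> inv_stereographic None" for z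
    using snd_less[of z] by (metis inv_stereographic.simps(1) less_irrefl snd_conv)
  ultimately show ?thesis
    by (intro injI) (metis not_None_eq)
qed

lemma surj_inv_stereographic: "range inv_stereographic = sphere 0 1"
proof (intro equalityI subsetI)
  fix x assume "x \<in> range inv_stereographic"
  then show "x \<in> sphere 0 1" using norm_inv_stereographic by auto
next
  fix x :: "complex \<times> real" assume x: "x \<in> sphere 0 1"
  obtain w t where wt: "x = (w, t)" by fastforce
  have nt: "(cmod w)\<^sup>2 + t\<^sup>2 = 1" using x by (simp add: wt norm_Pair)
  show "x \<in> range inv_stereographic"
  proof (cases "t = 1")
    case True
    then have "x = inv_stereographic None" using nt by (simp add: wt)
    then show ?thesis by blast
  next
    case False
    have "t\<^sup>2 \<le> 1\<^sup>2" unfolding one_power2 using nt zero_le_power2[of "cmod w"] by linarith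
    then have "t \<le> 1" by (rule power2_le_imp_le) simp
    then have t: "t < 1" using False by simp
    \<comment> \<open>Stereographic projection from the north pole.\<close>
    define z where "z = (1 / (1 - t)) *\<^sub>R w"
    have "(cmod w)\<^sup>2 = (1 - t) * (1 + t)" using nt by (simp add: power2_eq_square algebra_simps)
    then have n: "(cmod z)\<^sup>2 = (1 + t) / (1 - t)"
      using t by (simp add: z_def power_divide power2_eq_square)
    have "1 + (1 + t) / (1 - t) = 2 / (1 - t)" using t by (simp add: field_simps)
    then have 1: "2 / (1 + (cmod z)\<^sup>2) = 1 - t" using t n by simp
    have "(1 + t) / (1 - t) - 1 = 2 * t / (1 - t)" "(1 + t) / (1 - t) + 1 = 2 / (1 - t)"
      using t by (simp_all add: field_simps)
    then have 2: "((cmod z)\<^sup>2 - 1) / ((cmod z)\<^sup>2 + 1) = t" using t n by simp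
    have "x = inv_stereographic (Some z)"
      using t by (simp add: wt 1 2 del: scaleR_conv_of_real) (simp add: z_def)
    then show ?thesis by blast
  qed
qed

lemma homeomorphic_map_inv_stereographic:
  "homeomorphic_map riemann_sphere (top_of_set (sphere 0 1)) inv_stereographic"
proof (rule continuous_imp_homeomorphic_map)
  show "continuous_map riemann_sphere (top_of_set (sphere 0 1)) inv_stereographic"
    using continuous_map_inv_stereographic norm_inv_stereographic
    by (simp add: continuous_map_in_subtopology image_subset_iff)
  show "compact_space riemann_sphere" by (simp add: riemann_sphere_def)
  show "Hausdorff_space (top_of_set (sphere (0 :: complex \<times> real) 1))"
    by (simp add: Hausdorff_space_subtopology)
  show "inv_stereographic ` topspace riemann_sphere = topspace (top_of_set (sphere 0 1))"
    by (simp add: riemann_sphere_topspace surj_inv_stereographic)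
  show "inj_on inv_stereographic (topspace riemann_sphere)"
    by (simp add: riemann_sphere_topspace inj_inv_stereographic)
qed

lemma Hausdorff_riemann_sphere: "Hausdorff_space riemann_sphere"
  using homeomorphic_map_inv_stereographic
  by (metis Hausdorff_space_euclidean Hausdorff_space_subtopology homeomorphic_Hausdorff_space homeomorphic_map_imp_homeomorphic_space)

lemma openin_riemann_sphere_vimage:
  "openin riemann_sphere T \<longleftrightarrow> (\<exists>V. open V \<and> T = inv_stereographic -` V)"
proof
  assume "openin riemann_sphere T"
  then have "openin (top_of_set (sphere 0 1)) (inv_stereographic ` T)"
    using homeomorphic_map_inv_stereographic homeomorphic_imp_open_map open_map_def by blast
  then obtain V where V: "open V" "inv_stereographic ` T = sphere 0 1 \<inter> V"
    by (auto simp: openin_open)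
  have "T = inv_stereographic -` V"
  proof (intro equalityI subsetI)
    fix x assume "x \<in> inv_stereographic -` V"
    then have "inv_stereographic x \<in> inv_stereographic ` T"
      using V(2) norm_inv_stereographic[of x] by auto
    then show "x \<in> T" using inj_inv_stereographic by (auto dest: injD)
  qed (use V(2) in auto)
  then show "\<exists>V. open V \<and> T = inv_stereographic -` V" using V(1) by blast
next
  assume "\<exists>V. open V \<and> T = inv_stereographic -` V"
  then obtain V where "open V" "T = inv_stereographic -` V" by blast
  then show "openin riemann_sphere T"
    using openin_continuous_map_preimage[OF continuous_map_inv_stereographic, of V]
    by (simp add: riemann_sphere_topspace vimage_def)
qed

section \<open>The spherical distance and the topology of subsets of the sphere\<close>

text \<open>The components \<open>u\<close> and \<open>v\<close> of \<open>a\<close> and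
  \<open>c\<close> orthogonal to \<open>b\<close> have norms \<open>sin \<alpha>\<close> and
  \<open>sin \<beta>\<close>. By Cauchy-Schwarz \<open>u \<bullet> v\<close> is at least minus the
  product of these norms, which amounts to
  \<open>cos (\<alpha> + \<beta>) \<le> a \<bullet> c\<close>. If the sum of the angles exceeds
  \<open>pi\<close>, the range of \<open>arccos\<close> settles the claim.\<close>

lemma arccos_inner_triangle:
  fixes a b c :: "'a::real_inner"
  assumes "norm a = 1" "norm b = 1" "norm c = 1"
  shows "arccos (a \<bullet> c) \<le> arccos (a \<bullet> b) + arccos (b \<bullet> c)"
proof -
  have bd: "-1 \<le> x \<bullet> y" "x \<bullet> y \<le> 1" if "norm x = 1" "norm y = 1" for x y :: 'a
    using Cauchy_Schwarz_ineq2[of x y] that by (auto simp: abs_le_iff)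
  define \<alpha> \<beta> where "\<alpha> = arccos (a \<bullet> b)" and "\<beta> = arccos (b \<bullet> c)"
  have \<alpha>: "0 \<le> \<alpha>" "cos \<alpha> = a \<bullet> b" "sin \<alpha> = sqrt (1 - (a \<bullet> b)\<^sup>2)"
    and \<beta>: "0 \<le> \<beta>" "cos \<beta> = b \<bullet> c" "sin \<beta> = sqrt (1 - (b \<bullet> c)\<^sup>2)"
    using bd assms by (auto simp: \<alpha>_def \<beta>_def arccos_lbound sin_arccos)
  show ?thesis
  proof (cases "\<alpha> + \<beta> \<le> pi")
    case True
    define u v where "u = a - (a \<bullet> b) *\<^sub>R b" and "v = c - (b \<bullet> c) *\<^sub>R b"
    have bb: "b \<bullet> b = 1" "a \<bullet> a = 1" "c \<bullet> c = 1" using assms by (simp_all add: dot_square_norm)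
    have "u \<bullet> v = a \<bullet> c - (a \<bullet> b) * (b \<bullet> c)"
      by (simp add: u_def v_def inner_diff_left inner_diff_right bb inner_commute algebra_simps)
    moreover have "norm u = sin \<alpha>"
      unfolding \<alpha>(3) norm_eq_sqrt_inner
      by (simp add: u_def inner_diff_left inner_diff_right bb inner_commute power2_eq_square)
    moreover have "norm v = sin \<beta>"
      unfolding \<beta>(3) norm_eq_sqrt_inner
      by (simp add: v_def inner_diff_left inner_diff_right bb inner_commute power2_eq_square)
    moreover have "- (norm u * norm v) \<le> u \<bullet> v" using Cauchy_Schwarz_ineq2[of u v] by (simp add: abs_le_iff)
    ultimately have "cos (\<alpha> + \<beta>) \<le> a \<bullet> c" by (simp add: cos_add \<alpha>(2) \<beta>(2))
    then have "arccos (a \<bullet> c) \<le> arccos (cos (\<alpha> + \<beta>))"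
      using bd[OF assms(1,3)] by (intro arccos_le_arccos) auto
    also have "\<dots> = \<alpha> + \<beta>" using True \<alpha>(1) \<beta>(1) by (intro arccos_cos) auto
    finally show ?thesis by (simp add: \<alpha>_def \<beta>_def)
  next
    case False
    then show ?thesis using arccos_ubound[OF bd[OF assms(1,3)]] by (simp add: \<alpha>_def \<beta>_def)
  qed
qed

lemma inner_inv_stereographic_bounds:
  "-1 \<le> inv_stereographic p \<bullet> inv_stereographic q" "inv_stereographic p \<bullet> inv_stereographic q \<le> 1"
  using Cauchy_Schwarz_ineq2[of "inv_stereographic p" "inv_stereographic q"]
  by (auto simp: norm_inv_stereographic abs_le_iff)

lemma spherical_dist_bounds: "0 \<le> spherical_dist p q" "spherical_dist p q \<le> pi"
  unfolding spherical_dist_def using arccos_bounded[OF inner_inv_stereographic_bounds] by auto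

lemma dist_inv_stereographic:
  "(dist (inv_stereographic p) (inv_stereographic q))\<^sup>2 = 2 - 2 * cos (spherical_dist p q)"
proof -
  have "inv_stereographic p \<bullet> inv_stereographic p = 1" for p
    by (simp add: dot_square_norm norm_inv_stereographic)
  then show ?thesis
    unfolding spherical_dist_def dist_norm power2_norm_eq_inner
    by (simp add: inner_diff_left inner_diff_right inner_commute cos_arccos[OF inner_inv_stereographic_bounds])
qed

lemma spherical_dist_eq_0: "spherical_dist p q = 0 \<longleftrightarrow> p = q"
proof
  assume "spherical_dist p q = 0"
  then have "dist (inv_stereographic p) (inv_stereographic q) = 0"
    using dist_inv_stereographic[of p q] by simp
  then show "p = q" using inj_inv_stereographic by (simp add: inj_eq)
next
  assume "p = q"
  then show "spherical_dist p q = 0"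
    by (simp add: spherical_dist_def dot_square_norm norm_inv_stereographic)
qed

lemma dist_le_spherical_dist: "dist (inv_stereographic p) (inv_stereographic q) \<le> spherical_dist p q"
proof (rule power2_le_imp_le)
  define s where "s = spherical_dist p q"
  have s: "0 \<le> s" "s \<le> pi" using spherical_dist_bounds by (auto simp: s_def)
  have "cos s = 1 - 2 * (sin (s / 2))\<^sup>2" using cos_double_sin[of "s / 2"] by simp
  moreover have "(sin (s / 2))\<^sup>2 \<le> (s / 2)\<^sup>2"
    using s by (intro power_mono sin_x_le_x sin_ge_zero) auto
  ultimately show "(dist (inv_stereographic p) (inv_stereographic q))\<^sup>2 \<le> (spherical_dist p q)\<^sup>2"
    unfolding dist_inv_stereographic s_def[symmetric] by (simp add: power_divide)
qed (rule spherical_dist_bounds)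

lemma spherical_dist_less:
  assumes "0 < e"
  obtains d where "0 < d" "\<And>p q. dist (inv_stereographic p) (inv_stereographic q) < d \<Longrightarrow> spherical_dist p q < e"
proof -
  \<comment> \<open>Capped at \<open>pi\<close>, up to which \<open>cos\<close> is decreasing; the
    distance chosen below is the chord of the angle \<open>r\<close>.\<close>
  define r where "r = min e pi"
  have r: "0 < r" "r \<le> pi" "r \<le> e" using assms by (auto simp: r_def)
  have pos: "0 < 2 - 2 * cos r" using cos_monotone_0_pi[of 0 r] r by simp
  show thesis
  proof (rule that[of "sqrt (2 - 2 * cos r)"])
    show "0 < sqrt (2 - 2 * cos r)" using pos by simp
    fix p q assume "dist (inv_stereographic p) (inv_stereographic q) < sqrt (2 - 2 * cos r)"
    then have "(dist (inv_stereographic p) (inv_stereographic q))\<^sup>2 < (sqrt (2 - 2 * cos r))\<^sup>2"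
      by (intro power_strict_mono) auto
    then have "cos r < cos (spherical_dist p q)" using pos by (simp add: dist_inv_stereographic)
    then have "spherical_dist p q < r"
      using cos_monotone_0_pi_le[of r "spherical_dist p q"] r spherical_dist_bounds[of p q] by force
    then show "spherical_dist p q < e" using r by simp
  qed
qed

lemma Metric_space_point_dist: "Metric_space D (point_dist D)"
proof (cases "None \<in> D")
  case True
  have "spherical_dist x z \<le> spherical_dist x y + spherical_dist y z" for x y z
    unfolding spherical_dist_def by (rule arccos_inner_triangle) (rule norm_inv_stereographic)+
  then show ?thesis
    using True by (simp add: Metric_space_def point_dist_def spherical_dist_bounds spherical_dist_eq_0)
      (simp add: spherical_dist_def inner_commute)
next
  case False
  have inj: "x = y" if "x \<in> D" "y \<in> D" "the x = the y" for x y
    using that False by (metis option.expand)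
  have pd: "point_dist D x y = cmod (the x - the y)" for x y using False by (simp add: point_dist_def)
  show ?thesis
  proof
    show "point_dist D x y = point_dist D y x" for x y unfolding pd by (rule norm_minus_commute)
    show "point_dist D x y = 0 \<longleftrightarrow> x = y" if "x \<in> D" "y \<in> D" for x y
      using inj[OF that] by (auto simp: pd)
    show "point_dist D x z \<le> point_dist D x y + point_dist D y z" for x y z
      unfolding pd using norm_triangle_ineq[of "the x - the y" "the y - the z"] by simp
  qed (simp add: pd)
qed

interpretation pd: Metric_space D "point_dist D" for D
  by (rule Metric_space_point_dist)

text \<open>One criterion for both cases of \<open>point_dist\<close>: \<open>f\<close> will be
  \<open>inv_stereographic\<close> for sets containing infinity and \<open>the\<close> for sets of
  finite points.\<close>

lemma mtopology_eqI:
  fixes f :: "'a \<Rightarrow> 'b::metric_space"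
  assumes M: "Metric_space M d" and X: "\<And>U. openin X U \<longleftrightarrow> (\<exists>V. open V \<and> U = M \<inter> f -` V)"
    and 1: "\<And>x e. x \<in> M \<Longrightarrow> 0 < e \<Longrightarrow> \<exists>r>0. \<forall>y\<in>M. dist (f x) (f y) < r \<longrightarrow> d x y < e"
    and 2: "\<And>x e. x \<in> M \<Longrightarrow> 0 < e \<Longrightarrow> \<exists>r>0. \<forall>y\<in>M. d x y < r \<longrightarrow> dist (f x) (f y) < e"
  shows "Metric_space.mtopology M d = X"
proof -
  interpret Metric_space M d by (rule M)
  have "openin mtopology U \<longleftrightarrow> openin X U" for U
  proof
    assume U: "openin mtopology U"
    have "\<exists>r>0. \<forall>y\<in>M. dist (f x) (f y) < r \<longrightarrow> y \<in> U" if x: "x \<in> U" for x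
    proof -
      have xM: "x \<in> M" using U x by (auto simp: openin_mtopology)
      obtain e where e: "e > 0" "mball x e \<subseteq> U" using U x by (auto simp: openin_mtopology)
      obtain r where "r > 0" "\<And>y. y \<in> M \<Longrightarrow> dist (f x) (f y) < r \<Longrightarrow> d x y < e"
        using 1[OF xM e(1)] by blast
      then show ?thesis using e(2) xM by (intro exI[of _ r]) auto
    qed
    then obtain r where r: "\<And>x. x \<in> U \<Longrightarrow> r x > 0"
        "\<And>x y. x \<in> U \<Longrightarrow> y \<in> M \<Longrightarrow> dist (f x) (f y) < r x \<Longrightarrow> y \<in> U"
      by metis
    have "f x \<in> ball (f x) (r x)" if "x \<in> U" for x using r(1)[OF that] by simp
    moreover have "U \<subseteq> M" using openin_subset[OF U] by simp
    ultimately have "U = M \<inter> f -` (\<Union>x\<in>U. ball (f x) (r x))"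
    proof (intro equalityI subsetI)
      fix y assume "y \<in> M \<inter> f -` (\<Union>x\<in>U. ball (f x) (r x))"
      then obtain x where "x \<in> U" "y \<in> M" "dist (f x) (f y) < r x" by auto
      then show "y \<in> U" by (rule r(2))
    qed blast
    moreover have "open (\<Union>x\<in>U. ball (f x) (r x))" by blast
    ultimately show "openin X U" unfolding X by blast
  next
    assume "openin X U"
    then obtain V where V: "open V" "U = M \<inter> f -` V" unfolding X by blast
    have "\<exists>r>0. mball x r \<subseteq> U" if x: "x \<in> U" for x
    proof -
      obtain e where e: "e > 0" "\<And>y. dist y (f x) < e \<Longrightarrow> y \<in> V"
        using V x unfolding open_dist by blast
      obtain r where "r > 0" "\<And>y. y \<in> M \<Longrightarrow> d x y < r \<Longrightarrow> dist (f x) (f y) < e"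
        using 2[of x e] x V(2) e(1) by blast
      then show ?thesis using e(2) V(2) by (intro exI[of _ r]) (auto simp: dist_commute)
    qed
    then show "openin mtopology U" using V(2) by (auto simp: openin_mtopology)
  qed
  then show ?thesis by (simp add: topology_eq)
qed


text \<open>Links the metric used for quads with the topology used for crossings. For sets of finite
  points, a neighbourhood of infinity contributes the complement of a compact set.\<close>

lemma mtopology_point_dist: "pd.mtopology D = subtopology riemann_sphere D"
proof (cases "None \<in> D")
  case True
  show ?thesis
  proof (rule mtopology_eqI[OF Metric_space_point_dist, where f = inv_stereographic])
    show "openin (subtopology riemann_sphere D) U \<longleftrightarrow> (\<exists>V. open V \<and> U = D \<inter> inv_stereographic -` V)" for U
      unfolding openin_subtopology openin_riemann_sphere_vimage by blast
    show "\<exists>r>0. \<forall>y\<in>D. dist (inv_stereographic x) (inv_stereographic y) < r \<longrightarrow> point_dist D x y < e"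
      if "0 < e" for x e
      using spherical_dist_less[OF that] True unfolding point_dist_def by metis
    show "\<exists>r>0. \<forall>y\<in>D. point_dist D x y < r \<longrightarrow> dist (inv_stereographic x) (inv_stereographic y) < e"
      if "0 < e" for x e
      using that True
      by (intro exI[of _ e]) (auto simp: point_dist_def intro: le_less_trans[OF dist_le_spherical_dist])
  qed
next
  case False
  show ?thesis
  proof (rule mtopology_eqI[OF Metric_space_point_dist, where f = the])
    have D: "x \<in> D \<Longrightarrow> x = Some (the x)" for x using False by (cases x) auto
    show "openin (subtopology riemann_sphere D) U \<longleftrightarrow> (\<exists>V. open V \<and> U = D \<inter> the -` V)" for U
    proof
      assume "openin (subtopology riemann_sphere D) U"
      then obtain T where T: "openin riemann_sphere T" "U = T \<inter> D" by (auto simp: openin_subtopology)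
      then consider V where "open V" "T = Some ` V" | C where "compact C" "T = insert None (Some ` (- C))"
        unfolding openin_riemann_sphere by blast
      then show "\<exists>V. open V \<and> U = D \<inter> the -` V"
      proof cases
        case 1
        then have "U = D \<inter> the -` V" using T(2) D by force
        then show ?thesis using 1(1) by blast
      next
        case 2
        then have "U = D \<inter> the -` (- C)" using T(2) D False by force
        then show ?thesis using 2(1) by (metis compact_imp_closed open_Compl)
      qed
    next
      assume "\<exists>V. open V \<and> U = D \<inter> the -` V"
      then obtain V where V: "open V" "U = D \<inter> the -` V" by blast
      have "U = Some ` V \<inter> D" using V(2) D by force
      then show "openin (subtopology riemann_sphere D) U"
        using V(1) unfolding openin_subtopology openin_riemann_sphere by blast
    qed
  qed (use False in \<open>auto simp: point_dist_def dist_norm\<close>)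
qed

text \<open>The image of \<open>D\<close> under \<open>f\<close> is separable in the ambient space.
  Preimages of a countable dense subset are dense for \<open>d\<close>, because closeness under
  \<open>f\<close> controls \<open>d\<close>.\<close>

lemma countable_dense_embedding:
  fixes f :: "'a \<Rightarrow> 'b::{metric_space,second_countable_topology}" and d :: "'a \<Rightarrow> 'a \<Rightarrow> real"
  assumes near: "\<And>e. 0 < e \<Longrightarrow> \<exists>r>0. \<forall>x\<in>D. \<forall>y\<in>D. dist (f x) (f y) < r \<longrightarrow> d x y < e"
  obtains Z where "countable Z" "Z \<subseteq> D" "\<And>x e. x \<in> D \<Longrightarrow> 0 < e \<Longrightarrow> \<exists>z\<in>Z. d x z < e"
proof -
  obtain T where T: "countable T" "T \<subseteq> f ` D" "f ` D \<subseteq> closure T" by (rule separable)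
  define Z where "Z = inv_into D f ` T"
  show thesis
  proof (rule that[of Z])
    show "countable Z" using T(1) by (simp add: Z_def)
    show "Z \<subseteq> D" using T(2) by (auto simp: Z_def inv_into_into)
    fix x and e :: real assume x: "x \<in> D" "0 < e"
    obtain r where r: "r > 0" "\<And>y. y \<in> D \<Longrightarrow> dist (f x) (f y) < r \<Longrightarrow> d x y < e"
      using near[OF x(2)] x(1) by blast
    have "f x \<in> closure T" using T(3) x(1) by blast
    then obtain t where t: "t \<in> T" "dist t (f x) < r" using r(1) unfolding closure_approachable by blast
    have "f (inv_into D f t) = t" "inv_into D f t \<in> D"
      using t(1) T(2) by (auto simp: f_inv_into_f inv_into_into)
    then show "\<exists>z\<in>Z. d x z < e"
      using t r(2)[of "inv_into D f t"] by (auto simp: Z_def dist_commute)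
  qed
qed

lemma countable_dense_point_dist:
  obtains Z where "countable Z" "Z \<subseteq> D" "\<And>x e. x \<in> D \<Longrightarrow> 0 < e \<Longrightarrow> \<exists>z\<in>Z. point_dist D x z < e"
proof (cases "None \<in> D")
  case True
  show thesis
  proof (rule countable_dense_embedding[of D inv_stereographic "point_dist D", OF _ that])
    show "\<exists>r>0. \<forall>x\<in>D. \<forall>y\<in>D. dist (inv_stereographic x) (inv_stereographic y) < r \<longrightarrow> point_dist D x y < e"
      if "0 < e" for e
      using spherical_dist_less[OF that] True unfolding point_dist_def by metis
  qed
next
  case False
  show thesis
    by (rule countable_dense_embedding[of D the "point_dist D", OF _ that])
      (use False in \<open>auto simp: point_dist_def dist_norm\<close>)
qed

section \<open>The space of quads\<close>

lemma compact_unit_square: "compact unit_square"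
  unfolding unit_square_def by (intro compact_Times) auto

lemma unit_square_nonempty: "unit_square \<noteq> {}"
  by (auto simp: unit_square_def)

lemma quad_continuous: "Q \<in> quads D \<Longrightarrow> continuous_map (top_of_set unit_square) riemann_sphere Q"
  unfolding quads_def using homeomorphic_imp_continuous_map continuous_map_in_subtopology by blast

lemma quad_image: "Q \<in> quads D \<Longrightarrow> z \<in> unit_square \<Longrightarrow> Q z \<in> D"
  by (auto simp: quads_def)

lemma quad_inj: "Q \<in> quads D \<Longrightarrow> inj_on Q unit_square"
  using homeomorphic_imp_injective_map[of "top_of_set unit_square" "subtopology riemann_sphere (Q ` unit_square)" Q]
  by (simp add: quads_def)

lemma quad_continuous_metric: "Q \<in> quads D \<Longrightarrow> continuous_map (top_of_set unit_square) (pd.mtopology D) Q"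
  unfolding mtopology_point_dist
  by (auto simp: continuous_map_in_subtopology quad_continuous quad_image)

text \<open>Compactness of the square and the Hausdorff property of the sphere make a continuous
  injection a homeomorphism onto its image.\<close>

lemma quadsI:
  assumes "Q \<in> extensional unit_square" "continuous_map (top_of_set unit_square) riemann_sphere Q"
    "inj_on Q unit_square" "Q ` unit_square \<subseteq> D"
  shows "Q \<in> quads D"
proof -
  have "homeomorphic_map (top_of_set unit_square) (subtopology riemann_sphere (Q ` unit_square)) Q"
  proof (rule continuous_imp_homeomorphic_map)
    show "continuous_map (top_of_set unit_square) (subtopology riemann_sphere (Q ` unit_square)) Q"
      using assms(2) by (simp add: continuous_map_in_subtopology)
    show "compact_space (top_of_set unit_square)"
      using compact_unit_square by (simp add: compact_space_subtopology)
    show "Hausdorff_space (subtopology riemann_sphere (Q ` unit_square))"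
      using Hausdorff_riemann_sphere by (rule Hausdorff_space_subtopology)
  qed (use assms in \<open>auto simp: riemann_sphere_topspace\<close>)
  then show ?thesis using assms by (simp add: quads_def)
qed

text \<open>Only one of the two points is confined to the compact set, which permits comparison with
  points just outside the unit square. A Lebesgue number for a cover of \<open>S\<close> by sets of
  small oscillation works.\<close>

lemma continuous_map_uniform_at_compact:
  fixes P :: "'a::heine_borel \<Rightarrow> 'b"
  assumes M: "Metric_space M d" and P: "continuous_map (top_of_set A) (Metric_space.mtopology M d) P"
    and S: "compact S" "S \<subseteq> A" and "0 < e"
  obtains \<delta> where "0 < \<delta>" "\<And>x y. x \<in> S \<Longrightarrow> y \<in> A \<Longrightarrow> dist x y < \<delta> \<Longrightarrow> d (P x) (P y) < e"
proof -
  interpret Metric_space M d by (rule M)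
  define \<G> where "\<G> = {T. open T \<and> (\<exists>w\<in>S. \<forall>y\<in>A \<inter> T. P y \<in> mball (P w) (e / 2))}"
  have PM: "P y \<in> M" if "y \<in> A" for y
    using that continuous_map_image_subset_topspace[OF P] by auto
  have "S \<subseteq> \<Union>\<G>"
  proof
    fix w assume w: "w \<in> S"
    have "openin (top_of_set A) {y \<in> topspace (top_of_set A). P y \<in> mball (P w) (e / 2)}"
      by (rule openin_continuous_map_preimage[OF P openin_mball])
    then obtain T where T: "open T" "{y \<in> A. P y \<in> mball (P w) (e / 2)} = A \<inter> T"
      by (auto simp: openin_open)
    have "w \<in> A" using w S(2) by blast
    then have "w \<in> {y \<in> A. P y \<in> mball (P w) (e / 2)}" using \<open>0 < e\<close> PM by simp
    then have "w \<in> T" unfolding T(2) by blast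
    moreover have "T \<in> \<G>" unfolding \<G>_def using T w by blast
    ultimately show "w \<in> \<Union>\<G>" by blast
  qed
  moreover have "open T" if "T \<in> \<G>" for T using that by (simp add: \<G>_def)
  ultimately obtain \<delta> where \<delta>: "0 < \<delta>" "\<And>x. x \<in> S \<Longrightarrow> \<exists>T\<in>\<G>. ball x \<delta> \<subseteq> T"
    using Heine_Borel_lemma[OF S(1)] by metis
  show thesis
  proof (rule that[OF \<delta>(1)])
    fix x y assume xy: "x \<in> S" "y \<in> A" "dist x y < \<delta>"
    obtain T where T: "T \<in> \<G>" "ball x \<delta> \<subseteq> T" using \<delta>(2)[OF xy(1)] by blast
    then obtain w where w: "w \<in> S" "\<forall>y\<in>A \<inter> T. P y \<in> mball (P w) (e / 2)" by (auto simp: \<G>_def)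
    have "x \<in> A \<inter> T" "y \<in> A \<inter> T" using T(2) xy S(2) \<delta>(1) by auto
    then have "P x \<in> mball (P w) (e / 2)" "P y \<in> mball (P w) (e / 2)" using w(2) by blast+
    then show "d (P x) (P y) < e" using triangle[of "P x" "P w" "P y"] commute[of "P x" "P w"] by simp
  qed
qed

text \<open>The images of both quads are compact, hence bounded; this gives the supremum in
  \<open>quad_dist\<close> its meaning.\<close>

lemma quad_dist_bdd:
  assumes "Q1 \<in> quads D" "Q2 \<in> quads D"
  shows "bdd_above ((\<lambda>z. point_dist D (Q1 z) (Q2 z)) ` unit_square)"
proof -
  have "compactin (pd.mtopology D) (Q ` unit_square)" if "Q \<in> quads D" for Q
    by (rule image_compactin[OF _ quad_continuous_metric[OF that]])
      (simp add: compactin_subtopology compact_unit_square)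
  then have "pd.mbounded D (Q1 ` unit_square \<union> Q2 ` unit_square)"
    using assms by (simp add: pd.mbounded_Un pd.compactin_imp_mbounded)
  then have "\<exists>B. \<forall>x\<in>Q1 ` unit_square \<union> Q2 ` unit_square. \<forall>y\<in>Q1 ` unit_square \<union> Q2 ` unit_square. point_dist D x y \<le> B"
    unfolding pd.mbounded_alt by (rule conjunct2)
  then obtain B where "\<forall>x\<in>Q1 ` unit_square \<union> Q2 ` unit_square. \<forall>y\<in>Q1 ` unit_square \<union> Q2 ` unit_square. point_dist D x y \<le> B" ..
  then show ?thesis by (intro bdd_aboveI[of _ B]) auto
qed

lemma point_dist_le_quad_dist:
  assumes "Q1 \<in> quads D" "Q2 \<in> quads D" "z \<in> unit_square"
  shows "point_dist D (Q1 z) (Q2 z) \<le> quad_dist D Q1 Q2"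
  using cSUP_upper[OF assms(3) quad_dist_bdd[OF assms(1,2)]] assms by (simp add: quad_dist_def)

lemma quad_dist_le:
  assumes "Q1 \<in> quads D" "Q2 \<in> quads D" "\<And>z. z \<in> unit_square \<Longrightarrow> point_dist D (Q1 z) (Q2 z) \<le> e"
  shows "quad_dist D Q1 Q2 \<le> e"
  using cSUP_least[OF unit_square_nonempty assms(3)] assms(1,2) by (simp add: quad_dist_def)

lemma Metric_space_quad_dist: "Metric_space (quads D) (quad_dist D)"
proof
  obtain z0 where z0: "z0 \<in> unit_square" using unit_square_nonempty by blast
  show "0 \<le> quad_dist D Q1 Q2" for Q1 Q2
  proof (cases "Q1 \<in> quads D \<and> Q2 \<in> quads D")
    case True
    then show ?thesis using point_dist_le_quad_dist[of Q1 D Q2 z0] z0 pd.nonneg order_trans by blast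
  next
    case False
    then show ?thesis by (auto simp: quad_dist_def)
  qed
  show "quad_dist D Q1 Q2 = quad_dist D Q2 Q1" for Q1 Q2
    by (simp add: quad_dist_def pd.commute)
  show "quad_dist D Q1 Q2 = 0 \<longleftrightarrow> Q1 = Q2" if Q: "Q1 \<in> quads D" "Q2 \<in> quads D" for Q1 Q2
  proof
    assume 0: "quad_dist D Q1 Q2 = 0"
    have "Q1 z = Q2 z" if "z \<in> unit_square" for z
      using point_dist_le_quad_dist[OF Q that] 0 pd.nonneg[of D "Q1 z" "Q2 z"] pd.zero quad_image Q that
      by (metis antisym)
    then show "Q1 = Q2" using Q by (intro extensionalityI[of _ unit_square]) (auto simp: quads_def)
  next
    assume "Q1 = Q2"
    then have "quad_dist D Q1 Q2 \<le> 0" using Q by (intro quad_dist_le) (auto simp: quad_image)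
    moreover have "0 \<le> quad_dist D Q1 Q2"
      using point_dist_le_quad_dist[OF Q z0] pd.nonneg order_trans by blast
    ultimately show "quad_dist D Q1 Q2 = 0" by simp
  qed
  show "quad_dist D Q1 Q3 \<le> quad_dist D Q1 Q2 + quad_dist D Q2 Q3"
    if Q: "Q1 \<in> quads D" "Q2 \<in> quads D" "Q3 \<in> quads D" for Q1 Q2 Q3
  proof (rule quad_dist_le[OF Q(1,3)])
    fix z assume z: "z \<in> unit_square"
    have "point_dist D (Q1 z) (Q3 z) \<le> point_dist D (Q1 z) (Q2 z) + point_dist D (Q2 z) (Q3 z)"
      using Q z by (intro pd.triangle) (auto simp: quad_image)
    then show "point_dist D (Q1 z) (Q3 z) \<le> quad_dist D Q1 Q2 + quad_dist D Q2 Q3"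
      using point_dist_le_quad_dist[OF Q(1,2) z] point_dist_le_quad_dist[OF Q(2,3) z] by linarith
  qed
qed

interpretation qd: Metric_space "quads D" "quad_dist D" for D
  by (rule Metric_space_quad_dist)

lemma second_countable_mtopology:
  assumes M: "Metric_space M d"
    and nets: "\<And>e. 0 < e \<Longrightarrow> \<exists>C. countable C \<and> C \<subseteq> M \<and> (\<forall>x\<in>M. \<exists>c\<in>C. d c x < e)"
  shows "second_countable (Metric_space.mtopology M d)"
proof -
  interpret Metric_space M d by (rule M)
  define \<epsilon> where "\<epsilon> n = inverse (real (Suc n))" for n
  have \<epsilon>: "0 < \<epsilon> n" for n by (simp add: \<epsilon>_def)
  obtain C where C: "\<And>n. countable (C n)" "\<And>n. C n \<subseteq> M" "\<And>n x. x \<in> M \<Longrightarrow> \<exists>c\<in>C n. d c x < \<epsilon> n"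
    using nets[OF \<epsilon>] by metis
  let ?B = "\<Union>n. (\<lambda>c. mball c (\<epsilon> n)) ` C n"
  have base: "\<exists>V\<in>?B. x \<in> V \<and> V \<subseteq> U" if U: "openin mtopology U" "x \<in> U" for U x
  proof -
    obtain e where e: "e > 0" "mball x e \<subseteq> U" using U unfolding openin_mtopology by blast
    have xM: "x \<in> M" using openin_subset[OF U(1)] U(2) by auto
    obtain n where n: "\<epsilon> n < e / 2" using reals_Archimedean[of "e / 2"] e(1) by (auto simp: \<epsilon>_def)
    obtain c where c: "c \<in> C n" "d c x < \<epsilon> n" using C(3)[OF xM] by blast
    have cM: "c \<in> M" using c(1) C(2) by blast
    have "mball c (\<epsilon> n) \<subseteq> mball x e"
    proof
      fix y assume y: "y \<in> mball c (\<epsilon> n)"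
      then show "y \<in> mball x e"
        using triangle[of x c y] commute[of x c] c(2) n xM by simp
    qed
    moreover have "x \<in> mball c (\<epsilon> n)" using c(2) cM xM by simp
    ultimately show ?thesis using c(1) e(2) by blast
  qed
  show ?thesis
    unfolding second_countable_def
  proof (intro exI[of _ ?B] conjI)
    show "countable ?B" using C(1) by blast
  qed (use base in auto)
qed

text \<open>Quads are sorted by discrete data: an index \<open>n\<close> for the modulus of
  continuity at scale \<open>\<epsilon>\<close>, and approximate values, from a countable dense set,
  on a finite net of the square. One quad is picked for each combination that occurs, and any two
  quads sharing the same data are within \<open>4 * \<epsilon>\<close>.\<close>

lemma second_countable_quad_topology: "second_countable (quad_topology D)"
  unfolding quad_topology_def
proof (rule second_countable_mtopology[OF Metric_space_quad_dist])
  fix e :: real assume "0 < e"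
  \<comment> \<open>Going from \<open>c z\<close> to \<open>Q z\<close> takes four steps of size
    \<open>\<epsilon>\<close>; the fifth share makes the bound strict.\<close>
  define \<epsilon> where "\<epsilon> = e / 5"
  have \<epsilon>: "0 < \<epsilon>" using \<open>0 < e\<close> by (simp add: \<epsilon>_def)
  obtain Z where Z: "countable Z" "Z \<subseteq> D" "\<And>x. x \<in> D \<Longrightarrow> \<exists>z\<in>Z. point_dist D x z < \<epsilon>"
    using countable_dense_point_dist[of D] \<epsilon> by metis
  have "\<exists>G. finite G \<and> G \<subseteq> unit_square \<and> unit_square \<subseteq> (\<Union>x\<in>G. ball x (inverse (real (Suc n))))" for n
  proof (rule compactE_image[OF compact_unit_square, of unit_square "\<lambda>x. ball x (inverse (real (Suc n)))"])
    show "unit_square \<subseteq> (\<Union>x\<in>unit_square. ball x (inverse (real (Suc n))))" by (auto simp del: of_nat_Suc)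
  qed auto
  then obtain G where G: "\<And>n. finite (G n)" "\<And>n. G n \<subseteq> unit_square"
      "\<And>n. unit_square \<subseteq> (\<Union>x\<in>G n. ball x (inverse (real (Suc n))))"
    by metis
  define P where "P n \<sigma> Q \<longleftrightarrow> Q \<in> quads D \<and> (\<forall>g\<in>G n. point_dist D (Q g) (\<sigma> g) < \<epsilon>) \<and>
     (\<forall>z\<in>unit_square. \<forall>w\<in>unit_square. dist z w < inverse (real (Suc n)) \<longrightarrow> point_dist D (Q z) (Q w) < \<epsilon>)" for n \<sigma> Q
  define C where "C = {(SOME Q. P n \<sigma> Q) | n \<sigma>. \<sigma> \<in> G n \<rightarrow>\<^sub>E Z \<and> (\<exists>Q. P n \<sigma> Q)}"
  have "C \<subseteq> (\<Union>n. (\<lambda>\<sigma>. SOME Q. P n \<sigma> Q) ` (G n \<rightarrow>\<^sub>E Z))" by (auto simp: C_def)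
  moreover have "countable (\<Union>n. (\<lambda>\<sigma>. SOME Q. P n \<sigma> Q) ` (G n \<rightarrow>\<^sub>E Z))"
    using G(1) Z(1) by (intro countable_UN countable_image countable_PiE) auto
  ultimately have "countable C" by (rule countable_subset)
  moreover have "C \<subseteq> quads D"
  proof
    fix c assume "c \<in> C"
    then obtain n \<sigma> where "c = (SOME Q. P n \<sigma> Q)" "\<exists>Q. P n \<sigma> Q" by (auto simp: C_def)
    then have "P n \<sigma> c" using someI_ex by metis
    then show "c \<in> quads D" by (simp add: P_def)
  qed
  moreover have "\<exists>c\<in>C. quad_dist D c Q < e" if Q: "Q \<in> quads D" for Q
  proof -
    obtain \<delta> where \<delta>: "0 < \<delta>" "\<And>x y. x \<in> unit_square \<Longrightarrow> y \<in> unit_square \<Longrightarrow> dist x y < \<delta> \<Longrightarrow> point_dist D (Q x) (Q y) < \<epsilon>"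
      using continuous_map_uniform_at_compact[OF Metric_space_point_dist quad_continuous_metric[OF Q]
          compact_unit_square order_refl \<epsilon>] by metis
    obtain n where n: "inverse (real (Suc n)) < \<delta>" using reals_Archimedean[OF \<delta>(1)] by blast
    have "\<exists>z\<in>Z. point_dist D (Q g) z < \<epsilon>" if "g \<in> G n" for g
      using Z(3) quad_image[OF Q] G(2) that by blast
    then obtain \<sigma>0 where \<sigma>0: "\<And>g. g \<in> G n \<Longrightarrow> \<sigma>0 g \<in> Z \<and> point_dist D (Q g) (\<sigma>0 g) < \<epsilon>" by metis
    define \<sigma> where "\<sigma> = restrict \<sigma>0 (G n)"
    have \<sigma>: "\<sigma> \<in> G n \<rightarrow>\<^sub>E Z" using \<sigma>0 by (auto simp: \<sigma>_def)
    have PQ: "P n \<sigma> Q"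
      unfolding P_def using Q \<sigma>0 \<delta>(2) n by (auto simp: \<sigma>_def intro: less_trans)
    define c where "c = (SOME Q. P n \<sigma> Q)"
    have Pc: "P n \<sigma> c" unfolding c_def by (rule someI[of "P n \<sigma>", OF PQ])
    then have cQ: "c \<in> quads D" by (simp add: P_def)
    have "c \<in> C" unfolding C_def c_def using \<sigma> PQ by blast
    moreover have "quad_dist D c Q \<le> 4 * \<epsilon>"
    proof (rule quad_dist_le[OF cQ Q])
      fix z assume z: "z \<in> unit_square"
      then obtain g where g: "g \<in> G n" "dist g z < inverse (real (Suc n))" using G(3)[of n] by auto
      have gs: "g \<in> unit_square" using g(1) G(2) by blast
      have mem: "c z \<in> D" "c g \<in> D" "Q z \<in> D" "Q g \<in> D" "\<sigma> g \<in> D"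
        using quad_image cQ Q z gs \<sigma> g(1) Z(2) by auto
      have "point_dist D (c g) (c z) < \<epsilon>" "point_dist D (c g) (\<sigma> g) < \<epsilon>"
        using Pc g gs z unfolding P_def by blast+
      moreover have "point_dist D (Q g) (Q z) < \<epsilon>" "point_dist D (Q g) (\<sigma> g) < \<epsilon>"
        using PQ g gs z unfolding P_def by blast+
      moreover have "point_dist D (c z) (Q z) \<le> point_dist D (c z) (c g) + point_dist D (c g) (Q z)"
        "point_dist D (c g) (Q z) \<le> point_dist D (c g) (\<sigma> g) + point_dist D (\<sigma> g) (Q z)"
        "point_dist D (\<sigma> g) (Q z) \<le> point_dist D (\<sigma> g) (Q g) + point_dist D (Q g) (Q z)"
        using mem pd.triangle by blast+
      ultimately show "point_dist D (c z) (Q z) \<le> 4 * \<epsilon>"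
        using pd.commute[of D "c z" "c g"] pd.commute[of D "\<sigma> g" "Q g"] by linarith
    qed
    ultimately show ?thesis using \<open>0 < e\<close> by (intro bexI[of _ c]) (auto simp: \<epsilon>_def)
  qed
  ultimately show "\<exists>C. countable C \<and> C \<subseteq> quads D \<and> (\<forall>Q\<in>quads D. \<exists>c\<in>C. quad_dist D c Q < e)"
    by blast
qed

section \<open>Charts around a quad and approximation from below\<close>

text \<open>\<open>P\<close> and \<open>T\<close> form a chart in which \<open>Q\<close> is the
  identity of the unit square. Its domain is open in the sphere, so that nearby quads lie in it
  too.\<close>

lemma quad_extends:
  assumes Q: "Q \<in> quads D"
  obtains P T where "continuous_map euclidean riemann_sphere P" "openin riemann_sphere (range P)"
    "continuous_map (subtopology riemann_sphere (range P)) euclidean T"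
    "\<And>z::real \<times> real. T (P z) = z" "\<And>z. z \<in> unit_square \<Longrightarrow> P z = Q z"
proof -
  let ?e = inv_stereographic
  define f where "f = inv ?e"
  have fe: "f (?e p) = p" for p unfolding f_def using inj_inv_stereographic by (rule inv_f_f)
  have ef: "?e (f x) = x" if "x \<in> sphere 0 1" for x
    unfolding f_def using that surj_inv_stereographic by (intro f_inv_into_f) simp
  have contf: "continuous_map (top_of_set (sphere 0 1)) riemann_sphere f"
  proof -
    obtain g where g: "homeomorphic_maps riemann_sphere (top_of_set (sphere 0 1)) ?e g"
      using homeomorphic_map_inv_stereographic homeomorphic_map_maps by blast
    have "g x = f x" if "x \<in> sphere 0 1" for x
      using g ef[OF that] unfolding homeomorphic_maps_def riemann_sphere_topspace by (metis UNIV_I)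
    moreover have "continuous_map (top_of_set (sphere 0 1)) riemann_sphere g"
      using g by (simp add: homeomorphic_maps_def)
    ultimately show ?thesis by (rule continuous_map_eq[rotated]) simp
  qed
  define q where "q z = ?e (Q z)" for z
  have "continuous_map (top_of_set unit_square) euclidean (?e \<circ> Q)"
    using quad_continuous[OF Q] continuous_map_inv_stereographic by (rule continuous_map_compose)
  then have "continuous_on unit_square q" by (simp add: q_def[abs_def] o_def)
  moreover have "inj_on q unit_square"
    using quad_inj[OF Q] inj_inv_stereographic by (auto simp: inj_on_def q_def)
  moreover have "q ` unit_square \<subseteq> sphere 0 1" using norm_inv_stereographic by (auto simp: q_def)
  ultimately obtain r R where r: "continuous_on UNIV r" "openin (top_of_set (sphere 0 1)) (range r)"
    "continuous_on (range r) R" "\<And>z. R (r z) = z" "\<And>z. z \<in> unit_square \<Longrightarrow> r z = q z"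
    using square_embedding_extends by blast
  have "range r \<subseteq> sphere 0 1" using openin_subset[OF r(2)] by simp
  then have rS: "r z \<in> sphere 0 1" for z by blast
  have mem: "p \<in> range (\<lambda>z. f (r z)) \<longleftrightarrow> ?e p \<in> range r" for p
  proof
    assume "p \<in> range (\<lambda>z. f (r z))"
    then show "?e p \<in> range r" using ef[OF rS] by auto
  next
    assume "?e p \<in> range r"
    then obtain z where "?e p = r z" by blast
    then have "p = f (r z)" using fe[of p] by simp
    then show "p \<in> range (\<lambda>z. f (r z))" by blast
  qed
  show thesis
  proof (rule that[of "\<lambda>z. f (r z)" "\<lambda>p. R (?e p)"])
    have "continuous_map euclidean (top_of_set (sphere 0 1)) r"
      using r(1) rS by (auto simp: continuous_map_in_subtopology)
    then show "continuous_map euclidean riemann_sphere (\<lambda>z. f (r z))"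
      using continuous_map_compose[OF _ contf] by (simp add: o_def)
    have "openin riemann_sphere {p \<in> topspace riemann_sphere. ?e p \<in> range r}"
      by (rule openin_continuous_map_preimage[OF homeomorphic_imp_continuous_map[OF homeomorphic_map_inv_stereographic] r(2)])
    moreover have "{p \<in> topspace riemann_sphere. ?e p \<in> range r} = range (\<lambda>z. f (r z))"
      using mem by (auto simp: riemann_sphere_topspace)
    ultimately show "openin riemann_sphere (range (\<lambda>z. f (r z)))" by simp
    have "continuous_map (subtopology riemann_sphere (range (\<lambda>z. f (r z)))) (top_of_set (range r)) ?e"
      using continuous_map_inv_stereographic mem
      by (auto simp: continuous_map_in_subtopology intro: continuous_map_from_subtopology)
    moreover have "continuous_map (top_of_set (range r)) euclidean R" using r(3) by simp
    ultimately have "continuous_map (subtopology riemann_sphere (range (\<lambda>z. f (r z)))) euclidean (R \<circ> ?e)"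
      by (rule continuous_map_compose)
    then show "continuous_map (subtopology riemann_sphere (range (\<lambda>z. f (r z)))) euclidean (\<lambda>p. R (?e p))"
      by (simp only: o_def)
    show "R (?e (f (r z))) = z" for z using ef[OF rS] r(4) by simp
    show "f (r z) = Q z" if "z \<in> unit_square" for z using r(5)[OF that] fe by (simp add: q_def)
  qed
qed

text \<open>A Lebesgue number for the compact image of \<open>Q\<close>, covered by chart preimages
  of small balls. The two applications take \<open>a\<close> to be the identity, for the given quad,
  and \<open>stretch \<delta>\<close>, for the quad below it.\<close>

lemma nearby_quads_in_chart:
  assumes P: "openin riemann_sphere (range P)"
    and T: "continuous_map (subtopology riemann_sphere (range P)) euclidean T" "\<And>z::real \<times> real. T (P z) = z"
    and Q: "Q \<in> quads D" "\<And>z. z \<in> unit_square \<Longrightarrow> Q z = P (a z)" and "0 < \<eta>"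
  obtains \<rho> where "0 < \<rho>" "\<And>Q' z. Q' \<in> quads D \<Longrightarrow> quad_dist D Q Q' < \<rho> \<Longrightarrow> z \<in> unit_square \<Longrightarrow>
    Q' z \<in> range P \<and> dist (T (Q' z)) (a z) < \<eta>"
proof -
  define U where "U w = {p \<in> range P. T p \<in> ball w (\<eta> / 2)} \<inter> D" for w
  have openU: "openin (pd.mtopology D) (U w)" for w
  proof -
    have "openin (subtopology riemann_sphere (range P)) {p \<in> topspace (subtopology riemann_sphere (range P)). T p \<in> ball w (\<eta> / 2)}"
      by (rule openin_continuous_map_preimage[OF T(1)]) simp
    then have "openin riemann_sphere {p \<in> range P. T p \<in> ball w (\<eta> / 2)}"
      using P by (simp add: riemann_sphere_topspace openin_open_subtopology)
    then show ?thesis unfolding U_def mtopology_point_dist openin_subtopology by blast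
  qed
  have comp: "compactin (pd.mtopology D) (Q ` unit_square)"
    by (rule image_compactin[OF _ quad_continuous_metric[OF Q(1)]])
      (simp add: compactin_subtopology compact_unit_square)
  have "Q ` unit_square \<subseteq> \<Union> (range U)"
  proof
    fix p assume "p \<in> Q ` unit_square"
    then obtain z where z: "z \<in> unit_square" "p = Q z" by blast
    then have "p \<in> U (a z)" using quad_image[OF Q(1) z(1)] Q(2)[OF z(1)] T(2) \<open>0 < \<eta>\<close> by (simp add: U_def)
    then show "p \<in> \<Union> (range U)" by blast
  qed
  then obtain \<rho> where \<rho>: "\<rho> > 0" "\<And>x. x \<in> Q ` unit_square \<Longrightarrow> \<exists>V\<in>range U. pd.mball D x \<rho> \<subseteq> V"
    using pd.lebesgue_number[OF comp, of "range U"] openU by blast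
  show thesis
  proof (rule that[OF \<rho>(1)])
    fix Q' z assume Q': "Q' \<in> quads D" "quad_dist D Q Q' < \<rho>" and z: "z \<in> unit_square"
    obtain w where w: "pd.mball D (Q z) \<rho> \<subseteq> U w" using \<rho>(2) z by blast
    have "point_dist D (Q z) (Q' z) < \<rho>"
      using point_dist_le_quad_dist[OF Q(1) Q'(1) z] Q'(2) by simp
    then have "Q' z \<in> pd.mball D (Q z) \<rho>" using quad_image Q(1) Q'(1) z by simp
    then have 1: "Q' z \<in> U w" using w by blast
    have "Q z \<in> pd.mball D (Q z) \<rho>" using quad_image[OF Q(1) z] \<rho>(1) by simp
    then have 2: "Q z \<in> U w" using w by blast
    have "dist w (T (Q' z)) < \<eta> / 2" "dist w (a z) < \<eta> / 2"
      using 1 2 T(2) Q(2)[OF z] by (auto simp: U_def)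
    then show "Q' z \<in> range P \<and> dist (T (Q' z)) (a z) < \<eta>"
      using 1 dist_triangle_half_r[of w "T (Q' z)" \<eta> "a z"] by (simp add: U_def)
  qed
qed

text \<open>In the chart a crossing of \<open>Q2\<close> becomes a continuum in a strip that comes
  within \<open>\<eta>\<close> of both vertical sides, which is the situation of
  \<open>stretched_square_crossing\<close>; \<open>P\<close> transports the result back.\<close>

lemma quad_le_of_chart:
  assumes P: "continuous_map euclidean riemann_sphere P" 
    and T: "continuous_map (subtopology riemann_sphere (range P)) euclidean T" "\<And>z::real \<times> real. T (P z) = z"
    and \<delta>: "0 < \<delta>" "\<delta> \<le> 1/4" and \<eta>: "0 < \<eta>" "\<eta> \<le> \<delta> / 4"
    and Q1: "Q1 \<in> quads D" "\<And>z. z \<in> unit_square \<Longrightarrow> Q1 z \<in> range P \<and> dist (T (Q1 z)) (stretch \<delta> z) < \<eta>"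
    and Q2: "Q2 \<in> quads D" "\<And>z. z \<in> unit_square \<Longrightarrow> Q2 z \<in> range P \<and> dist (T (Q2 z)) z < \<eta>"
  shows "quad_le Q1 Q2"
  unfolding quad_le_def
proof (intro allI impI)
  fix K assume K: "crossing Q2 K"
  have PT: "P (T p) = p" if "p \<in> range P" for p using that T(2) by auto
  have KP: "K \<subseteq> range P" using K Q2(2) by (auto simp: crossing_def)
  have "compact (T ` K)"
    using image_compactin[OF _ T(1), of K] K KP by (simp add: crossing_def compactin_subtopology)
  have "connected (T ` K)"
    using connectedin_continuous_map_image[OF T(1), of K] K KP by (simp add: crossing_def connectedin_subtopology)
  have bounds: "- \<eta> \<le> snd p \<and> snd p \<le> 1 + \<eta>" if "p \<in> T ` K" for p
  proof -
    have "K \<subseteq> Q2 ` unit_square" using K by (simp add: crossing_def)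
    with that obtain z where z: "z \<in> unit_square" "p = T (Q2 z)" by blast
    then show ?thesis
      using dist_less_components(2)[of p z \<eta>] Q2(2)[OF z(1)] by (auto simp: unit_square_def)
  qed
  have "K \<inter> Q2 ` ({0} \<times> {0..1}) \<noteq> {}" "K \<inter> Q2 ` ({1} \<times> {0..1}) \<noteq> {}"
    using K by (simp_all add: crossing_def)
  then obtain l r where lr: "l \<in> {0} \<times> {0..1}" "Q2 l \<in> K" "r \<in> {1} \<times> {0..1}" "Q2 r \<in> K" by blast
  have "l \<in> unit_square" "r \<in> unit_square" "fst l = 0" "fst r = 1"
    using lr by (auto simp: unit_square_def)
  then have ends: "fst (T (Q2 l)) \<le> \<eta>" "1 - \<eta> \<le> fst (T (Q2 r))"
    using dist_less_components(1)[of "T (Q2 l)" l \<eta>] dist_less_components(1)[of "T (Q2 r)" r \<eta>] Q2(2)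
    by (auto simp: abs_less_iff)
  have contg: "continuous_on unit_square (\<lambda>z. T (Q1 z))"
  proof -
    have "continuous_map (top_of_set unit_square) (subtopology riemann_sphere (range P)) Q1"
      using quad_continuous[OF Q1(1)] Q1(2) by (auto simp: continuous_map_in_subtopology)
    from continuous_map_compose[OF this T(1)] show ?thesis by (simp add: o_def)
  qed
  have injg: "inj_on (\<lambda>z. T (Q1 z)) unit_square"
  proof (rule inj_onI)
    fix x y assume xy: "x \<in> unit_square" "y \<in> unit_square" "T (Q1 x) = T (Q1 y)"
    then have "Q1 x = Q1 y" using PT Q1(2) by metis
    then show "x = y" using inj_onD[OF quad_inj[OF Q1(1)]] xy by blast
  qed
  have near: "dist (T (Q1 z)) (stretch \<delta> z) < \<eta>" if "z \<in> unit_square" for z using Q1(2)[OF that] by blast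
  obtain L where L: "L \<subseteq> T ` K" "compact L" "connected L" "L \<subseteq> (\<lambda>z. T (Q1 z)) ` unit_square"
    "L \<inter> (\<lambda>z. T (Q1 z)) ` ({0} \<times> {0..1}) \<noteq> {}" "L \<inter> (\<lambda>z. T (Q1 z)) ` ({1} \<times> {0..1}) \<noteq> {}"
    using stretched_square_crossing[OF \<delta> \<eta> contg injg near \<open>compact (T ` K)\<close> \<open>connected (T ` K)\<close> bounds
        imageI[OF lr(2)] ends(1) imageI[OF lr(4)] ends(2)] by blast
  have PTQ: "P (T (Q1 z)) = Q1 z" if "z \<in> unit_square" for z using PT Q1(2)[OF that] by blast
  have side: "P ` L \<inter> Q1 ` S \<noteq> {}" if LS: "L \<inter> (\<lambda>z. T (Q1 z)) ` S \<noteq> {}" "S \<subseteq> unit_square" for S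
  proof -
    obtain z where z: "z \<in> S" "T (Q1 z) \<in> L" using LS(1) by blast
    then have "P (T (Q1 z)) = Q1 z" using PTQ LS(2) by blast
    then have "Q1 z \<in> P ` L" using z(2) by (metis imageI)
    then show ?thesis using z(1) by blast
  qed
  have "crossing Q1 (P ` L)"
    unfolding crossing_def
  proof (intro conjI)
    show "connectedin riemann_sphere (P ` L)"
      using connectedin_continuous_map_image[OF P, of L] L(3) by simp
    show "compactin riemann_sphere (P ` L)"
      using image_compactin[OF _ P, of L] L(2) by simp
    show "P ` L \<subseteq> Q1 ` unit_square"
    proof (rule image_subsetI)
      fix x assume "x \<in> L"
      then obtain z where "z \<in> unit_square" "x = T (Q1 z)" using L(4) by blast
      then show "P x \<in> Q1 ` unit_square" using PTQ by simp
    qed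
    show "P ` L \<inter> Q1 ` ({0} \<times> {0..1}) \<noteq> {}" by (rule side[OF L(5)]) (auto simp: unit_square_def)
    show "P ` L \<inter> Q1 ` ({1} \<times> {0..1}) \<noteq> {}" by (rule side[OF L(6)]) (auto simp: unit_square_def)
  qed
  moreover have "P ` L \<subseteq> K"
  proof (rule image_subsetI)
    fix x assume "x \<in> L"
    then obtain k where "k \<in> K" "x = T k" using L(1) by blast
    then show "P x \<in> K" using PT[of k] KP by auto
  qed
  ultimately show "\<exists>L. crossing Q1 L \<and> L \<subseteq> K" by blast
qed

text \<open>Here openness of \<open>D\<close> enters: the stretched square is taller than the unit
  square, and its image under the chart must still lie in \<open>D\<close>.\<close>

proposition quad_approximated_from_below:
  assumes D: "openin riemann_sphere D" and Q: "Q \<in> quads D" and "0 < e"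
  obtains Q' where "Q' \<in> quads D" "quad_dist D Q Q' < e" "quad_less D Q' Q"
proof -
  obtain P T where P: "continuous_map euclidean riemann_sphere P" "openin riemann_sphere (range P)"
    and T: "continuous_map (subtopology riemann_sphere (range P)) euclidean T" "\<And>z::real \<times> real. T (P z) = z"
    and PQ: "\<And>z. z \<in> unit_square \<Longrightarrow> P z = Q z"
    using quad_extends[OF Q] by blast
  define A where "A = {z. P z \<in> D}"
  have "open A"
    using openin_continuous_map_preimage[OF P(1) D] by (simp add: A_def)
  have sqA: "unit_square \<subseteq> A" using PQ quad_image[OF Q] by (auto simp: A_def)
  have "continuous_map (top_of_set A) (pd.mtopology D) P"
    unfolding mtopology_point_dist using P(1)
    by (auto simp: continuous_map_in_subtopology A_def intro: continuous_map_from_subtopology)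
  moreover have "0 < e / 2" using \<open>0 < e\<close> by simp
  ultimately obtain d1 where d1: "0 < d1" "\<And>x y. x \<in> unit_square \<Longrightarrow> y \<in> A \<Longrightarrow> dist x y < d1 \<Longrightarrow> point_dist D (P x) (P y) < e / 2"
    using continuous_map_uniform_at_compact[OF Metric_space_point_dist _ compact_unit_square sqA] by metis
  obtain d2 where d2: "0 < d2" "\<And>x. x \<in> unit_square \<Longrightarrow> ball x d2 \<subseteq> A"
    using Heine_Borel_lemma[OF compact_unit_square, of "{A}"] sqA \<open>open A\<close> by auto
  \<comment> \<open>\<open>stretch \<delta>\<close> moves points by at most
    \<open>2 * \<delta>\<close>, and the division by 3 keeps this strictly below \<open>d1\<close>
    and \<open>d2\<close>. The bound \<open>d1\<close> controls the distance between the quads,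
    \<open>d2\<close> keeps the new quad in \<open>D\<close>.\<close>
  define \<delta> where "\<delta> = min (1/4) (min d1 d2 / 3)"
  have \<delta>: "0 < \<delta>" "\<delta> \<le> 1/4" "2 * \<delta> < d1" "2 * \<delta> < d2" using d1(1) d2(1) by (auto simp: \<delta>_def min_def)
  have near: "dist z (stretch \<delta> z) < d1" "dist z (stretch \<delta> z) < d2" if "z \<in> unit_square" for z
    using dist_stretch[OF that \<delta>(1)] \<delta>(3,4) by auto
  have inA: "stretch \<delta> z \<in> A" if "z \<in> unit_square" for z using near(2)[OF that] d2(2)[OF that] by auto
  define Q' where "Q' = restrict (\<lambda>z. P (stretch \<delta> z)) unit_square"
  have Q'eq: "Q' z = P (stretch \<delta> z)" if "z \<in> unit_square" for z using that by (simp add: Q'_def)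
  have Q': "Q' \<in> quads D"
  proof (rule quadsI)
    show "Q' \<in> extensional unit_square" by (simp add: Q'_def)
    have "continuous_map (top_of_set unit_square) riemann_sphere (\<lambda>z. P (stretch \<delta> z))"
      using continuous_map_compose[OF _ P(1), of "top_of_set unit_square" "stretch \<delta>"] continuous_on_stretch
      by (simp add: o_def)
    then show "continuous_map (top_of_set unit_square) riemann_sphere Q'"
      by (rule continuous_map_eq) (simp add: Q'eq)
    show "inj_on Q' unit_square"
    proof (rule inj_onI)
      fix x y assume xy: "x \<in> unit_square" "y \<in> unit_square" "Q' x = Q' y"
      then have "T (P (stretch \<delta> x)) = T (P (stretch \<delta> y))" by (simp add: Q'eq)
      then have "stretch \<delta> x = stretch \<delta> y" using T(2) by simp
      then show "x = y" using inj_stretch[of \<delta>] \<delta>(1,2) by (auto dest: injD)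
    qed
    show "Q' ` unit_square \<subseteq> D" using inA by (auto simp: Q'eq A_def)
  qed
  have "quad_dist D Q Q' \<le> e / 2"
    using d1(2) inA near(1) PQ Q'eq by (intro quad_dist_le[OF Q Q']) (metis less_imp_le)
  then have "quad_dist D Q Q' < e" using \<open>0 < e\<close> by simp
  moreover have "quad_less D Q' Q"
  proof -
    \<comment> \<open>The largest tolerance that \<open>quad_le_of_chart\<close> admits.\<close>
    define \<eta> where "\<eta> = \<delta> / 4"
    have \<eta>: "0 < \<eta>" "\<eta> \<le> \<delta> / 4" using \<delta>(1) by (auto simp: \<eta>_def)
    obtain \<rho>1 where \<rho>1: "0 < \<rho>1" "\<And>Q1 z. Q1 \<in> quads D \<Longrightarrow> quad_dist D Q' Q1 < \<rho>1 \<Longrightarrow> z \<in> unit_square \<Longrightarrow>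
        Q1 z \<in> range P \<and> dist (T (Q1 z)) (stretch \<delta> z) < \<eta>"
      using nearby_quads_in_chart[OF P(2) T Q' Q'eq \<eta>(1)] by blast
    obtain \<rho>2 where \<rho>2: "0 < \<rho>2" "\<And>Q2 z. Q2 \<in> quads D \<Longrightarrow> quad_dist D Q Q2 < \<rho>2 \<Longrightarrow> z \<in> unit_square \<Longrightarrow>
        Q2 z \<in> range P \<and> dist (T (Q2 z)) z < \<eta>"
      using nearby_quads_in_chart[OF P(2) T Q, of "\<lambda>z. z"] PQ \<eta>(1) by metis
    have "quad_le Q1 Q2" if "Q1 \<in> qd.mball D Q' \<rho>1" "Q2 \<in> qd.mball D Q \<rho>2" for Q1 Q2
    proof (rule quad_le_of_chart[OF P(1) T \<delta>(1,2) \<eta>])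
      show "Q1 \<in> quads D" "Q2 \<in> quads D" using that by auto
      show "Q1 z \<in> range P \<and> dist (T (Q1 z)) (stretch \<delta> z) < \<eta>" if "z \<in> unit_square" for z
        using \<rho>1(2)[OF _ _ that] \<open>Q1 \<in> qd.mball D Q' \<rho>1\<close> by simp
      show "Q2 z \<in> range P \<and> dist (T (Q2 z)) z < \<eta>" if "z \<in> unit_square" for z
        using \<rho>2(2)[OF _ _ that] \<open>Q2 \<in> qd.mball D Q \<rho>2\<close> by simp
    qed
    moreover have "Q' \<in> qd.mball D Q' \<rho>1" "Q \<in> qd.mball D Q \<rho>2" using Q Q' \<rho>1(1) \<rho>2(1) by auto
    ultimately show ?thesis
      unfolding quad_less_def quad_topology_def using qd.openin_mball by blast
  qed
  ultimately show thesis using that Q' by blast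
qed

lemma quad_le_trans: "quad_le Q1 Q2 \<Longrightarrow> quad_le Q2 Q3 \<Longrightarrow> quad_le Q1 Q3"
  unfolding quad_le_def by (meson order_trans)

lemma open_order_quads:
  assumes D: "openin riemann_sphere D"
  shows "open_order (quad_topology D) (quad_less D)"
proof
  show "\<exists>U V. openin (quad_topology D) U \<and> openin (quad_topology D) V \<and> Q1 \<in> U \<and> Q2 \<in> V \<and>
      (\<forall>u\<in>U. \<forall>v\<in>V. quad_less D u v)" if less: "quad_less D Q1 Q2" for Q1 Q2
  proof -
    obtain U V where UV: "openin (quad_topology D) U" "openin (quad_topology D) V" "Q1 \<in> U" "Q2 \<in> V"
      "\<forall>u\<in>U. \<forall>v\<in>V. quad_le u v" using less unfolding quad_less_def by blast
    then have "\<forall>u\<in>U. \<forall>v\<in>V. quad_less D u v" unfolding quad_less_def by blast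
    then show ?thesis using UV by blast
  qed
  show "quad_less D Q1 Q3" if "quad_less D Q1 Q2" "quad_less D Q2 Q3" for Q1 Q2 Q3
  proof -
    obtain U V where UV: "openin (quad_topology D) U" "openin (quad_topology D) V" "Q1 \<in> U" "Q2 \<in> V"
      "\<forall>u\<in>U. \<forall>v\<in>V. quad_le u v" using \<open>quad_less D Q1 Q2\<close> unfolding quad_less_def by blast
    obtain U' V' where UV': "openin (quad_topology D) U'" "openin (quad_topology D) V'" "Q2 \<in> U'" "Q3 \<in> V'"
      "\<forall>u\<in>U'. \<forall>v\<in>V'. quad_le u v" using \<open>quad_less D Q2 Q3\<close> unfolding quad_less_def by blast
    \<comment> \<open>\<open>Q2\<close> itself, which lies in both \<open>V\<close> and
      \<open>U'\<close>, serves as the intermediate quad.\<close>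
    have "\<forall>u\<in>U. \<forall>v\<in>V'. quad_le u v" using UV(4,5) UV'(3,5) quad_le_trans by blast
    then show ?thesis unfolding quad_less_def using UV(1,3) UV'(2,4) by blast
  qed
  show "\<exists>Q'\<in>U. quad_less D Q' Q" if U: "openin (quad_topology D) U" "Q \<in> U" for U Q
  proof -
    obtain e where e: "0 < e" "qd.mball D Q e \<subseteq> U" "Q \<in> quads D"
      using U unfolding quad_topology_def qd.openin_mtopology by blast
    obtain Q' where "Q' \<in> quads D" "quad_dist D Q Q' < e" "quad_less D Q' Q"
      using quad_approximated_from_below[OF D e(3,1)] .
    then show ?thesis using e by (intro bexI[of _ Q']) auto
  qed
qed

proposition closed_lower_topology_properties:
  assumes D: "openin riemann_sphere D"
  shows "compact_space (closed_lower_topology D)" "Hausdorff_space (closed_lower_topology D)"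
    "second_countable (closed_lower_topology D)"
proof -
  interpret open_order "quad_topology D" "quad_less D" by (rule open_order_quads[OF D])
  have top: "topspace (quad_topology D) = quads D" by (simp add: quad_topology_def)
  have "closed_lower_sets D = closed_lower"
    unfolding closed_lower_sets_def lower_set_def closed_lower_def top
    using closedin_subset[of "quad_topology D"] by (auto simp: top)
  then have "closed_lower_topology D = lower_topology"
    unfolding closed_lower_topology_def generators_def top by simp
  then show "compact_space (closed_lower_topology D)" "Hausdorff_space (closed_lower_topology D)"
    "second_countable (closed_lower_topology D)"
    using compact_lower_topology Hausdorff_lower_topology
      second_countable_lower_topology[OF second_countable_quad_topology] by simp_all
qed

theorem corollary1p15:
  fixes D :: "complex option set"
  assumes "openin riemann_sphere D" and "D \<noteq> {}"
  shows "compact_space (weak_star_topology (closed_lower_topology D))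
       \<and> metrizable_space (weak_star_topology (closed_lower_topology D))
       \<and> Hausdorff_space (weak_star_topology (closed_lower_topology D))"
  using weak_star_topology_compact_metrizable[OF closed_lower_topology_properties[OF assms(1)]] by blast

end
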